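(* Let $n\ge1$ and $1\le p<\infty$. Let $w\in L^1_{\rm loc}(\mathbb{R}^n)$, $w>0$ a.e., be such that $d\mu=w\,dx$ is a Borel doubling measure. Assume that $\mu$ supports an $L^p$ Poincaré inequality, that is, $$\Big(\frac1{\mu(B)}\int_B|f-m_Bf|^p\,d\mu\Big)^{1/p}\le C\,r(B)\Big(\frac1{\mu(B)}\int_B|\nabla f|^p\,d\mu\Big)^{1/p}$$ for all locally Lipschitz functions $f$ and all balls $B$ with radius $r(B)$. Assume that $f\in\mathcal{S}$ is such that $\|\nabla f\|_{L^p(\mu)}<\infty$. Let $\alpha>0$. Then one can find a collection of balls $\{B_i\}_i$, smooth functions $\{b_i\}_i$ and a function $g\in L^1_{\rm loc}(\mathbb{R}^n,\mu)$ such that $$f=g+\sum_ib_i$$ and the following properties hold: $$|\nabla g(x)|\le C\alpha\quad\text{for }\mu\text{-a.e. }x,$$ $$\operatorname{supp}b_i\subset B_i\quad\text{and}\quad\int_{B_i}|\nabla b_i|^p\,d\mu\le C\alpha^p\mu(B_i),$$ $$\sum_i\mu(B_i)\le C\alpha^{-p}\int_{\mathbb{R}^n}|\nabla f|^p\,d\mu,$$ $$\sum_i\mathbf{1}_{B_i}\le N,$$ where $C$ and $N$ depend only on the dimension, the doubling constant of $\mu$ and $p$. If furthermore $\mu$ supports an $L^p$--$L^q$ Poincaré inequality with $p\le q<\infty$, that is, $$\Big(\frac1{\mu(B)}\int_B|f-m_Bf|^q\,d\mu\Big)^{1/q}\le C\,r(B)\Big(\frac1{\mu(B)}\int_B|\nabla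 f|^p\,d\mu\Big)^{1/p}$$ for all locally Lipschitz $f$ and all balls $B$, then $$\Big(\frac1{\mu(B_i)}\int_{B_i}|b_i|^q\,d\mu\Big)^{1/q}\lesssim\alpha\,r(B_i).$$
   Context: $\mathcal{S}$ is the Schwartz class on $\mathbb{R}^n$. $\mu$ doubling: there is a constant (the doubling constant) $C_0$ with $\mu(2B)\le C_0\mu(B)<\infty$ for all balls $B$. $m_Bf=\frac1{\mu(B)}\int_Bf\,d\mu$ is the average of $f$ on $B$ with respect to $\mu$. $\mathbf{1}_E$ is the indicator function of $E$. $w$ is not assumed to be a Muckenhoupt weight. The gradient of $g$ exists $\mu$-a.e. (equivalently Lebesgue-a.e.); $g$ is a.e. equal to a Lipschitz function $\tilde g$ and $\nabla g$ coincides a.e. with the distributional gradient of $\tilde g$. The symbol $\lesssim$ means inequality up to a constant independent of $f$, $\alpha$ and $i$. Balls may be freely replaced by cubes.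
   Formalization: The constant C is allowed to depend also on the constant in the L^p Poincaré inequality, besides the dimension, the doubling constant and p; without this the claim is false. N depends only on the dimension, the doubling constant and p. *)

theory Defs
  imports "HOL-Analysis.Analysis"
begin

text \<open>All functions on \<open>\<real>\<^sup>n\<close> (realised as \<^typ>\<open>real ^ 'n\<close>) are complex-valued, as is usual for the Schwartz class.\<close>

definition partial :: "'n \<Rightarrow> (real ^ 'n::finite \<Rightarrow> complex) \<Rightarrow> real ^ 'n \<Rightarrow> complex" where
  "partial j f x = frechet_derivative f (at x) (axis j 1)"

text \<open>The value at points of non-differentiability is irrelevant: the gradient is only used for
  functions that are differentiable almost everywhere. The norm on \<^typ>\<open>complex ^ 'n\<close> is the
  Hermitian one, so \<open>norm (grad f x)\<close> is \<open>(\<Sum>\<^sub>j |\<partial>\<^sub>j f x|^2)^(1/2)\<close>.\<close>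

definition grad :: "(real ^ 'n::finite \<Rightarrow> complex) \<Rightarrow> real ^ 'n \<Rightarrow> complex ^ 'n" where
  "grad f x = (if f differentiable (at x) then (\<chi> j. partial j f x) else 0)"

text \<open>A multi-index is represented by a list of directions.\<close>

primrec partials :: "'n list \<Rightarrow> (real ^ 'n::finite \<Rightarrow> complex) \<Rightarrow> real ^ 'n \<Rightarrow> complex" where
  "partials [] f = f"
| "partials (j # js) f = partial j (partials js f)"

definition smooth :: "(real ^ 'n::finite \<Rightarrow> complex) \<Rightarrow> bool" where
  "smooth f \<longleftrightarrow> (\<forall>js x. partials js f differentiable (at x))"

definition supp :: "(real ^ 'n::finite \<Rightarrow> complex) \<Rightarrow> (real ^ 'n) set" where
  "supp f = closure {x. f x \<noteq> 0}"

definition schwartz :: "(real ^ 'n::finite \<Rightarrow> complex) \<Rightarrow> bool" where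
  "schwartz f \<longleftrightarrow> smooth f \<and>
     (\<forall>k::nat. \<forall>js. \<exists>A. \<forall>x. (1 + norm x) ^ k * norm (partials js f x) \<le> A)"

definition locally_integrable ::
    "'a::euclidean_space measure \<Rightarrow> ('a \<Rightarrow> 'b::{banach, second_countable_topology}) \<Rightarrow> bool" where
  "locally_integrable M f \<longleftrightarrow> f \<in> borel_measurable M \<and> (\<forall>K. compact K \<longrightarrow> set_integrable M K f)"

definition locally_lipschitz :: "(real ^ 'n::finite \<Rightarrow> complex) \<Rightarrow> bool" where
  "locally_lipschitz f \<longleftrightarrow> (\<forall>x. \<exists>\<epsilon>>0. \<exists>L. L-lipschitz_on (ball x \<epsilon>) f)"

definition distributional_gradient ::
    "(real ^ 'n::finite \<Rightarrow> complex) \<Rightarrow> (real ^ 'n \<Rightarrow> complex ^ 'n) \<Rightarrow> bool" where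
  "distributional_gradient u G \<longleftrightarrow>
     locally_integrable lborel u \<and> locally_integrable lborel G \<and>
     (\<forall>\<phi> j. smooth \<phi> \<and> compact (supp \<phi>) \<longrightarrow>
        (LINT x|lborel. u x * partial j \<phi> x) = - (LINT x|lborel. G x $ j * \<phi> x))"

definition weighted :: "(real ^ 'n::finite \<Rightarrow> real) \<Rightarrow> (real ^ 'n) measure" where
  "weighted w = density lborel (\<lambda>x. ennreal (w x))"

definition doubling :: "(real ^ 'n::finite) measure \<Rightarrow> real \<Rightarrow> bool" where
  "doubling M C0 \<longleftrightarrow> (\<forall>x. \<forall>r>0.
     emeasure M (ball x (2 * r)) \<le> ennreal C0 * emeasure M (ball x r) \<and>
     emeasure M (ball x r) < \<infinity>)"

definition average ::
    "'a measure \<Rightarrow> 'a set \<Rightarrow> ('a \<Rightarrow> 'b::{banach, second_countable_topology}) \<Rightarrow> 'b" where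
  "average M B f = (1 / measure M B) *\<^sub>R (LINT x:B|M. f x)"

text \<open>The \<open>L\<^sup>p\<close>--\<open>L\<^sup>q\<close> Poincare inequality with constant \<open>C\<close>; \<open>q = p\<close> gives the \<open>L\<^sup>p\<close> Poincare
  inequality.\<close>

definition poincare :: "(real ^ 'n::finite) measure \<Rightarrow> real \<Rightarrow> real \<Rightarrow> real \<Rightarrow> bool" where
  "poincare M p q C \<longleftrightarrow> (\<forall>f x. \<forall>r>0. locally_lipschitz f \<longrightarrow>
     (average M (ball x r) (\<lambda>y. norm (f y - average M (ball x r) f) powr q)) powr (1 / q)
       \<le> C * r * (average M (ball x r) (\<lambda>y. norm (grad f y) powr p)) powr (1 / p))"

text \<open>\<open>|\<nabla>g| \<le> K\<close> almost everywhere. Pointwise a.e. differentiability alone would admit Cantor-type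
  functions, so it is also required that \<open>g\<close> agrees a.e. with a Lipschitz function whose
  distributional gradient is \<open>\<nabla>g\<close>.\<close>

definition gradient_bounded ::
    "(real ^ 'n::finite) measure \<Rightarrow> (real ^ 'n \<Rightarrow> complex) \<Rightarrow> real \<Rightarrow> bool" where
  "gradient_bounded M g K \<longleftrightarrow>
     (AE x in M. g differentiable (at x) \<and> norm (grad g x) \<le> K) \<and>
     (\<exists>h L G. L-lipschitz_on UNIV h \<and> (AE x in M. g x = h x) \<and>
        distributional_gradient h G \<and> (AE x in M. grad g x = G x))"

end

theory Submission
  imports Defs
begin

text \<open>
  Let \<open>U\<close> be the set where the uncentred maximal function of \<open>|\<nabla>f|\<^sup>p\<close> exceeds \<open>\<alpha>\<^sup>p\<close>. Vitali's covering
  lemma bounds \<open>\<mu>(U)\<close>, and since a doubling measure on \<open>\<real>\<^sup>n\<close> is infinite, \<open>U\<close> has a nonempty complement.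
  Take a Whitney covering of \<open>U\<close> by balls \<open>B\<^sub>i\<close>, a subordinate smooth partition of unity \<open>\<psi>\<^sub>i\<close>, and
  \<open>b\<^sub>i = (f - m\<^sub>i) \<psi>\<^sub>i\<close> with \<open>m\<^sub>i\<close> the average of \<open>f\<close> over \<open>B\<^sub>i\<close>. Enlarged Whitney balls meet the complement of
  \<open>U\<close>, so \<open>|\<nabla>f|\<^sup>p\<close> has average at most \<open>C \<alpha>\<^sup>p\<close> on \<open>B\<^sub>i\<close>, and the Poincare inequality controls \<open>b\<^sub>i\<close> as well as
  \<open>\<nabla>g = \<Sum> (m\<^sub>i - m) \<nabla>\<psi>\<^sub>i\<close> on \<open>U\<close>.

  No Rademacher theorem is needed to differentiate \<open>g\<close> outside \<open>U\<close>: there \<open>g - f\<close> is bounded by a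
  multiple of the distance to the complement of \<open>U\<close>, which by the weak type estimate is \<open>o(|y - x|)\<close> at
  almost every point \<open>x\<close> of that complement. Hence \<open>\<nabla>g = \<nabla>f\<close>, of norm at most \<open>\<alpha>\<close>, at these points.
\<close>

section \<open>Smooth functions\<close>

text \<open>Two kinds of constants are kept apart. The quantitative bounds use only the dimension,
  \<open>p\<close>, the doubling constant and the Poincare constant. The supremum of |grad f|,
  finite because \<open>f\<close> is Schwartz, enters only qualitatively: it makes \<open>g\<close>
  globally Lipschitz and gives differentiability outside \<open>U\<close>. The Lipschitz property in
  turn supplies the distributional gradient, since bounded difference quotients pass to the limit
  under the integral. All radii are fractions of the distance \<open>d\<close> to the complement of
  \<open>U\<close>, in one increasing chain: 1/20 (disjoint balls), 3/20 (covering), 9/40 = 3/2 *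
  3/20 (support of the bumps), 1/4 (the balls of the theorem), 1/3 (indices active near a point).
  Each gap pays for one strict inclusion, and the powers of the doubling constant come from
  comparing balls of such sizes. The partition of unity is a telescoping product rather than a
  quotient by the sum of the bumps, so no lower bound for a denominator is needed.\<close>

lemma smooth_coinduct:
  assumes "P f" "\<And>f x. P f \<Longrightarrow> f differentiable (at x)" "\<And>f j. P f \<Longrightarrow> P (partial j f)"
  shows "smooth f"
proof -
  have "P (partials js f)" for js by (induction js) (auto simp: assms)
  then show ?thesis unfolding smooth_def using assms(2) by blast
qed

lemma partials_partial: "partials js (partial j f) = partials (js @ [j]) f"
  by (induction js) auto

lemma smooth_partial: "smooth f \<Longrightarrow> smooth (partial j f)"
  unfolding smooth_def partials_partial by blast

lemma smooth_differentiable: "smooth f \<Longrightarrow> f differentiable (at x)"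
  unfolding smooth_def by (metis partials.simps(1))

lemma smooth_continuous: "smooth f \<Longrightarrow> continuous_on S f"
  by (meson continuous_at_imp_continuous_on differentiable_imp_continuous_within smooth_differentiable)

lemma partial_has_derivative:
  "(f has_derivative f') (at x) \<Longrightarrow> partial j f x = f' (axis j 1)"
  unfolding partial_def by (metis frechet_derivative_at)

lemma differentiable_has_derivative:
  "f differentiable (at x) \<Longrightarrow> (f has_derivative frechet_derivative f (at x)) (at x)"
  by (simp add: frechet_derivative_works)

lemma partial_add:
  assumes "f differentiable (at x)" "g differentiable (at x)"
  shows "partial j (\<lambda>x. f x + g x) x = partial j f x + partial j g x"
  using partial_has_derivative[OF has_derivative_add[OF assms[THEN differentiable_has_derivative]]]
  by (simp add: partial_def)

lemma partial_mult:
  assumes "f differentiable (at x)" "g differentiable (at x)"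
  shows "partial j (\<lambda>x. f x * g x) x = f x * partial j g x + partial j f x * g x"
  using partial_has_derivative[OF has_derivative_mult[OF assms[THEN differentiable_has_derivative]]]
  by (simp add: partial_def)

lemma smooth_const [simp]: "smooth (\<lambda>x. a)"
proof (rule smooth_coinduct[where P="\<lambda>f. \<exists>a. f = (\<lambda>x. a)"])
  have *: "partial j (\<lambda>x. a) = (\<lambda>x. 0)" for j :: "'b::finite" and a
    by (rule ext) (subst partial_has_derivative[OF has_derivative_const], simp)
  show "\<exists>a. partial j f = (\<lambda>x. a)" if "\<exists>a. f = (\<lambda>x. a)" for f and j :: "'b::finite"
    using that * by metis
qed auto

text \<open>For \<open>P = 1\<close> this is the classical function exp (-1/t), flat at 0. The
  polynomial factor in 1/t is there so that the family contains the derivatives of its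
  members.\<close>

definition flat :: "real poly \<Rightarrow> real \<Rightarrow> real" where
  "flat P t = (if t > 0 then poly P (inverse t) * exp (- inverse t) else 0)"

text \<open>The extra power \<open>x ^ k\<close> is what the induction needs:
  \<open>pCons a P\<close> stands for a + x P, and the factor x is passed on to the
  exponent.\<close>

lemma poly_exp_tendsto_0: "((\<lambda>x. x ^ k * poly P x * exp (- x)) \<longlongrightarrow> (0::real)) at_top"
proof (induction P arbitrary: k)
  case 0
  then show ?case by simp
next
  case (pCons a P)
  have "((\<lambda>x. a * (x ^ k / exp x) + x ^ Suc k * poly P x * exp (- x)) \<longlongrightarrow> a * 0 + 0) at_top"
    by (intro tendsto_intros tendsto_power_div_exp_0 pCons.IH)
  moreover have "(\<lambda>x. a * (x ^ k / exp x) + x ^ Suc k * poly P x * exp (- x))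
      = (\<lambda>x. x ^ k * poly (pCons a P) x * exp (- x))"
    by (rule ext) (simp add: exp_minus field_simps)
  ultimately show ?case by simp
qed

text \<open>In the variable s = 1/t the operator d/dt is - s^2 d/ds, which sends P(s) exp(-s) to s^2
  (P - P')(s) exp(-s); \<open>[:0,0,1:]\<close> is s^2. Only t = 0 needs an argument of its own:
  there the exponential beats every polynomial.\<close>

lemma flat_has_derivative:
  "(flat P has_real_derivative flat ([:0,0,1:] * (P - pderiv P)) t) (at t)"
proof -
  consider "t > 0" | "t < 0" | "t = 0" by linarith
  then show ?thesis
  proof cases
    case 1
    have "((\<lambda>t. poly P (inverse t) * exp (- inverse t)) has_real_derivative
        flat ([:0,0,1:] * (P - pderiv P)) t) (at t)"
      using 1 by (auto intro!: derivative_eq_intros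
          simp: flat_def algebra_simps power2_eq_square)
    then show ?thesis
      by (rule has_field_derivative_transform_within_open[where S="{0<..}"])
        (use 1 in \<open>auto simp: flat_def\<close>)
  next
    case 2
    have "((\<lambda>t. 0) has_real_derivative 0) (at t)" by simp
    then have "(flat P has_real_derivative 0) (at t)"
      by (rule has_field_derivative_transform_within_open[where S="{..<0}"])
        (use 2 in \<open>auto simp: flat_def\<close>)
    then show ?thesis using 2 by (simp add: flat_def)
  next
    case 3
    have "((\<lambda>h. inverse h ^ 1 * poly P (inverse h) * exp (- inverse h)) \<longlongrightarrow> 0) (at_right (0::real))"
      by (rule filterlim_compose[OF poly_exp_tendsto_0 filterlim_inverse_at_top_right])
    then have R: "((\<lambda>h. flat P h / h) \<longlongrightarrow> 0) (at_right 0)"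
      by (rule tendsto_cong[THEN iffD1, rotated])
        (auto simp: eventually_at_filter flat_def field_simps)
    have "((\<lambda>h::real. 0::real) \<longlongrightarrow> 0) (at_left 0)" by simp
    then have L: "((\<lambda>h. flat P h / h) \<longlongrightarrow> 0) (at_left 0)"
      by (rule tendsto_cong[THEN iffD1, rotated])
        (auto simp: eventually_at_filter flat_def)
    have "((\<lambda>h. flat P h / h) \<longlongrightarrow> 0) (at 0)"
      using L R by (simp add: filterlim_split_at_real)
    then show ?thesis
      unfolding 3 DERIV_def by (simp add: flat_def)
  qed
qed

text \<open>The functions \<open>flat P \<circ> u\<close> and the smooth functions generate an algebra that is closed under
  partial derivatives, so coinduction applies.\<close>

inductive smooth_alg :: "(real ^ 'n::finite \<Rightarrow> real) \<Rightarrow> (real ^ 'n \<Rightarrow> complex) \<Rightarrow> bool" for u where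
  base: "smooth f \<Longrightarrow> smooth_alg u f"
| comp: "smooth_alg u (\<lambda>x. of_real (flat P (u x)))"
| add: "smooth_alg u f \<Longrightarrow> smooth_alg u g \<Longrightarrow> smooth_alg u (\<lambda>x. f x + g x)"
| mult: "smooth_alg u f \<Longrightarrow> smooth_alg u g \<Longrightarrow> smooth_alg u (\<lambda>x. f x * g x)"

lemma has_derivative_flat_comp:
  assumes "(u has_derivative u') (at x)"
  shows "((\<lambda>x. complex_of_real (flat P (u x))) has_derivative
    (\<lambda>v. of_real (flat ([:0,0,1:] * (P - pderiv P)) (u x)) * of_real (u' v))) (at x)"
proof -
  have "((\<lambda>x. flat P (u x)) has_derivative (\<lambda>v. flat ([:0,0,1:] * (P - pderiv P)) (u x) * u' v)) (at x)"
    using has_derivative_compose[OF assms flat_has_derivative[unfolded has_field_derivative_def]]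
    by (simp add: o_def)
  from has_derivative_of_real[OF this, where 'a=complex] show ?thesis by simp
qed

lemma smooth_of_real_has_derivative:
  assumes "smooth (\<lambda>x. complex_of_real (u x))"
  obtains u' where "(u has_derivative u') (at x)"
    "\<And>j. partial j (\<lambda>x. complex_of_real (u x)) x = of_real (u' (axis j 1))"
proof -
  obtain U where U: "((\<lambda>x. complex_of_real (u x)) has_derivative U) (at x)"
    using smooth_differentiable[OF assms] differentiable_has_derivative by blast
  have u: "(u has_derivative (\<lambda>v. Re (U v))) (at x)"
    using bounded_linear.has_derivative[OF bounded_linear_Re U] by simp
  show ?thesis
    by (rule that[OF u], rule partial_has_derivative) (rule has_derivative_of_real[OF u])
qed

lemma smooth_alg_smooth:
  assumes "smooth_alg u f" and u: "smooth (\<lambda>x. complex_of_real (u x))"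
  shows "smooth f"
proof (rule smooth_coinduct[where P="smooth_alg u"])
  show "smooth_alg u f" by fact
  show D: "f differentiable (at x)" if "smooth_alg u f" for f x
    using that
  proof induction
    case (comp P)
    obtain u' where "(u has_derivative u') (at x)"
      using smooth_of_real_has_derivative[OF u] by blast
    from has_derivative_flat_comp[OF this] show ?case
      unfolding differentiable_def by blast
  qed (auto intro: smooth_differentiable)
  show "smooth_alg u (partial j f)" if "smooth_alg u f" for f j
    using that
  proof induction
    case (base f)
    then show ?case by (simp add: smooth_alg.base smooth_partial)
  next
    case (comp P)
    have "partial j (\<lambda>x. complex_of_real (flat P (u x))) x =
        of_real (flat ([:0,0,1:] * (P - pderiv P)) (u x)) * partial j (\<lambda>x. complex_of_real (u x)) x" for x
    proof -
      obtain u' where u': "(u has_derivative u') (at x)"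
        "partial j (\<lambda>x. complex_of_real (u x)) x = of_real (u' (axis j 1))"
        using smooth_of_real_has_derivative[OF u] by blast
      from partial_has_derivative[OF has_derivative_flat_comp[OF this(1)]]
      show ?thesis unfolding u'(2) .
    qed
    then have "partial j (\<lambda>x. complex_of_real (flat P (u x))) =
        (\<lambda>x. of_real (flat ([:0,0,1:] * (P - pderiv P)) (u x)) * partial j (\<lambda>x. complex_of_real (u x)) x)"
      by blast
    then show ?case
      by (simp only:) (intro smooth_alg.mult smooth_alg.comp smooth_alg.base smooth_partial u)
  next
    case (add f g)
    have "partial j (\<lambda>x. f x + g x) = (\<lambda>x. partial j f x + partial j g x)"
      using add.hyps by (intro ext partial_add D)
    then show ?case using add.IH by (simp add: smooth_alg.add)
  next
    case (mult f g)
    have "partial j (\<lambda>x. f x * g x) = (\<lambda>x. f x * partial j g x + partial j f x * g x)"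
      using mult.hyps by (intro ext partial_mult D)
    then show ?case using mult by (simp add: smooth_alg.add smooth_alg.mult)
  qed
qed

text \<open>The algebra over \<open>u = 0\<close> contains all smooth functions, so its stability
  under sums and products passes to them without a Leibniz formula for iterated derivatives.\<close>

lemma smooth_zero_alg: "smooth_alg (\<lambda>x. 0) f \<Longrightarrow> smooth f"
  by (erule smooth_alg_smooth) simp

lemma smooth_add: "smooth f \<Longrightarrow> smooth g \<Longrightarrow> smooth (\<lambda>x. f x + g x)"
  by (rule smooth_zero_alg) (intro smooth_alg.intros)

lemma smooth_mult: "smooth f \<Longrightarrow> smooth g \<Longrightarrow> smooth (\<lambda>x. f x * g x)"
  by (rule smooth_zero_alg) (intro smooth_alg.intros)

lemma smooth_diff: "smooth f \<Longrightarrow> smooth g \<Longrightarrow> smooth (\<lambda>x. f x - g x)"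
  using smooth_add[of f "\<lambda>x. (-1) * g x"] smooth_mult[of "\<lambda>x. -1" g] by simp

lemma smooth_sum: "(\<And>i. i \<in> S \<Longrightarrow> smooth (f i)) \<Longrightarrow> smooth (\<lambda>x. \<Sum>i\<in>S. f i x)"
  by (induction S rule: infinite_finite_induct) (auto intro: smooth_add)

lemma smooth_prod: "(\<And>i. i \<in> S \<Longrightarrow> smooth (f i)) \<Longrightarrow> smooth (\<lambda>x. \<Prod>i\<in>S. f i x)"
  by (induction S rule: infinite_finite_induct) (auto intro: smooth_mult)

lemma smooth_flat_comp:
  "smooth (\<lambda>x. complex_of_real (u x)) \<Longrightarrow> smooth (\<lambda>x. complex_of_real (flat P (u x)))"
  by (rule smooth_alg_smooth[OF smooth_alg.comp])

lemma smooth_coordinate: "smooth (\<lambda>x::real^'n::finite. complex_of_real (x $ i))"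
proof -
  have d: "((\<lambda>x::real^'n. complex_of_real (x $ i)) has_derivative (\<lambda>v. complex_of_real (v $ i))) (at x)" for x
    by (intro has_derivative_of_real bounded_linear_imp_has_derivative bounded_linear_vec_nth)
  have p: "partial j (\<lambda>x. complex_of_real (x $ i)) = (\<lambda>x. complex_of_real (axis j 1 $ i))" for j
    by (rule ext) (rule partial_has_derivative[OF d])
  show ?thesis
  proof (rule smooth_coinduct[where P="\<lambda>f. f = (\<lambda>x. complex_of_real (x $ i)) \<or> smooth f"])
    show "f differentiable (at x)" if "f = (\<lambda>x. complex_of_real (x $ i)) \<or> smooth f" for f x
      using that d smooth_differentiable unfolding differentiable_def by blast
    show "partial j f = (\<lambda>x. complex_of_real (x $ i)) \<or> smooth (partial j f)"
      if "f = (\<lambda>x. complex_of_real (x $ i)) \<or> smooth f" for f j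
      using that by (auto simp: p smooth_partial)
  qed simp
qed

lemma smooth_norm_power2: "smooth (\<lambda>x. complex_of_real ((norm (x - c))\<^sup>2))"
proof -
  have "(\<lambda>x. complex_of_real ((norm (x - c))\<^sup>2)) =
      (\<lambda>x. \<Sum>i\<in>UNIV. (of_real (x $ i) - of_real (c $ i)) * (of_real (x $ i) - of_real (c $ i)))"
    by (rule ext) (simp add: power2_norm_eq_inner inner_vec_def)
  then show ?thesis
    by (simp only:) (intro smooth_sum smooth_mult smooth_diff smooth_coordinate smooth_const)
qed

section \<open>Gradients\<close>

lemma grad_nth: "f differentiable (at x) \<Longrightarrow> grad f x $ j = partial j f x"
  by (simp add: grad_def)

lemma norm_vec_le_sum: "norm (x :: complex ^ 'n) \<le> (\<Sum>i\<in>UNIV. norm (x $ i))"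
  unfolding norm_vec_def by (rule L2_set_le_sum) auto

lemma norm_grad_le:
  fixes f :: "real ^ 'n \<Rightarrow> complex"
  assumes "(f has_derivative f') (at x)" "\<And>v. norm (f' v) \<le> K * norm v"
  shows "norm (grad f x) \<le> real CARD('n) * K"
proof -
  have "f differentiable (at x)" using assms differentiable_def by blast
  then have "norm (grad f x) \<le> (\<Sum>i\<in>UNIV. norm (partial i f x))"
    using norm_vec_le_sum[of "grad f x"] by (simp add: grad_nth)
  also have "\<dots> \<le> (\<Sum>i\<in>(UNIV::'n set). K)"
    using assms(2)[of "axis _ 1"] by (intro sum_mono) (simp add: partial_has_derivative[OF assms(1)])
  finally show ?thesis by simp
qed

lemma derivative_eq_sum_partial:
  fixes f :: "real ^ 'n \<Rightarrow> complex"
  assumes "(f has_derivative f') (at x)"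
  shows "f' v = (\<Sum>j\<in>UNIV. v $ j *\<^sub>R partial j f x)"
proof -
  have "linear f'" using assms has_derivative_linear by blast
  then have "f' (\<Sum>j\<in>UNIV. v $ j *\<^sub>R axis j 1) = (\<Sum>j\<in>UNIV. v $ j *\<^sub>R f' (axis j 1))"
    by (simp add: linear_sum linear_cmul)
  moreover have "(\<Sum>j\<in>UNIV. v $ j *\<^sub>R axis j 1) = v"
    using basis_expansion[of v] by (simp add: scalar_mult_eq_scaleR)
  ultimately show ?thesis using partial_has_derivative[OF assms] by simp
qed

text \<open>Cauchy-Schwarz on the expansion into partial derivatives. Unlike the sum over
  coordinates in \<open>norm_grad_le\<close>, it costs no dimensional factor.\<close>

lemma norm_derivative_le_grad:
  fixes f :: "real ^ 'n \<Rightarrow> complex"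
  assumes "(f has_derivative f') (at x)"
  shows "norm (f' v) \<le> norm (grad f x) * norm v"
proof -
  have d: "f differentiable (at x)" using assms differentiable_def by blast
  have "norm (f' v) \<le> (\<Sum>j\<in>UNIV. \<bar>v $ j\<bar> * \<bar>norm (partial j f x)\<bar>)"
    unfolding derivative_eq_sum_partial[OF assms] by (rule norm_sum[THEN order_trans]) simp
  also have "\<dots> \<le> L2_set (\<lambda>j. v $ j) UNIV * L2_set (\<lambda>j. norm (partial j f x)) UNIV"
    by (rule L2_set_mult_ineq)
  also have "L2_set (\<lambda>j. norm (partial j f x)) UNIV = norm (grad f x)"
    by (simp add: norm_vec_def grad_nth[OF d])
  also have "L2_set (\<lambda>j. v $ j) UNIV = norm v"
    by (simp add: norm_vec_def L2_set_def)
  finally show ?thesis by (simp add: mult.commute)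
qed

lemma grad_bound_lipschitz:
  fixes f :: "real ^ 'n \<Rightarrow> complex"
  assumes "convex S" "\<And>z. z \<in> S \<Longrightarrow> f differentiable (at z)" "\<And>z. z \<in> S \<Longrightarrow> norm (grad f z) \<le> K"
    "x \<in> S" "y \<in> S"
  shows "norm (f x - f y) \<le> K * norm (x - y)"
proof (rule differentiable_bound[OF assms(1) _ _ assms(4,5)])
  show "(f has_derivative frechet_derivative f (at z)) (at z within S)" if "z \<in> S" for z
    using differentiable_has_derivative[OF assms(2)[OF that]] has_derivative_at_withinI by blast
  show "onorm (frechet_derivative f (at z)) \<le> K" if "z \<in> S" for z
  proof (rule onorm_le)
    fix v
    have "norm (frechet_derivative f (at z) v) \<le> norm (grad f z) * norm v"
      by (rule norm_derivative_le_grad[OF differentiable_has_derivative[OF assms(2)[OF that]]])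
    also have "\<dots> \<le> K * norm v" using assms(3)[OF that] by (simp add: mult_right_mono)
    finally show "norm (frechet_derivative f (at z) v) \<le> K * norm v" .
  qed
qed

lemma norm_grad_mult_le:
  fixes f g :: "real ^ 'n \<Rightarrow> complex"
  assumes "f differentiable (at x)" "g differentiable (at x)"
  shows "norm (grad (\<lambda>x. f x * g x) x) \<le> norm (f x) * norm (grad g x) + norm (grad f x) * norm (g x)"
proof -
  have *: "norm ((\<chi> j. c * v $ j) :: complex ^ 'n) = norm c * norm v" for c and v :: "complex ^ 'n"
    by (simp add: norm_vec_def norm_mult L2_set_right_distrib)
  have "grad (\<lambda>x. f x * g x) x = (\<chi> j. f x * grad g x $ j) + (\<chi> j. g x * grad f x $ j)"
    using assms by (simp add: vec_eq_iff grad_nth partial_mult)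
  then have "norm (grad (\<lambda>x. f x * g x) x) \<le> norm (\<chi> j. f x * grad g x $ j) + norm (\<chi> j. g x * grad f x $ j)"
    by (simp only:) (rule norm_triangle_ineq)
  then show ?thesis by (simp only: * mult.commute[of "norm (grad f x)"])
qed

lemma grad_add:
  assumes "f differentiable (at x)" "g differentiable (at x)"
  shows "grad (\<lambda>x. f x + g x) x = grad f x + grad g x"
  using assms by (simp add: vec_eq_iff grad_nth partial_add)

lemma has_derivative_zero_grad: "(f has_derivative (\<lambda>v. 0)) (at x) \<Longrightarrow> grad f x = 0"
  using partial_has_derivative[of f "\<lambda>v. 0" x] by (auto simp: grad_def vec_eq_iff)

lemma grad_const [simp]: "grad (\<lambda>x. a) x = 0"
  by (rule has_derivative_zero_grad) simp

lemma differentiable_sum_fun: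
  "(\<And>i. i \<in> S \<Longrightarrow> f i differentiable (at x)) \<Longrightarrow> (\<lambda>x. \<Sum>i\<in>S. f i x) differentiable (at x)"
  by (induction S rule: infinite_finite_induct) auto

lemma differentiable_prod_fun:
  fixes f :: "'i \<Rightarrow> real ^ 'n \<Rightarrow> complex"
  shows "(\<And>i. i \<in> S \<Longrightarrow> f i differentiable (at x)) \<Longrightarrow> (\<lambda>x. \<Prod>i\<in>S. f i x) differentiable (at x)"
  by (induction S rule: infinite_finite_induct) auto

lemma grad_sum:
  assumes "\<And>i. i \<in> S \<Longrightarrow> f i differentiable (at x)"
  shows "grad (\<lambda>x. \<Sum>i\<in>S. f i x) x = (\<Sum>i\<in>S. grad (f i) x)"
  using assms by (induction S rule: infinite_finite_induct) (auto simp: grad_add differentiable_sum_fun)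

lemma grad_cong_open:
  assumes "open S" "x \<in> S" "\<And>y. y \<in> S \<Longrightarrow> f y = g y"
  shows "grad f x = grad g x" "f differentiable (at x) \<longleftrightarrow> g differentiable (at x)"
proof -
  have *: "(f has_derivative D) (at x) \<longleftrightarrow> (g has_derivative D) (at x)" for D
    using has_derivative_transform_within_open[OF _ assms(1,2)] assms(3) by metis
  then show d: "f differentiable (at x) \<longleftrightarrow> g differentiable (at x)"
    by (simp add: differentiable_def)
  show "grad f x = grad g x"
    unfolding grad_def d partial_def frechet_derivative_def using * by simp
qed

text \<open>With every undifferentiated factor at most 1, the Leibniz rule leaves one gradient per
  factor. What counts is how many gradients are nonzero at x, not how many factors there are; this
  makes the long products in the partition of unity harmless.\<close>

lemma norm_grad_prod_le:
  fixes f :: "'i \<Rightarrow> real ^ 'n \<Rightarrow> complex"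
  assumes "finite S" "\<And>i. i \<in> S \<Longrightarrow> f i differentiable (at x)" "\<And>i. i \<in> S \<Longrightarrow> norm (f i x) \<le> 1"
  shows "norm (grad (\<lambda>x. \<Prod>i\<in>S. f i x) x) \<le> (\<Sum>i\<in>S. norm (grad (f i) x))"
  using assms
proof (induction S)
  case (insert a S)
  have "norm (\<Prod>i\<in>S. f i x) \<le> 1"
    using insert.prems by (auto simp: prod_norm[symmetric] intro!: prod_le_1)
  then have "norm (grad (f a) x) * norm (\<Prod>i\<in>S. f i x) \<le> norm (grad (f a) x)"
    by (simp add: mult_left_le)
  moreover have "norm (f a x) * norm (grad (\<lambda>x. \<Prod>i\<in>S. f i x) x) \<le> 1 * (\<Sum>i\<in>S. norm (grad (f i) x))"
    using insert by (intro mult_mono) auto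
  moreover have "norm (grad (\<lambda>x. f a x * (\<Prod>i\<in>S. f i x)) x) \<le>
      norm (f a x) * norm (grad (\<lambda>x. \<Prod>i\<in>S. f i x) x) + norm (grad (f a) x) * norm (\<Prod>i\<in>S. f i x)"
    using insert.prems by (intro norm_grad_mult_le differentiable_prod_fun) auto
  ultimately show ?case using insert.hyps by simp
qed simp

lemma continuous_on_grad: "smooth f \<Longrightarrow> continuous_on S (grad f)"
proof -
  assume f: "smooth f"
  have "grad f = (\<lambda>x. \<chi> j. partial j f x)"
    using smooth_differentiable[OF f] by (auto simp: grad_def)
  then show ?thesis
    by (simp only:) (intro continuous_on_vec_lambda smooth_continuous smooth_partial f)
qed

lemma schwartz_grad_bounded:
  assumes "schwartz f"
  obtains A where "0 \<le> A" "\<And>x. norm (grad f x) \<le> A"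
proof -
  have "\<forall>j. \<exists>A. \<forall>x. norm (partial j f x) \<le> A"
  proof
    fix j
    have "\<exists>A. \<forall>x. (1 + norm x) ^ 0 * norm (partials [j] f x) \<le> A"
      using assms unfolding schwartz_def by blast
    then show "\<exists>A. \<forall>x. norm (partial j f x) \<le> A" by simp
  qed
  then obtain A where A: "norm (partial j f x) \<le> A j" for j x by metis
  have d: "f differentiable (at x)" for x
    using assms smooth_differentiable unfolding schwartz_def by blast
  have B: "norm (grad f x) \<le> (\<Sum>j\<in>UNIV. A j)" for x
    by (rule order_trans[OF norm_vec_le_sum]) (intro sum_mono, simp add: grad_nth[OF d] A)
  then have "0 \<le> (\<Sum>j\<in>UNIV. A j)" using norm_ge_zero order_trans by blast
  with B show ?thesis using that by blast
qed

section \<open>Bump functions\<close>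

text \<open>\<open>exp 1 * flat 1\<close> vanishes for t \<le> 0 and is normalised to reach 1 at t =
  1. Inserting 1 minus this function into itself gives a smooth descent from 1 to 0 without a
  quotient of flat functions.\<close>

definition cutoff :: "real \<Rightarrow> real" where
  "cutoff t = exp 1 * flat 1 (1 - exp 1 * flat 1 t)"

text \<open>The squared norm is a polynomial, hence smooth at the centre as well. The transition
  takes place between the radii \<rho> and sqrt 2 * \<rho>; the latter is rounded up to 3/2 * \<rho>
  below.\<close>

definition bump :: "real ^ 'n \<Rightarrow> real \<Rightarrow> real ^ 'n \<Rightarrow> complex" where
  "bump c \<rho> x = of_real (cutoff ((norm (x - c))\<^sup>2 / \<rho>\<^sup>2 - 1))"

lemma flat_1_le: "0 \<le> flat 1 t" "t \<le> 1 \<Longrightarrow> exp 1 * flat 1 t \<le> 1" "t \<ge> 1 \<Longrightarrow> exp 1 * flat 1 t \<ge> 1"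
  by (auto simp: flat_def exp_add[symmetric] field_simps)

lemma cutoff_eq_1: "t \<le> 0 \<Longrightarrow> cutoff t = 1"
  by (simp add: cutoff_def flat_def exp_add[symmetric])

lemma cutoff_eq_0: "t \<ge> 1 \<Longrightarrow> cutoff t = 0"
  using flat_1_le(3)[of t] by (simp add: cutoff_def flat_def)

lemma cutoff_bounds: "0 \<le> cutoff t" "cutoff t \<le> 1"
  using flat_1_le(1)[of t] flat_1_le(1,2)[of "1 - exp 1 * flat 1 t"] by (auto simp: cutoff_def)

lemma smooth_bump: "smooth (bump c \<rho>)"
proof -
  have s: "smooth (\<lambda>x. complex_of_real ((norm (x - c))\<^sup>2 / \<rho>\<^sup>2 - 1))"
    using smooth_diff[OF smooth_mult[OF smooth_norm_power2 smooth_const[of "of_real (inverse (\<rho>\<^sup>2))"]] smooth_const[of 1]]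
    by (simp add: divide_inverse)
  have "smooth (\<lambda>x. complex_of_real (1 - exp 1 * flat 1 ((norm (x - c))\<^sup>2 / \<rho>\<^sup>2 - 1)))"
    using smooth_diff[OF smooth_const[of 1] smooth_mult[OF smooth_const[of "of_real (exp 1)"] smooth_flat_comp[OF s, of 1]]]
    by simp
  from smooth_mult[OF smooth_const[of "of_real (exp 1)"] smooth_flat_comp[OF this, of 1]]
  show ?thesis by (simp add: bump_def[abs_def] cutoff_def)
qed

lemma bump_eq_1: assumes "0 < \<rho>" "dist x c \<le> \<rho>" shows "bump c \<rho> x = 1"
proof -
  have "(norm (x - c))\<^sup>2 \<le> \<rho>\<^sup>2" using assms by (simp add: dist_norm power_mono)
  then show ?thesis using assms by (simp add: bump_def cutoff_eq_1)
qed

lemma bump_eq_0: assumes "0 < \<rho>" "dist x c \<ge> 3/2 * \<rho>" shows "bump c \<rho> x = 0"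
proof -
  have "(3/2 * \<rho>)\<^sup>2 \<le> (norm (x - c))\<^sup>2" using assms by (intro power_mono) (auto simp: dist_norm)
  moreover have "(3/2 * \<rho>)\<^sup>2 = 9/4 * \<rho>\<^sup>2" by (simp add: power2_eq_square)
  ultimately have "2 * \<rho>\<^sup>2 \<le> (norm (x - c))\<^sup>2" using zero_le_power2[of \<rho>] by linarith
  then show ?thesis using assms by (simp add: bump_def cutoff_eq_0 field_simps)
qed

lemma norm_bump: "norm (bump c \<rho> x) \<le> 1" "norm (1 - bump c \<rho> x) \<le> 1"
proof -
  have "1 - bump c \<rho> x = of_real (1 - cutoff ((norm (x - c))\<^sup>2 / \<rho>\<^sup>2 - 1))"
    by (simp add: bump_def)
  then show "norm (1 - bump c \<rho> x) \<le> 1" using cutoff_bounds by (simp only: norm_of_real) simp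
  show "norm (bump c \<rho> x) \<le> 1" using cutoff_bounds by (simp add: bump_def)
qed

lemma flat_deriv_bound: "\<bar>flat [:0,0,1:] t\<bar> \<le> 2"
proof (cases "t > 0")
  case True
  let ?s = "inverse t"
  have "1 + ?s + ?s\<^sup>2 / 2 \<le> exp ?s" using True by (intro exp_lower_Taylor_quadratic) simp
  moreover have "0 < ?s" using True by simp
  moreover have "?s\<^sup>2 = ?s * ?s" by (rule power2_eq_square)
  ultimately have "?s * ?s \<le> 2 * exp ?s" by linarith
  then show ?thesis using True by (simp add: flat_def exp_minus field_simps)
qed (simp add: flat_def)

text \<open>The chain rule yields two factors, each at most 2 exp 1. For t \<ge> 1 the outer
  \<open>flat\<close> is evaluated at a number \<le> 0, so the derivative is zero there.\<close>

lemma cutoff_has_derivative: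
  obtains D where "\<And>t. (cutoff has_real_derivative D t) (at t)" "\<And>t. \<bar>D t\<bar> \<le> (2 * exp 1)\<^sup>2"
    "\<And>t::real. t \<ge> 1 \<Longrightarrow> D t = 0"
proof -
  let ?F = "flat [:0,0,1:]"
  have F: "(flat 1 has_real_derivative ?F t) (at t)" for t
    using flat_has_derivative[of 1 t] by (simp add: pderiv_1)
  define D where "D t = exp 1 * (?F (1 - exp 1 * flat 1 t) * (- (exp 1 * ?F t)))" for t
  have "(cutoff has_real_derivative D t) (at t)" for t
    unfolding cutoff_def[abs_def] D_def
    by (rule DERIV_cmult, rule DERIV_chain2[OF F]) (auto intro!: derivative_eq_intros F)
  moreover have "\<bar>D t\<bar> \<le> (2 * exp 1)\<^sup>2" for t
  proof -
    have "\<bar>D t\<bar> = (exp 1)\<^sup>2 * (\<bar>?F (1 - exp 1 * flat 1 t)\<bar> * \<bar>?F t\<bar>)"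
      by (simp add: D_def abs_mult power2_eq_square)
    also have "\<dots> \<le> (exp 1)\<^sup>2 * (2 * 2)"
      by (intro mult_left_mono mult_mono flat_deriv_bound) auto
    finally show ?thesis by (simp add: power2_eq_square)
  qed
  moreover have "D t = 0" if "t \<ge> 1" for t
    using flat_1_le(3)[OF that] by (simp add: D_def flat_def[of _ "1 - _"])
  ultimately show ?thesis by (rule that)
qed

text \<open>Scaling: the inner function has gradient 2 (x - c) / \<rho>^2, of size at most 4 /
  \<rho> within distance 2 \<rho> of the centre, and beyond that the derivative of
  \<open>cutoff\<close> is zero. Hence one constant serves all centres and radii.\<close>

lemma grad_bump_bound:
  obtains K where "0 \<le> K"
    "\<And>c \<rho> x. 0 < \<rho> \<Longrightarrow> norm (grad (bump c \<rho> :: real ^ 'n::finite \<Rightarrow> complex) x) \<le> K / \<rho>"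
proof -
  obtain D where D: "\<And>t. (cutoff has_real_derivative D t) (at t)" "\<And>t. \<bar>D t\<bar> \<le> (2 * exp 1)\<^sup>2"
    "\<And>t. t \<ge> 1 \<Longrightarrow> D t = 0" using cutoff_has_derivative by blast
  define K where "K = (2 * exp 1)\<^sup>2 * (4::real)"
  have "norm (grad (bump c \<rho>) x) \<le> real CARD('n) * (K / \<rho>)" if \<rho>: "0 < \<rho>" for c \<rho> and x :: "real ^ 'n"
  proof (rule norm_grad_le)
    define t where "t = (norm (x - c))\<^sup>2 / \<rho>\<^sup>2 - 1"
    have "((\<lambda>x. (norm (x - c))\<^sup>2 / \<rho>\<^sup>2 - 1) has_derivative (\<lambda>v. 2 * ((x - c) \<bullet> v) / \<rho>\<^sup>2)) (at x)"
      unfolding power2_norm_eq_inner divide_inverse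
      by (auto intro!: derivative_eq_intros simp: inner_commute algebra_simps)
    from has_derivative_compose[OF this D(1)[unfolded has_field_derivative_def]]
    have "((\<lambda>x. cutoff ((norm (x - c))\<^sup>2 / \<rho>\<^sup>2 - 1)) has_derivative
      (\<lambda>v. D t * (2 * ((x - c) \<bullet> v) / \<rho>\<^sup>2))) (at x)" unfolding t_def by simp
    from has_derivative_of_real[OF this, where 'a=complex]
    show "(bump c \<rho> has_derivative (\<lambda>v. of_real (D t * (2 * ((x - c) \<bullet> v) / \<rho>\<^sup>2)))) (at x)"
      unfolding bump_def[abs_def] .
    fix v
    show "norm (of_real (D t * (2 * ((x - c) \<bullet> v) / \<rho>\<^sup>2)) :: complex) \<le> K / \<rho> * norm v"
    proof (cases "norm (x - c) \<le> 2 * \<rho>")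
      case True
      have "\<bar>(x - c) \<bullet> v\<bar> \<le> 2 * \<rho> * norm v"
        by (rule order_trans[OF Cauchy_Schwarz_ineq2]) (simp add: True mult_right_mono)
      then have "\<bar>2 * ((x - c) \<bullet> v) / \<rho>\<^sup>2\<bar> \<le> 4 * norm v / \<rho>"
        using \<rho> by (simp add: abs_mult power2_eq_square field_simps)
      then have "\<bar>D t\<bar> * \<bar>2 * ((x - c) \<bullet> v) / \<rho>\<^sup>2\<bar> \<le> (2 * exp 1)\<^sup>2 * (4 * norm v / \<rho>)"
        by (intro mult_mono D(2)) auto
      then show ?thesis by (simp only: norm_of_real abs_mult K_def) simp
    next
      case False
      then have "(2 * \<rho>)\<^sup>2 \<le> (norm (x - c))\<^sup>2" using \<rho> by (intro power_mono) auto
      moreover have "(2 * \<rho>)\<^sup>2 = 4 * \<rho>\<^sup>2" by (simp add: power2_eq_square)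
      ultimately have "2 * \<rho>\<^sup>2 \<le> (norm (x - c))\<^sup>2" using zero_le_power2[of \<rho>] by linarith
      then have "t \<ge> 1" using \<rho> by (simp add: t_def field_simps)
      then show ?thesis using D(3) \<rho> by (simp add: K_def)
    qed
  qed
  then show ?thesis using that[of "real CARD('n) * K"] by (simp add: K_def)
qed

section \<open>Doubling measures\<close>

text \<open>\<open>ball_pos\<close> rules out the zero measure, which satisfies the doubling
  inequality trivially.\<close>

locale doubling_measure =
  fixes M :: "'a::euclidean_space measure" and D :: real
  assumes sets_M [measurable_cong]: "sets M = sets borel"
    and ball_finite: "0 < r \<Longrightarrow> emeasure M (ball x r) < \<infinity>"
    and ball_pos: "0 < r \<Longrightarrow> 0 < emeasure M (ball x r)"
    and ball_doubling: "0 < r \<Longrightarrow> emeasure M (ball x (2 * r)) \<le> ennreal D * emeasure M (ball x r)"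
begin

lemma emeasure_ball: "emeasure M (ball x r) = ennreal (measure M (ball x r))"
proof (cases "0 < r")
  case True
  then show ?thesis using ball_finite[OF True, of x] by (intro emeasure_eq_ennreal_measure) auto
next
  case False
  then have "ball x r = {}" by (simp add: not_less)
  then show ?thesis by (simp only: emeasure_empty measure_empty ennreal_0)
qed

lemma measure_ball_pos: "0 < r \<Longrightarrow> 0 < measure M (ball x r)"
  using ball_pos[of r x] by (simp add: emeasure_ball)

lemma space_M [simp]: "space M = UNIV"
  using sets_eq_imp_space_eq[OF sets_M] by simp

lemma open_sets [simp, intro]: "open S \<Longrightarrow> S \<in> sets M"
  by (simp add: sets_M)

lemma measure_ball_mono:
  assumes "ball y s \<subseteq> ball x r" shows "measure M (ball y s) \<le> measure M (ball x r)"
proof -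
  have "emeasure M (ball y s) \<le> emeasure M (ball x r)" using assms by (intro emeasure_mono) auto
  then show ?thesis by (simp add: emeasure_ball)
qed

lemma D_ge_1: "1 \<le> D"
proof (rule ccontr)
  assume "\<not> 1 \<le> D"
  let ?x = "0 :: 'a" and ?m = "\<lambda>r. measure M (ball (0::'a) r)"
  have "ennreal (?m 2) \<le> ennreal D * ennreal (?m 1)"
    using ball_doubling[of 1 ?x] by (simp add: emeasure_ball)
  moreover have "?m 1 \<le> ?m 2" by (rule measure_ball_mono) auto
  moreover have "0 < ?m 1" by (rule measure_ball_pos) simp
  ultimately have "?m 1 \<le> max D 0 * ?m 1"
  proof (cases "D \<ge> 0")
    case True
    then have "?m 2 \<le> D * ?m 1"
      using \<open>ennreal (?m 2) \<le> ennreal D * ennreal (?m 1)\<close> by (simp add: ennreal_mult[symmetric])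
    then show ?thesis using True \<open>?m 1 \<le> ?m 2\<close> by (simp add: max_def)
  next
    case False
    then have "?m 2 \<le> 0"
      using \<open>ennreal (?m 2) \<le> ennreal D * ennreal (?m 1)\<close> by (simp add: ennreal_neg)
    then show ?thesis using \<open>?m 1 \<le> ?m 2\<close> \<open>0 < ?m 1\<close> by linarith
  qed
  moreover have "max D 0 * ?m 1 < 1 * ?m 1"
    using \<open>0 < ?m 1\<close> \<open>\<not> 1 \<le> D\<close> by (intro mult_strict_right_mono) auto
  ultimately show False by simp
qed

lemma measure_doubling: "0 < r \<Longrightarrow> measure M (ball x (2 * r)) \<le> D * measure M (ball x r)"
  using ball_doubling[of r x] D_ge_1 by (simp add: emeasure_ball ennreal_mult[symmetric])

lemma measure_doubling_power: "0 < r \<Longrightarrow> measure M (ball x (2 ^ k * r)) \<le> D ^ k * measure M (ball x r)"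
proof (induction k)
  case (Suc k)
  have "measure M (ball x (2 * (2 ^ k * r))) \<le> D * measure M (ball x (2 ^ k * r))"
    using Suc.prems by (intro measure_doubling) simp
  also have "\<dots> \<le> D * (D ^ k * measure M (ball x r))"
    using Suc D_ge_1 by (intro mult_left_mono) auto
  finally show ?case by (simp add: mult.assoc)
qed simp

text \<open>Here \<open>k\<close> counts the doublings after which the second ball swallows the
  first. The exponents of \<open>D\<close> in the later estimates come from this comparison.\<close>

lemma measure_ball_compare:
  assumes "0 < s" "dist x y + r \<le> 2 ^ k * s"
  shows "measure M (ball x r) \<le> D ^ k * measure M (ball y s)"
proof -
  have "ball x r \<subseteq> ball y (2 ^ k * s)"
  proof
    fix z assume "z \<in> ball x r"
    then show "z \<in> ball y (2 ^ k * s)" using assms dist_triangle[of y z x]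
      by (simp add: dist_commute)
  qed
  then show ?thesis
    using measure_ball_mono measure_doubling_power[OF assms(1)] order_trans by blast
qed

text \<open>A ball of radius R around a point at distance 2 R from the origin is disjoint from
  \<open>ball 0 R\<close> and carries at least a fixed proportion of its mass. If the total mass T
  were finite, letting R grow would give T (1 + a) \<le> T with T > 0.\<close>

lemma emeasure_UNIV: "emeasure M UNIV = \<infinity>"
proof (rule ccontr)
  assume inf: "emeasure M UNIV \<noteq> \<infinity>"
  define T where "T = measure M UNIV"
  have T: "emeasure M UNIV = ennreal T"
    using inf unfolding T_def by (intro emeasure_eq_ennreal_measure) auto
  define a where "a = inverse (D ^ 2)"
  have a: "0 < a" using D_ge_1 by (simp add: a_def)
  have *: "measure M (ball 0 R) * (1 + a) \<le> T" if R: "0 < R" for R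
  proof -
    obtain e :: 'a where e: "e \<in> Basis" by (rule nonempty_Basis[THEN ex_in_conv[THEN iffD2, THEN exE]])
    define y where "y = (2 * R) *\<^sub>R e"
    have ny: "dist 0 y = 2 * R" using e R by (simp add: y_def)
    have "measure M (ball 0 R) \<le> D ^ 2 * measure M (ball y R)"
      using R ny by (intro measure_ball_compare) auto
    then have 1: "a * measure M (ball 0 R) \<le> measure M (ball y R)"
      using D_ge_1 by (simp add: a_def field_simps)
    have "ball 0 R \<inter> ball y R = {}"
    proof -
      have False if "z \<in> ball 0 R" "z \<in> ball y R" for z
        using that ny dist_triangle[of 0 y z] by (simp add: dist_commute)
      then show ?thesis by blast
    qed
    then have "emeasure M (ball 0 R) + emeasure M (ball y R) = emeasure M (ball 0 R \<union> ball y R)"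
      by (intro plus_emeasure) auto
    also have "\<dots> \<le> emeasure M UNIV" by (intro emeasure_mono) auto
    finally have "measure M (ball 0 R) + measure M (ball y R) \<le> T"
      unfolding T emeasure_ball by (simp add: ennreal_plus[symmetric] T_def del: ennreal_plus)
    then show ?thesis using 1 by (simp add: algebra_simps)
  qed
  have "incseq (\<lambda>n. ball (0::'a) (real (Suc n)))" by (auto simp: incseq_def)
  moreover have "(\<Union>n. ball (0::'a) (real (Suc n))) = UNIV"
  proof -
    have "\<exists>n. z \<in> ball 0 (real (Suc n))" for z :: 'a
    proof -
      obtain n where "norm z < real n" using reals_Archimedean2 by blast
      then show ?thesis by (intro exI[of _ n]) simp
    qed
    then show ?thesis by blast
  qed
  ultimately have "(SUP n. emeasure M (ball (0::'a) (real (Suc n)))) = emeasure M UNIV"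
    using SUP_emeasure_incseq[of "\<lambda>n. ball (0::'a) (real (Suc n))" M] by auto
  moreover have "emeasure M (ball (0::'a) (real (Suc n))) \<le> ennreal (T / (1 + a))" for n
  proof -
    have "measure M (ball (0::'a) (real (Suc n))) \<le> T / (1 + a)"
      using *[of "real (Suc n)"] a by (simp add: field_simps)
    then show ?thesis unfolding emeasure_ball by (rule ennreal_leI)
  qed
  ultimately have "ennreal T \<le> ennreal (T / (1 + a))"
    unfolding T[symmetric] by (metis SUP_least)
  moreover have "0 < T"
  proof -
    have "0 < emeasure M (ball (0::'a) 1)" by (rule ball_pos) simp
    also have "\<dots> \<le> emeasure M UNIV" by (intro emeasure_mono) auto
    finally show ?thesis by (simp add: T)
  qed
  moreover from this a have "0 < T * a" by simp
  ultimately show False using a by (simp add: field_simps)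
qed

text \<open>The maximal function is taken of a measure \<open>N\<close> because two kinds occur: the
  density of the energy, for the exceptional set, and restrictions of \<open>M\<close>, in
  \<open>AE_infdist_small\<close>. The factor \<open>D ^ 3\<close> is the price of Vitali's dilation
  by 5 \<le> 2 ^ 3.\<close>

lemma weak_type:
  fixes N :: "'a measure"
  assumes N [measurable_cong]: "sets N = sets borel" and t: "0 \<le> t"
  defines "W \<equiv> {x. \<exists>c r. 0 < r \<and> x \<in> ball c r \<and> ennreal t * emeasure M (ball c r) < emeasure N (ball c r)}"
  shows "open W" "ennreal t * emeasure M W \<le> ennreal (D ^ 3) * emeasure N UNIV"
proof -
  define Q where "Q = {(c, r). 0 < r \<and> ennreal t * emeasure M (ball c r) < emeasure N (ball c r)}"
  have W: "W = (\<Union>(c, r)\<in>Q. ball c r)" unfolding W_def Q_def by blast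
  then show "open W" by auto
  have K: "ennreal t * emeasure M K \<le> ennreal (D ^ 3) * emeasure N UNIV"
    if "compact K" "K \<subseteq> W" for K
  proof -
    obtain Q' where Q': "Q' \<subseteq> Q" "finite Q'" "K \<subseteq> (\<Union>q\<in>Q'. ball (fst q) (snd q))"
    proof (rule compactE_image[OF \<open>compact K\<close>, of Q "\<lambda>q. ball (fst q) (snd q)"])
      show "K \<subseteq> (\<Union>q\<in>Q. ball (fst q) (snd q))" using \<open>K \<subseteq> W\<close> W by (auto simp: case_prod_unfold)
    qed (use that in auto)
    have r: "0 < snd q \<and> snd q \<le> (if Q' = {} then 0 else Max (snd ` Q'))" if "q \<in> Q'" for q
      using that Q' by (auto simp: Q_def)
    obtain C where C: "C \<subseteq> Q'" "pairwise (\<lambda>i j. disjnt (ball (fst i) (snd i)) (ball (fst j) (snd j))) C"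
      "K \<subseteq> (\<Union>i\<in>C. ball (fst i) (5 * snd i))"
    proof (rule Vitali_covering_lemma_balls[OF Q'(3) r])
      fix C assume "C \<subseteq> Q'" "pairwise (\<lambda>i j. disjnt (ball (fst i) (snd i)) (ball (fst j) (snd j))) C"
        "K \<subseteq> (\<Union>i\<in>C. ball (fst i) (5 * snd i))"
      then show thesis by (rule that)
    qed
    have finC: "finite C" using C(1) Q'(2) finite_subset by blast
    have CQ: "0 < snd i" "ennreal t * emeasure M (ball (fst i) (snd i)) \<le> emeasure N (ball (fst i) (snd i))"
      if "i \<in> C" for i
      using that C(1) Q'(1) by (auto simp: Q_def)
    have "emeasure M K \<le> emeasure M (\<Union>i\<in>C. ball (fst i) (5 * snd i))"
      using C(3) by (intro emeasure_mono) auto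
    also have "\<dots> \<le> (\<Sum>i\<in>C. emeasure M (ball (fst i) (5 * snd i)))"
      using finC by (intro emeasure_subadditive_finite) auto
    also have "\<dots> \<le> (\<Sum>i\<in>C. ennreal (D ^ 3) * emeasure M (ball (fst i) (snd i)))"
    proof (intro sum_mono)
      fix i assume "i \<in> C"
      then have "measure M (ball (fst i) (5 * snd i)) \<le> D ^ 3 * measure M (ball (fst i) (snd i))"
        using CQ(1) by (intro measure_ball_compare) (auto simp: less_imp_le)
      then show "emeasure M (ball (fst i) (5 * snd i)) \<le> ennreal (D ^ 3) * emeasure M (ball (fst i) (snd i))"
        using D_ge_1 by (simp add: emeasure_ball ennreal_mult[symmetric])
    qed
    finally have "ennreal t * emeasure M K \<le>
        ennreal t * (\<Sum>i\<in>C. ennreal (D ^ 3) * emeasure M (ball (fst i) (snd i)))"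
      by (rule mult_left_mono) simp
    also have "\<dots> = ennreal (D ^ 3) * (\<Sum>i\<in>C. ennreal t * emeasure M (ball (fst i) (snd i)))"
      by (simp add: sum_distrib_left mult.left_commute)
    also have "\<dots> \<le> ennreal (D ^ 3) * (\<Sum>i\<in>C. emeasure N (ball (fst i) (snd i)))"
      by (intro mult_left_mono sum_mono CQ) auto
    also have "(\<Sum>i\<in>C. emeasure N (ball (fst i) (snd i))) = emeasure N (\<Union>i\<in>C. ball (fst i) (snd i))"
      using finC C(2) by (intro sum_emeasure)
        (auto simp: N disjoint_family_on_def pairwise_def disjnt_def)
    also have "\<dots> \<le> emeasure N UNIV"
      using sets_eq_imp_space_eq[OF N] by (intro emeasure_mono) (auto simp: N)
    finally show ?thesis by (simp add: mult_left_mono)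
  qed
  \<comment> \<open>The Vitali selection starts from a finite cover and so reaches only compact
    sets; an exhaustion of the open set \<open>W\<close> and continuity from below do the
    rest.\<close>
  obtain C where C: "\<And>n. compact (C n)" "\<And>n. C n \<subseteq> W" "\<And>n. C n \<subseteq> interior (C (Suc n))" "\<Union>(range C) = W"
  proof (rule open_Union_compact_subsets[OF \<open>open W\<close>])
    fix C :: "nat \<Rightarrow> 'a set"
    assume "\<And>n. compact (C n)" "\<And>n. C n \<subseteq> W" "\<And>n. C n \<subseteq> interior (C (Suc n))" "\<Union>(range C) = W"
    then show thesis by (rule that)
  qed
  have "incseq C" using C(3) interior_subset by (intro incseq_SucI) blast
  then have "(SUP n. emeasure M (C n)) = emeasure M W"
  proof (subst C(4)[symmetric], intro SUP_emeasure_incseq)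
    show "range C \<subseteq> sets M" using C(1) by (auto simp: sets_M intro!: borel_closed compact_imp_closed)
  qed
  moreover have "ennreal t * (SUP n. emeasure M (C n)) \<le> ennreal (D ^ 3) * emeasure N UNIV"
    by (subst SUP_mult_left_ennreal) (intro SUP_least K C)
  ultimately show "ennreal t * emeasure M W \<le> ennreal (D ^ 3) * emeasure N UNIV" by simp
qed

text \<open>If \<open>infdist y (- U) > \<epsilon> * dist y x\<close>, then the part of \<open>U\<close> close to its complement fills a fixed
  proportion of a ball around \<open>x\<close>, so the weak type estimate bounds the set of such \<open>x\<close>.\<close>

lemma AE_infdist_small:
  assumes U: "open U" "emeasure M U < \<infinity>"
  shows "AE x in M. x \<notin> U \<longrightarrow>
    (\<forall>\<epsilon>>0. \<exists>\<delta>>0. \<forall>y. dist y x < \<delta> \<longrightarrow> infdist y (- U) \<le> \<epsilon> * dist y x)"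
proof -
  have "U \<noteq> UNIV" using U(2) emeasure_UNIV by auto
  then have ne: "- U \<noteq> {}" by auto
  have cl: "closed (- U)" using U(1) by auto
  have ip: "y \<in> U \<longleftrightarrow> 0 < infdist y (- U)" for y
    using in_closed_iff_infdist_zero[OF cl ne, of y] infdist_nonneg[of y "- U"] by auto
  \<comment> \<open>Layers of \<open>U\<close> along its complement. They shrink to the empty set
    inside a set of finite measure, so their measures tend to 0.\<close>
  define V where "V k = {y \<in> U. infdist y (- U) < inverse (real (Suc k))}" for k
  have V: "open (V k)" for k
  proof -
    have "open {y. infdist y (- U) < inverse (real (Suc k))}"
      by (intro open_Collect_less continuous_intros)
    moreover have "V k = U \<inter> {y. infdist y (- U) < inverse (real (Suc k))}" by (auto simp: V_def)
    ultimately show ?thesis using U(1) by (simp add: open_Int)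
  qed
  have Vlim: "(\<lambda>k. emeasure M (V k)) \<longlonglongrightarrow> 0"
  proof -
    have "decseq V"
    proof (rule decseq_SucI)
      fix k
      have "inverse (real (Suc (Suc k))) \<le> inverse (real (Suc k))" by (simp add: field_simps)
      then show "V (Suc k) \<subseteq> V k" unfolding V_def using less_le_trans by blast
    qed
    moreover have "emeasure M (V k) \<noteq> \<infinity>" for k
    proof -
      have "emeasure M (V k) \<le> emeasure M U" using U(1) by (intro emeasure_mono) (auto simp: V_def)
      then show ?thesis using U(2) by (metis infinity_ennreal_def leD)
    qed
    moreover have "(\<Inter>k. V k) = {}"
    proof -
      have "\<exists>k. y \<notin> V k" for y
      proof (cases "y \<in> U")
        case True
        then obtain k where "inverse (real (Suc k)) < infdist y (- U)"
          using ip reals_Archimedean by blast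
        then have "y \<notin> V k" unfolding V_def by auto
        then show ?thesis by blast
      qed (simp add: V_def)
      then show ?thesis by blast
    qed
    ultimately show ?thesis using Lim_emeasure_decseq[of V M] V by auto
  qed
  have null: "AE x in M. x \<notin> U \<longrightarrow> (\<exists>\<delta>>0. \<forall>y. dist y x < \<delta> \<longrightarrow> infdist y (- U) \<le> \<epsilon> * dist y x)"
    if \<epsilon>: "0 < \<epsilon>" for \<epsilon>
  proof -
    \<comment> \<open>If 2 ^ j * \<epsilon> > 3 and infdist y (- U) > \<epsilon> * dist y x, then j
      doublings of the ball of radius infdist y (- U) around y cover the ball of radius 2 * dist y x
      around x. The half in \<open>t\<close> makes the later comparison strict.\<close>
    obtain j where j: "3 / \<epsilon> < 2 ^ j" using real_arch_pow[of 2 "3/\<epsilon>"] by auto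
    define t where "t = inverse (D ^ j) / 2"
    have t: "0 < t" using D_ge_1 by (simp add: t_def)
    define N where "N k = density M (indicator (V k))" for k
    define W where "W k = {x. \<exists>c r. 0 < r \<and> x \<in> ball c r \<and>
        ennreal t * emeasure M (ball c r) < emeasure (N k) (ball c r)}" for k
    have sN: "sets (N k) = sets borel" for k by (simp add: N_def sets_M)
    have N: "emeasure (N k) X = emeasure M (V k \<inter> X)" if "X \<in> sets M" for k X
      unfolding N_def using V that by (intro emeasure_restricted) auto
    note wt = weak_type[OF sN order.strict_implies_order[OF t], folded W_def]
    have Wb: "emeasure M (W k) \<le> ennreal (D ^ 3 / t) * emeasure M (V k)" for k
    proof -
      have "ennreal t * emeasure M (W k) \<le> ennreal (D ^ 3) * emeasure M (V k)"
        using wt(2)[of k] N[of UNIV k] by auto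
      then have "ennreal (1 / t) * (ennreal t * emeasure M (W k)) \<le>
          ennreal (1 / t) * (ennreal (D ^ 3) * emeasure M (V k))"
        by (rule mult_left_mono) simp
      then show ?thesis
        using t D_ge_1 by (simp add: mult.assoc[symmetric] ennreal_mult[symmetric])
    qed
    have "emeasure M (\<Inter>k. W k) \<le> 0"
    proof (rule LIMSEQ_le_const)
      show "(\<lambda>k. ennreal (D ^ 3 / t) * emeasure M (V k)) \<longlonglongrightarrow> 0"
        using tendsto_mult_ennreal[OF tendsto_const Vlim, of "ennreal (D ^ 3 / t)"] by simp
      have "emeasure M (\<Inter>k. W k) \<le> ennreal (D ^ 3 / t) * emeasure M (V k)" for k
        by (rule order_trans[OF emeasure_mono Wb]) (use wt(1) in auto)
      then show "\<exists>n. \<forall>k\<ge>n. emeasure M (\<Inter>k. W k) \<le> ennreal (D ^ 3 / t) * emeasure M (V k)" by blast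
    qed
    moreover have "(\<Inter>k. W k) \<in> sets M" using wt(1) by (intro sets.countable_INT) auto
    ultimately have "(\<Inter>k. W k) \<in> null_sets M" by (auto simp: null_sets_def)
    then show ?thesis
    proof (rule AE_I')
      \<comment> \<open>A bad point x lies in every \<open>W k\<close>: the bound fails at points y
        arbitrarily close to x, and the balls that these y have inside \<open>U\<close> lie in ever
        thinner layers.\<close>
      show "{x \<in> space M. \<not> (x \<notin> U \<longrightarrow> (\<exists>\<delta>>0. \<forall>y. dist y x < \<delta> \<longrightarrow> infdist y (- U) \<le> \<epsilon> * dist y x))} \<subseteq> (\<Inter>k. W k)"
      proof (clarsimp simp: not_le)
        fix x k
        assume x: "x \<notin> U" and bad: "\<forall>\<delta>>0. \<exists>y. dist y x < \<delta> \<and> \<epsilon> * dist y x < infdist y (- U)"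
        have "0 < inverse (real (Suc k)) / 2" by simp
        then obtain y where y: "dist y x < inverse (real (Suc k)) / 2" "\<epsilon> * dist y x < infdist y (- U)"
          using bad by blast
        let ?d = "infdist y (- U)" and ?s = "dist y x"
        have d: "0 < ?d" using y(2) \<epsilon> by (smt (verit) mult_nonneg_nonneg zero_le_dist)
        then have "y \<noteq> x" using ip x by blast
        then have s: "0 < ?s" by simp
        have ds: "?d \<le> ?s" using x by (intro infdist_le) auto
        have sub: "ball y ?d \<subseteq> V k \<inter> ball x (2 * ?s)"
        proof
          fix z assume z: "z \<in> ball y ?d"
          have "z \<in> U"
          proof (rule ccontr)
            assume "z \<notin> U"
            then have "?d \<le> dist y z" by (intro infdist_le) auto
            then show False using z by simp
          qed
          moreover have "infdist z (- U) \<le> ?d + dist z y" by (rule infdist_triangle)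
          moreover have "dist x z \<le> ?s + dist y z" by (metis dist_commute dist_triangle)
          ultimately show "z \<in> V k \<inter> ball x (2 * ?s)"
            using z ds y(1) by (auto simp: V_def dist_commute)
        qed
        have "3 * ?s \<le> (2 ^ j * \<epsilon>) * ?s" using j \<epsilon> s by (intro mult_right_mono) (auto simp: field_simps)
        also have "\<dots> = 2 ^ j * (\<epsilon> * ?s)" by simp
        also have "\<dots> \<le> 2 ^ j * ?d" using y(2) by (intro mult_left_mono) auto
        finally have "measure M (ball x (2 * ?s)) \<le> D ^ j * measure M (ball y ?d)"
          using d by (intro measure_ball_compare) (auto simp: dist_commute)
        then have "2 * (t * measure M (ball x (2 * ?s))) \<le> measure M (ball y ?d)"
          using D_ge_1 by (simp add: t_def field_simps)
        moreover have "0 < t * measure M (ball x (2 * ?s))"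
          using t measure_ball_pos[of "2 * ?s" x] s by simp
        ultimately have "ennreal (t * measure M (ball x (2 * ?s))) < ennreal (measure M (ball y ?d))"
          by (intro ennreal_lessI) linarith+
        then have "ennreal t * emeasure M (ball x (2 * ?s)) < emeasure M (ball y ?d)"
          using t by (simp add: emeasure_ball ennreal_mult)
        also have "\<dots> \<le> emeasure (N k) (ball x (2 * ?s))"
          using V by (subst N) (auto intro!: emeasure_mono sub)
        finally show "x \<in> W k" using s by (auto simp: W_def intro!: exI[of _ x] exI[of _ "2 * ?s"])
      qed
    qed
  qed
  \<comment> \<open>The null set depends on \<epsilon>; the values 1 / (m + 1) reduce the union to a
    countable one.\<close>
  have "AE x in M. \<forall>m::nat. x \<notin> U \<longrightarrow>
      (\<exists>\<delta>>0. \<forall>y. dist y x < \<delta> \<longrightarrow> infdist y (- U) \<le> inverse (real (Suc m)) * dist y x)"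
    unfolding AE_all_countable by (intro allI null) simp
  then show ?thesis
  proof (rule AE_mp, intro AE_I2 impI allI)
    fix x and \<epsilon> :: real
    assume H: "\<forall>m::nat. x \<notin> U \<longrightarrow>
      (\<exists>\<delta>>0. \<forall>y. dist y x < \<delta> \<longrightarrow> infdist y (- U) \<le> inverse (real (Suc m)) * dist y x)"
      and x: "x \<notin> U" and \<epsilon>: "0 < \<epsilon>"
    obtain m where m: "inverse (real (Suc m)) < \<epsilon>" using reals_Archimedean[OF \<epsilon>] by blast
    obtain \<delta> where "\<delta> > 0" "\<And>y. dist y x < \<delta> \<Longrightarrow> infdist y (- U) \<le> inverse (real (Suc m)) * dist y x"
      using H x by blast
    moreover have "inverse (real (Suc m)) * dist y x \<le> \<epsilon> * dist y x" for y
      using m by (intro mult_right_mono) auto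
    ultimately show "\<exists>\<delta>>0. \<forall>y. dist y x < \<delta> \<longrightarrow> infdist y (- U) \<le> \<epsilon> * dist y x"
      by (meson order_trans)
  qed
qed

end

section \<open>Whitney coverings\<close>

text \<open>Zorn's lemma supplies a maximal disjoint family. The small ball of any other point z
  meets the ball of some member x, and since the distance to the complement is 1-Lipschitz, dist z x
  < 2/19 * d x follows, which is rounded up to 3/20.\<close>

lemma whitney_covering:
  fixes U :: "'a::euclidean_space set"
  assumes U: "open U" "U \<noteq> UNIV"
  defines "d \<equiv> \<lambda>x. infdist x (- U)"
  obtains A where "countable A" "A \<subseteq> U"
    "\<And>x y. x \<in> A \<Longrightarrow> y \<in> A \<Longrightarrow> x \<noteq> y \<Longrightarrow> ball x (d x / 20) \<inter> ball y (d y / 20) = {}"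
    "\<And>z. z \<in> U \<Longrightarrow> \<exists>x\<in>A. dist z x \<le> 3/20 * d x"
proof -
  have dpos: "0 < d x" if "x \<in> U" for x
    unfolding d_def using U that by (intro infdist_pos_not_in_closed) auto
  define \<F> where "\<F> = {A. A \<subseteq> U \<and> (\<forall>x\<in>A. \<forall>y\<in>A. x \<noteq> y \<longrightarrow> ball x (d x / 20) \<inter> ball y (d y / 20) = {})}"
  have "\<exists>A\<in>\<F>. \<forall>B\<in>\<F>. A \<subseteq> B \<longrightarrow> B = A"
  proof (rule subset_Zorn_nonempty)
    show "\<F> \<noteq> {}" by (auto simp: \<F>_def)
    show "\<Union>\<C> \<in> \<F>" if "\<C> \<noteq> {}" "subset.chain \<F> \<C>" for \<C>
      unfolding \<F>_def
    proof (intro CollectI conjI ballI impI)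
      have sub: "\<C> \<subseteq> \<F>" and ch: "\<And>P Q. P \<in> \<C> \<Longrightarrow> Q \<in> \<C> \<Longrightarrow> P \<subseteq> Q \<or> Q \<subseteq> P"
        using that(2) unfolding subset_chain_def by auto
      show "\<Union>\<C> \<subseteq> U" using sub by (auto simp: \<F>_def)
      fix x y assume "x \<in> \<Union>\<C>" "y \<in> \<Union>\<C>" "x \<noteq> y"
      then obtain P where "P \<in> \<C>" "x \<in> P" "y \<in> P" using ch by blast
      then show "ball x (d x / 20) \<inter> ball y (d y / 20) = {}" using sub \<open>x \<noteq> y\<close> unfolding \<F>_def by blast
    qed
  qed
  then obtain A where A: "A \<in> \<F>" and max: "\<And>B. B \<in> \<F> \<Longrightarrow> A \<subseteq> B \<Longrightarrow> B = A" by blast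
  have AU: "A \<subseteq> U" and dis: "\<And>x y. x \<in> A \<Longrightarrow> y \<in> A \<Longrightarrow> x \<noteq> y \<Longrightarrow> ball x (d x / 20) \<inter> ball y (d y / 20) = {}"
    using A by (auto simp: \<F>_def)
  show ?thesis
  proof (rule that[OF _ AU dis])
    have inj: "inj_on (\<lambda>x. ball x (d x / 20)) A"
    proof (rule inj_onI, rule ccontr)
      fix x y assume "x \<in> A" "y \<in> A" "ball x (d x / 20) = ball y (d y / 20)" "x \<noteq> y"
      then have "ball x (d x / 20) = {}" using dis by blast
      then show False using dpos[of x] AU \<open>x \<in> A\<close> by (auto simp: not_less)
    qed
    have "countable ((\<lambda>x. ball x (d x / 20)) ` A)"
    proof (rule countable_disjoint_open_subsets)
      show "pairwise disjnt ((\<lambda>x. ball x (d x / 20)) ` A)"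
        unfolding pairwise_def disjnt_def using dis by blast
    qed auto
    then show "countable A" using inj countable_image_inj_on by blast
    show "\<exists>x\<in>A. dist z x \<le> 3/20 * d x" if z: "z \<in> U" for z
    proof (cases "z \<in> A")
      case True
      then show ?thesis using dpos[OF z] by (intro bexI[of _ z]) auto
    next
      case False
      then have "insert z A \<notin> \<F>" using max by blast
      then obtain x where x: "x \<in> A" "ball z (d z / 20) \<inter> ball x (d x / 20) \<noteq> {}"
        using dis AU z unfolding \<F>_def by auto
      then obtain y where "dist z y < d z / 20" "dist x y < d x / 20" by auto
      moreover have "dist z x \<le> dist z y + dist x y" by (metis dist_commute dist_triangle)
      moreover have "d z \<le> d x + dist z x" unfolding d_def by (rule infdist_triangle)
      moreover have "0 < d x" using x AU dpos by blast
      ultimately have "dist z x \<le> 3/20 * d x" by linarith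
      with x show ?thesis by blast
    qed
  qed
qed

context doubling_measure
begin

text \<open>A packing argument: the disjoint small balls around these centres lie in one ball around
  z of comparable radius, and each carries at least the fraction 1 / \<open>D ^ 6\<close> of its
  mass. The exponent fits because 2 ^ 6 / 20 exceeds 1/3 + 4/3, the bound for (dist z x + d z) / d
  x.\<close>

lemma whitney_overlap:
  fixes U :: "'a set"
  assumes U: "open U" "U \<noteq> UNIV"
  defines "d \<equiv> \<lambda>x. infdist x (- U)"
  assumes A: "A \<subseteq> U"
    "\<And>x y. x \<in> A \<Longrightarrow> y \<in> A \<Longrightarrow> x \<noteq> y \<Longrightarrow> ball x (d x / 20) \<inter> ball y (d y / 20) = {}"
    and z: "z \<in> U"
  shows "finite {x \<in> A. dist z x < d x / 3}" "real (card {x \<in> A. dist z x < d x / 3}) \<le> D ^ 6"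
proof -
  have dpos: "0 < d x" if "x \<in> U" for x
    unfolding d_def using U that by (intro infdist_pos_not_in_closed) auto
  have bd: "real (card S) \<le> D ^ 6" if S: "finite S" "S \<subseteq> {x \<in> A. dist z x < d x / 3}" for S
  proof -
    let ?m = "measure M (ball z (d z))"
    have m: "0 < ?m" using dpos z measure_ball_pos by blast
    have sub: "ball x (d x / 20) \<subseteq> ball z (d z)" "?m \<le> D ^ 6 * measure M (ball x (d x / 20))" if "x \<in> S" for x
    proof -
      have x: "dist z x < d x / 3" "0 < d x" using that S dpos A by auto
      have 1: "d x \<le> d z + dist z x" "d z \<le> d x + dist z x"
        unfolding d_def using infdist_triangle dist_commute by metis+
      show "ball x (d x / 20) \<subseteq> ball z (d z)"
      proof
        fix y assume "y \<in> ball x (d x / 20)"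
        then have "dist x y < d x / 20" by simp
        moreover have "dist z y \<le> dist z x + dist x y" by (rule dist_triangle)
        ultimately have "dist z y < d z" using x 1 by linarith
        then show "y \<in> ball z (d z)" by simp
      qed
      show "?m \<le> D ^ 6 * measure M (ball x (d x / 20))"
        using x 1 by (intro measure_ball_compare) auto
    qed
    have "real (card S) * ?m = (\<Sum>x\<in>S. ?m)" by simp
    also have "\<dots> \<le> (\<Sum>x\<in>S. D ^ 6 * measure M (ball x (d x / 20)))" using sub by (intro sum_mono) auto
    also have "\<dots> = D ^ 6 * (\<Sum>x\<in>S. measure M (ball x (d x / 20)))" by (simp add: sum_distrib_left)
    also have "(\<Sum>x\<in>S. measure M (ball x (d x / 20))) \<le> ?m"
    proof -
      have "(\<Sum>x\<in>S. emeasure M (ball x (d x / 20))) = emeasure M (\<Union>x\<in>S. ball x (d x / 20))"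
      proof (intro sum_emeasure)
        show "disjoint_family_on (\<lambda>x. ball x (d x / 20)) S"
          unfolding disjoint_family_on_def using S(2) A(2) by blast
      qed (use S in auto)
      also have "\<dots> \<le> emeasure M (ball z (d z))" using sub(1) by (intro emeasure_mono) auto
      finally show ?thesis by (simp add: emeasure_ball sum_ennreal)
    qed
    finally show ?thesis using m D_ge_1 by (simp add: mult_left_mono)
  qed
  have *: "card S \<le> nat \<lfloor>D ^ 6\<rfloor>" if "finite S" "S \<subseteq> {x \<in> A. dist z x < d x / 3}" for S
    using bd[OF that] by (simp add: le_nat_floor)
  have "finite {x \<in> A. dist z x < d x / 3} \<and> card {x \<in> A. dist z x < d x / 3} \<le> nat \<lfloor>D ^ 6\<rfloor>"
    by (rule finite_if_finite_subsets_card_bdd) (rule *)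
  then show f: "finite {x \<in> A. dist z x < d x / 3}" ..
  show "real (card {x \<in> A. dist z x < d x / 3}) \<le> D ^ 6" using bd[OF f] by simp
qed

end

section \<open>Distributional gradients of Lipschitz functions\<close>

text \<open>Steps of either sign are allowed because integration by parts uses positive steps for
  one function and negative steps for the other.\<close>

lemma difference_quotient_tendsto:
  assumes f: "(f has_derivative f') (at x)" and t: "t \<longlonglongrightarrow> (0::real)" "\<And>k. t k \<noteq> 0"
  shows "(\<lambda>k. (f (x + t k *\<^sub>R v) - f x) /\<^sub>R t k) \<longlonglongrightarrow> f' v"
proof (cases "v = 0")
  case True
  then show ?thesis using linear_0[OF has_derivative_linear[OF f]] by simp
next
  case False
  have lin: "f' (a *\<^sub>R v) = a *\<^sub>R f' v" for a
    using has_derivative_linear[OF f] by (simp add: linear_cmul)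
  have "filterlim (\<lambda>k. t k *\<^sub>R v) (at 0) sequentially"
    using False t tendsto_scaleR[OF t(1) tendsto_const[of v]] by (intro filterlim_atI) auto
  moreover have "((\<lambda>h. norm (f (x + h) - f x - f' h) / norm h) \<longlongrightarrow> 0) (at 0)"
    using f by (simp add: has_derivative_at)
  ultimately have "(\<lambda>k. norm (f (x + t k *\<^sub>R v) - f x - f' (t k *\<^sub>R v)) / norm (t k *\<^sub>R v)) \<longlonglongrightarrow> 0"
    by (rule filterlim_compose[rotated])
  from tendsto_mult_right[OF this, of "norm v"]
  have "(\<lambda>k. norm (f (x + t k *\<^sub>R v) - f x - f' (t k *\<^sub>R v)) / norm (t k *\<^sub>R v) * norm v) \<longlonglongrightarrow> 0"
    by simp
  also have "(\<lambda>k. norm (f (x + t k *\<^sub>R v) - f x - f' (t k *\<^sub>R v)) / norm (t k *\<^sub>R v) * norm v) =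
      (\<lambda>k. norm ((f (x + t k *\<^sub>R v) - f x) /\<^sub>R t k - f' v))"
  proof
    fix k
    have "(f (x + t k *\<^sub>R v) - f x) /\<^sub>R t k - f' v = (f (x + t k *\<^sub>R v) - f x - f' (t k *\<^sub>R v)) /\<^sub>R t k"
      using t(2)[of k] by (simp add: lin scaleR_diff_right)
    then show "norm (f (x + t k *\<^sub>R v) - f x - f' (t k *\<^sub>R v)) / norm (t k *\<^sub>R v) * norm v =
        norm ((f (x + t k *\<^sub>R v) - f x) /\<^sub>R t k - f' v)"
      using False by (simp add: divide_inverse)
  qed
  finally show ?thesis by (rule LIM_zero_cancel[OF tendsto_norm_zero_cancel])
qed

lemma integrable_continuous_compact_support:
  fixes f :: "'a::euclidean_space \<Rightarrow> 'b::{banach, second_countable_topology}"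
  assumes "continuous_on UNIV f" "compact K" "\<And>x. x \<notin> K \<Longrightarrow> f x = 0"
  shows "integrable lborel f"
proof -
  have "integrable lborel (\<lambda>x. indicator K x *\<^sub>R f x)"
    using assms by (intro borel_integrable_compact continuous_on_subset[OF assms(1)]) auto
  moreover have "(\<lambda>x. indicator K x *\<^sub>R f x) = f" using assms(3) by (auto simp: indicator_def)
  ultimately show ?thesis by simp
qed

lemma lborel_integral_translate:
  fixes f :: "'a::euclidean_space \<Rightarrow> 'b::{banach, second_countable_topology}"
  assumes [measurable]: "f \<in> borel_measurable borel"
  shows "(LINT x|lborel. f (c + x)) = (LINT x|lborel. f x)"
proof -
  have "(LINT x|lborel. f x) = (LINT x|distr lborel borel ((+) c). f x)"
    by (simp add: lborel_distr_plus)
  also have "\<dots> = (LINT x|lborel. f (c + x))" by (rule integral_distr) auto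
  finally show ?thesis by simp
qed

lemma smooth_compact_supp_lipschitz:
  fixes \<phi> :: "real ^ 'n::finite \<Rightarrow> complex"
  assumes "smooth \<phi>" "compact (supp \<phi>)"
  obtains A where "0 \<le> A" "\<And>x y. norm (\<phi> x - \<phi> y) \<le> A * norm (x - y)"
proof -
  have "compact (grad \<phi> ` supp \<phi>)"
    using assms by (intro compact_continuous_image continuous_on_grad)
  then have "bounded (grad \<phi> ` supp \<phi>)" by (rule compact_imp_bounded)
  then obtain A where A: "\<And>x. x \<in> supp \<phi> \<Longrightarrow> norm (grad \<phi> x) \<le> A"
    unfolding bounded_iff by blast
  have "norm (grad \<phi> x) \<le> max A 0" for x
  proof (cases "x \<in> supp \<phi>")
    case False
    have "grad \<phi> x = grad (\<lambda>x. 0) x"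
    proof (rule grad_cong_open(1))
      show "open (- supp \<phi>)" by (simp add: supp_def open_Compl)
      show "\<phi> y = 0" if "y \<in> - supp \<phi>" for y
        using that closure_subset[of "{x. \<phi> x \<noteq> 0}"] unfolding supp_def by blast
    qed (use False in simp)
    then show ?thesis by simp
  qed (use A in force)
  then have "norm (\<phi> x - \<phi> y) \<le> max A 0 * norm (x - y)" for x y
    by (rule grad_bound_lipschitz[OF convex_UNIV smooth_differentiable[OF assms(1)]]) auto
  then show ?thesis by (rule that[rotated]) simp
qed

text \<open>Translation invariance moves the difference quotient from \<phi> to u exactly, for each
  step. Both sides then converge by dominated convergence, with the Lipschitz constant controlling
  the quotients of u. The derivative of u is written as a \<open>lim\<close> of quotients because
  that is measurable on the whole space.\<close>

lemma lipschitz_integration_by_parts: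
  fixes u \<phi> :: "real ^ 'n::finite \<Rightarrow> complex"
  assumes u: "L-lipschitz_on UNIV u" "AE x in lborel. u differentiable (at x)"
    and \<phi>: "smooth \<phi>" "compact (supp \<phi>)"
  shows "(LINT x|lborel. u x * partial j \<phi> x) =
    - (LINT x|lborel. lim (\<lambda>k. (u (x + inverse (real (Suc k)) *\<^sub>R axis j 1) - u x) /\<^sub>R inverse (real (Suc k))) * \<phi> x)"
proof -
  define e :: "real ^ 'n" where "e = axis j 1"
  define h where "h k = inverse (real (Suc k))" for k
  have h: "0 < h k" "h k \<le> 1" "h k \<noteq> 0" for k by (auto simp: h_def field_simps)
  have hlim: "h \<longlonglongrightarrow> 0" "(\<lambda>k. - h k) \<longlonglongrightarrow> 0"
    using LIMSEQ_inverse_real_of_nat tendsto_minus[OF LIMSEQ_inverse_real_of_nat] by (simp_all add: h_def[abs_def])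
  have ne: "norm e = 1" by (simp add: e_def)
  define q where "q k x = (u (x + h k *\<^sub>R e) - u x) /\<^sub>R h k" for k x
  define \<psi> where "\<psi> k x = (\<phi> (x + (- h k) *\<^sub>R e) - \<phi> x) /\<^sub>R (- h k)" for k x
  have cu: "continuous_on UNIV u" using u(1) lipschitz_on_continuous_on by blast
  have cuc: "continuous_on UNIV (\<lambda>x. u (x + c))" for c
    by (rule continuous_on_compose2[OF cu]) (auto intro!: continuous_intros)
  have cp: "continuous_on UNIV \<phi>" by (rule smooth_continuous[OF \<phi>(1)])
  have cpc: "continuous_on UNIV (\<lambda>x. \<phi> (x + c))" for c
    by (rule continuous_on_compose2[OF cp]) (auto intro!: continuous_intros)
  have cpj: "continuous_on UNIV (partial j \<phi>)" by (intro smooth_continuous smooth_partial \<phi>)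
  have m: "u \<in> borel_measurable borel" "\<phi> \<in> borel_measurable borel"
    "partial j \<phi> \<in> borel_measurable borel"
    using cu cp cpj by (auto intro: borel_measurable_continuous_onI)
  have mq: "q k \<in> borel_measurable borel" and m\<psi>: "\<psi> k \<in> borel_measurable borel" for k
    unfolding q_def[abs_def] \<psi>_def[abs_def]
    by (auto intro!: borel_measurable_continuous_onI continuous_intros cu cp cuc cpc
        simp del: scaleR_minus_left)
  obtain R where "supp \<phi> \<subseteq> ball 0 R"
    using bounded_subset_ballD[OF compact_imp_bounded[OF \<phi>(2)], of 0] by blast
  then have R: "\<phi> x = 0" if "norm x \<ge> R" for x
    using that closure_subset[of "{x. \<phi> x \<noteq> 0}"] unfolding supp_def by force
  \<comment> \<open>The steps are at most 1, so enlarging the radius by 1 captures the supports of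
    all translates of \<phi>.\<close>
  define K where "K = cball (0 :: real ^ 'n) (R + 1)"
  have K: "compact K" by (simp add: K_def)
  have \<phi>K: "\<phi> x = 0" "\<phi> (x + (- h k) *\<^sub>R e) = 0" if "x \<notin> K" for x k
  proof -
    have "norm x - norm (h k *\<^sub>R e) \<le> norm (x - h k *\<^sub>R e)" by (rule norm_triangle_ineq2)
    moreover have "norm (h k *\<^sub>R e) \<le> 1" using h[of k] ne by simp
    ultimately show "\<phi> x = 0" "\<phi> (x + (- h k) *\<^sub>R e) = 0"
      using that by (auto simp: K_def intro!: R)
  qed
  obtain A where A: "0 \<le> A" "\<And>x y. norm (\<phi> x - \<phi> y) \<le> A * norm (x - y)"
    using smooth_compact_supp_lipschitz[OF \<phi>] by blast
  have lim1: "(\<lambda>k. LINT x|lborel. u x * \<psi> k x) \<longlonglongrightarrow> (LINT x|lborel. u x * partial j \<phi> x)"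
  proof (rule integral_dominated_convergence[where w="\<lambda>x. indicator K x *\<^sub>R (norm (u x) * A)"])
    show "integrable lborel (\<lambda>x. indicator K x *\<^sub>R (norm (u x) * A))"
      using K by (intro borel_integrable_compact continuous_intros continuous_on_subset[OF cu]) auto
    show "AE x in lborel. (\<lambda>k. u x * \<psi> k x) \<longlonglongrightarrow> u x * partial j \<phi> x"
    proof (intro AE_I2 tendsto_mult tendsto_const)
      fix x
      have d: "(\<phi> has_derivative frechet_derivative \<phi> (at x)) (at x)"
        by (rule differentiable_has_derivative[OF smooth_differentiable[OF \<phi>(1)]])
      show "(\<lambda>k. \<psi> k x) \<longlonglongrightarrow> partial j \<phi> x"
        using difference_quotient_tendsto[OF d hlim(2), of e] h(3)
        unfolding \<psi>_def partial_def e_def by simp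
    qed
    show "AE x in lborel. norm (u x * \<psi> k x) \<le> indicator K x *\<^sub>R (norm (u x) * A)" for k
    proof (intro AE_I2)
      fix x
      show "norm (u x * \<psi> k x) \<le> indicator K x *\<^sub>R (norm (u x) * A)"
      proof (cases "x \<in> K")
        case True
        have "norm (\<psi> k x) = norm (\<phi> (x + (- h k) *\<^sub>R e) - \<phi> x) / h k"
          using h[of k] by (simp add: \<psi>_def divide_inverse mult.commute)
        also have "\<dots> \<le> (A * norm ((x + (- h k) *\<^sub>R e) - x)) / h k"
          using h[of k] by (intro divide_right_mono A(2)) auto
        also have "\<dots> = A" using h[of k] ne by simp
        finally show ?thesis using True by (simp add: norm_mult mult_left_mono)
      next
        case False
        then show ?thesis using \<phi>K[OF False] by (simp add: \<psi>_def)
      qed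
    qed
    show "(\<lambda>x. u x * partial j \<phi> x) \<in> borel_measurable lborel" "(\<lambda>x. u x * \<psi> k x) \<in> borel_measurable lborel" for k
      using m\<psi> m by (auto intro!: borel_measurable_times)
  qed
  have eq: "(LINT x|lborel. u x * \<psi> k x) = - (LINT x|lborel. q k x * \<phi> x)" for k
  proof -
    have i1: "integrable lborel (\<lambda>x. u x * \<phi> x)"
      by (rule integrable_continuous_compact_support[OF _ K])
        (auto intro!: continuous_intros cu cp simp: \<phi>K)
    have i2: "integrable lborel (\<lambda>x. u x * \<phi> (x + (- h k) *\<^sub>R e))"
      by (rule integrable_continuous_compact_support[OF _ K])
        (use \<phi>K cpc[of "- (h k *\<^sub>R e)"] in \<open>auto intro!: continuous_intros cu\<close>)
    have i3: "integrable lborel (\<lambda>x. u (x + h k *\<^sub>R e) * \<phi> x)"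
      by (rule integrable_continuous_compact_support[OF _ K])
        (use \<phi>K in \<open>auto intro!: continuous_intros cuc cp\<close>)
    have tr: "(LINT x|lborel. u x * \<phi> (x + (- h k) *\<^sub>R e)) = (LINT x|lborel. u (x + h k *\<^sub>R e) * \<phi> x)"
      using lborel_integral_translate[OF borel_measurable_times[OF m(1)
          borel_measurable_continuous_onI[OF cpc[of "(- h k) *\<^sub>R e"]]], of "h k *\<^sub>R e"]
      by (simp add: add.commute[of "h k *\<^sub>R e"])
    have "(LINT x|lborel. u x * \<psi> k x) =
        (LINT x|lborel. (u x * \<phi> x - u x * \<phi> (x + (- h k) *\<^sub>R e)) /\<^sub>R h k)"
      by (rule Bochner_Integration.integral_cong) (auto simp: \<psi>_def algebra_simps)
    also have "\<dots> = ((LINT x|lborel. u x * \<phi> x) - (LINT x|lborel. u (x + h k *\<^sub>R e) * \<phi> x)) /\<^sub>R h k"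
      using i1 i2 tr by simp
    also have "\<dots> = - (((LINT x|lborel. u (x + h k *\<^sub>R e) * \<phi> x) - (LINT x|lborel. u x * \<phi> x)) /\<^sub>R h k)"
      by (simp add: algebra_simps)
    also have "((LINT x|lborel. u (x + h k *\<^sub>R e) * \<phi> x) - (LINT x|lborel. u x * \<phi> x)) /\<^sub>R h k
        = (LINT x|lborel. (u (x + h k *\<^sub>R e) * \<phi> x - u x * \<phi> x) /\<^sub>R h k)"
      using i1 i3 by simp
    also have "\<dots> = (LINT x|lborel. q k x * \<phi> x)"
      by (rule Bochner_Integration.integral_cong) (auto simp: q_def algebra_simps)
    finally show ?thesis .
  qed
  have lim2: "(\<lambda>k. LINT x|lborel. q k x * \<phi> x) \<longlonglongrightarrow> (LINT x|lborel. lim (\<lambda>k. q k x) * \<phi> x)"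
  proof (rule integral_dominated_convergence[where w="\<lambda>x. L * norm (\<phi> x)"])
    have "integrable lborel \<phi>"
      by (rule integrable_continuous_compact_support[OF cp K \<phi>K(1)])
    then show "integrable lborel (\<lambda>x. L * norm (\<phi> x))" by simp
    show "AE x in lborel. (\<lambda>k. q k x * \<phi> x) \<longlonglongrightarrow> lim (\<lambda>k. q k x) * \<phi> x"
      using u(2)
    proof eventually_elim
      case (elim x)
      have q: "(\<lambda>k. q k x) \<longlonglongrightarrow> frechet_derivative u (at x) e"
        unfolding q_def
        by (rule difference_quotient_tendsto[OF differentiable_has_derivative[OF elim] hlim(1) h(3)])
      show ?case unfolding limI[OF q] by (intro tendsto_mult q tendsto_const)
    qed
    show "AE x in lborel. norm (q k x * \<phi> x) \<le> L * norm (\<phi> x)" for k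
    proof (intro AE_I2)
      fix x
      have "norm (q k x) = norm (u (x + h k *\<^sub>R e) - u x) / h k"
        using h[of k] by (simp add: q_def divide_inverse mult.commute)
      also have "\<dots> \<le> (L * norm ((x + h k *\<^sub>R e) - x)) / h k"
        using h[of k] lipschitz_onD[OF u(1), of "x + h k *\<^sub>R e" x]
        by (intro divide_right_mono) (auto simp: dist_norm)
      also have "\<dots> = L" using h[of k] ne by simp
      finally show "norm (q k x * \<phi> x) \<le> L * norm (\<phi> x)" by (simp add: norm_mult mult_right_mono)
    qed
    show "(\<lambda>x. lim (\<lambda>k. q k x) * \<phi> x) \<in> borel_measurable lborel" "(\<lambda>x. q k x * \<phi> x) \<in> borel_measurable lborel" for k
      using mq m by (auto intro!: borel_measurable_times borel_measurable_lim_metric)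
  qed
  have "(\<lambda>k. LINT x|lborel. u x * \<psi> k x) \<longlonglongrightarrow> - (LINT x|lborel. lim (\<lambda>k. q k x) * \<phi> x)"
    using tendsto_minus[OF lim2] by (simp only: eq)
  then have "(LINT x|lborel. u x * partial j \<phi> x) = - (LINT x|lborel. lim (\<lambda>k. q k x) * \<phi> x)"
    by (rule LIMSEQ_unique[OF lim1])
  then show ?thesis by (simp only: q_def h_def e_def)
qed

lemma lipschitz_distributional_gradient:
  fixes u :: "real ^ 'n::finite \<Rightarrow> complex"
  assumes u: "L-lipschitz_on UNIV u" "AE x in lborel. u differentiable (at x)"
  obtains G where "distributional_gradient u G" "AE x in lborel. grad u x = G x"
proof -
  define h where "h k = inverse (real (Suc k))" for k
  define q where "q j k x = (u (x + h k *\<^sub>R axis j 1) - u x) /\<^sub>R h k" for j k x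
  \<comment> \<open>A limit of continuous quotients is measurable, and it agrees with
    \<open>grad u\<close> wherever u is differentiable.\<close>
  define G where "G x = (\<chi> j. lim (\<lambda>k. q j k x))" for x
  have cu: "continuous_on UNIV u" using u(1) lipschitz_on_continuous_on by blast
  have cuc: "continuous_on UNIV (\<lambda>x. u (x + c))" for c
    by (rule continuous_on_compose2[OF cu]) (auto intro!: continuous_intros)
  have [measurable]: "u \<in> borel_measurable borel" using cu by (rule borel_measurable_continuous_onI)
  have mq: "q j k \<in> borel_measurable borel" for j k
    unfolding q_def[abs_def]
    by (rule borel_measurable_continuous_onI) (rule continuous_on_scaleR[OF continuous_on_const continuous_on_diff[OF cuc cu]])
  have mG: "G \<in> borel_measurable borel"
  proof (rule borel_measurable_euclidean_space[THEN iffD2], rule ballI)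
    fix b :: "complex ^ 'n" assume "b \<in> Basis"
    then obtain j z where b: "b = axis j z" unfolding Basis_vec_def by blast
    have "(\<lambda>x. lim (\<lambda>k. q j k x) \<bullet> z) \<in> borel_measurable borel"
      by (rule borel_measurable_inner[OF borel_measurable_lim_metric[of "\<lambda>k. q j k", OF mq] borel_measurable_const])
    moreover have "G x \<bullet> b = lim (\<lambda>k. q j k x) \<bullet> z" for x
      unfolding b inner_axis G_def vec_lambda_beta ..
    ultimately show "(\<lambda>x. G x \<bullet> b) \<in> borel_measurable borel" by (simp only:)
  qed
  have qlim: "(\<lambda>k. q j k x) \<longlonglongrightarrow> partial j u x" if "u differentiable (at x)" for j x
    using difference_quotient_tendsto[OF differentiable_has_derivative[OF that] LIMSEQ_inverse_real_of_nat, of "axis j 1"]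
    by (simp add: q_def h_def partial_def)
  have G: "grad u x = G x" if "u differentiable (at x)" for x
    using limI[OF qlim[OF that]] by (simp add: vec_eq_iff grad_nth[OF that] G_def)
  \<comment> \<open>Each directional derivative is a limit of quotients bounded by the Lipschitz
    constant. The dimensional factor is harmless: the bound serves only for the local integrability
    of \<open>G\<close>.\<close>
  have nG: "norm (G x) \<le> real CARD('n) * L" if "u differentiable (at x)" for x
  proof -
    have d: "(u has_derivative frechet_derivative u (at x)) (at x)"
      by (rule differentiable_has_derivative[OF that])
    have "norm (frechet_derivative u (at x) v) \<le> L * norm v" for v
    proof (rule LIMSEQ_le_const2[OF tendsto_norm])
      show "(\<lambda>k. (u (x + inverse (real (Suc k)) *\<^sub>R v) - u x) /\<^sub>R inverse (real (Suc k)))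
          \<longlonglongrightarrow> frechet_derivative u (at x) v"
        by (rule difference_quotient_tendsto[OF d LIMSEQ_inverse_real_of_nat]) simp
      show "\<exists>N. \<forall>k\<ge>N. norm ((u (x + inverse (real (Suc k)) *\<^sub>R v) - u x) /\<^sub>R inverse (real (Suc k))) \<le> L * norm v"
      proof (intro exI allI impI)
        fix k
        define h where "h = inverse (real (Suc k))"
        have h: "0 < h" by (simp add: h_def)
        have "norm (u (x + h *\<^sub>R v) - u x) \<le> L * norm (h *\<^sub>R v)"
          using lipschitz_onD[OF u(1), of "x + h *\<^sub>R v" x] by (simp add: dist_norm)
        then have "inverse h * norm (u (x + h *\<^sub>R v) - u x) \<le> inverse h * (L * norm (h *\<^sub>R v))"
          by (rule mult_left_mono) (use h in simp)
        also have "\<dots> = L * norm v" using h by simp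
        finally have "norm ((u (x + h *\<^sub>R v) - u x) /\<^sub>R h) \<le> L * norm v"
          using h by simp
        then show "norm ((u (x + inverse (real (Suc k)) *\<^sub>R v) - u x) /\<^sub>R inverse (real (Suc k))) \<le> L * norm v"
          unfolding h_def .
      qed
    qed
    from norm_grad_le[OF d this] show ?thesis using G[OF that] by simp
  qed
  have AE_nG: "AE x in lborel. norm (G x) \<le> real CARD('n) * L"
    using u(2) by eventually_elim (rule nG)
  have lu: "locally_integrable lborel u"
    unfolding locally_integrable_def set_integrable_def
  proof (rule conjI)
    show "u \<in> borel_measurable lborel"
      unfolding measurable_lborel2 by (rule borel_measurable_continuous_onI[OF cu])
    show "\<forall>K. compact K \<longrightarrow> integrable lborel (\<lambda>x. indicator K x *\<^sub>R u x)"
      using borel_integrable_compact[OF _ continuous_on_subset[OF cu]] by blast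
  qed
  have lG: "locally_integrable lborel G"
    unfolding locally_integrable_def set_integrable_def
  proof (rule conjI)
    show mG': "G \<in> borel_measurable lborel"
      unfolding measurable_lborel2 by (rule mG)
    have "integrable lborel (\<lambda>x. indicator K x *\<^sub>R G x)" if K: "compact K" for K
    proof (rule integrableI_bounded_set_indicator[OF _ mG'])
      show "K \<in> sets lborel" using borel_compact[OF K] by simp
      show "emeasure lborel K < \<infinity>" by (rule emeasure_bounded_finite[OF compact_imp_bounded[OF K]])
      show "AE x in lborel. x \<in> K \<longrightarrow> norm (G x) \<le> real CARD('n) * L"
        using AE_nG by eventually_elim simp
    qed
    then show "\<forall>K. compact K \<longrightarrow> integrable lborel (\<lambda>x. indicator K x *\<^sub>R G x)" by blast
  qed
  have "(LINT x|lborel. u x * partial j \<phi> x) = - (LINT x|lborel. G x $ j * \<phi> x)"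
    if "smooth \<phi>" "compact (supp \<phi>)" for \<phi> j
    unfolding lipschitz_integration_by_parts[OF u that] by (simp only: G_def q_def h_def vec_lambda_beta)
  then have "distributional_gradient u G"
    unfolding distributional_gradient_def using lu lG by blast
  moreover have "AE x in lborel. grad u x = G x" using u(2) by eventually_elim (rule G)
  ultimately show ?thesis by (rule that)
qed

section \<open>Weighted measures\<close>

text \<open>As w > 0 a.e., the weighted and the Lebesgue measure have the same null sets. This
  carries differentiability from the weighted measure, in which it is proved, to Lebesgue measure,
  in which distributional gradients live.\<close>

lemma AE_weighted_iff:
  fixes w :: "real ^ 'n::finite \<Rightarrow> real"
  assumes "w \<in> borel_measurable lborel" "AE x in lborel. 0 < w x"
  shows "(AE x in weighted w. P x) \<longleftrightarrow> (AE x in lborel. P x)"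
proof -
  have "(AE x in weighted w. P x) \<longleftrightarrow> (AE x in lborel. 0 < ennreal (w x) \<longrightarrow> P x)"
    unfolding weighted_def using assms(1) by (intro AE_density) auto
  also have "\<dots> \<longleftrightarrow> (AE x in lborel. P x)"
  proof
    assume "AE x in lborel. 0 < ennreal (w x) \<longrightarrow> P x"
    with assms(2) show "AE x in lborel. P x" by eventually_elim simp
  next
    assume "AE x in lborel. P x"
    then show "AE x in lborel. 0 < ennreal (w x) \<longrightarrow> P x" by eventually_elim simp
  qed
  finally show ?thesis .
qed

lemma doubling_measure_weighted:
  fixes w :: "real ^ 'n::finite \<Rightarrow> real"
  assumes w: "w \<in> borel_measurable lborel" "AE x in lborel. 0 < w x" "doubling (weighted w) C0"
  shows "doubling_measure (weighted w) C0"
proof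
  show "sets (weighted w) = sets borel" by (simp add: weighted_def)
  fix x :: "real ^ 'n" and r :: real assume r: "0 < r"
  show "emeasure (weighted w) (ball x r) < \<infinity>"
    "emeasure (weighted w) (ball x (2 * r)) \<le> ennreal C0 * emeasure (weighted w) (ball x r)"
    using w(3) r unfolding doubling_def by auto
  show "0 < emeasure (weighted w) (ball x r)"
  proof (rule ccontr)
    assume "\<not> 0 < emeasure (weighted w) (ball x r)"
    then have "ball x r \<in> null_sets (weighted w)" by (auto simp: null_sets_def weighted_def)
    then have "AE y in weighted w. y \<notin> ball x r" by (rule AE_not_in)
    then have "AE y in lborel. y \<notin> ball x r" using AE_weighted_iff[OF w(1,2)] by simp
    then have "emeasure lborel (ball x r) = 0"
      using AE_iff_null_sets[of "ball x r" lborel] by (auto simp: null_sets_def)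
    then show False using r content_ball_pos[of r x] by (simp add: measure_def)
  qed
qed

text \<open>A Lipschitz \<open>g\<close> serves as its own representative in
  \<open>gradient_bounded\<close>.\<close>

lemma gradient_bounded_weighted:
  fixes g :: "real ^ 'n::finite \<Rightarrow> complex"
  assumes w: "w \<in> borel_measurable lborel" "AE x in lborel. 0 < w x"
    and g: "L-lipschitz_on UNIV g" "AE x in weighted w. g differentiable (at x) \<and> norm (grad g x) \<le> K"
  shows "gradient_bounded (weighted w) g K"
proof -
  have "AE x in lborel. g differentiable (at x)"
    using g(2) AE_weighted_iff[OF w, of "\<lambda>x. g differentiable (at x) \<and> norm (grad g x) \<le> K"] by auto
  then obtain G where "distributional_gradient g G" "AE x in lborel. grad g x = G x"
    using lipschitz_distributional_gradient[OF g(1)] by blast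
  then show ?thesis
    unfolding gradient_bounded_def using g AE_weighted_iff[OF w]
    by (intro conjI exI[of _ g] exI[of _ L] exI[of _ G]) auto
qed

section \<open>Averages over balls\<close>

context doubling_measure
begin

lemma measurable_continuous:
  "continuous_on UNIV f \<Longrightarrow> f \<in> borel_measurable M"
  unfolding measurable_cong_sets[OF sets_M refl] by (rule borel_measurable_continuous_onI)

lemma set_integrable_ball:
  fixes f :: "'a \<Rightarrow> 'b::{banach, second_countable_topology}"
  assumes "continuous_on UNIV f"
  shows "set_integrable M (ball x r) f"
proof -
  have "compact (f ` cball x r)"
    by (rule compact_continuous_image[OF continuous_on_subset[OF assms] compact_cball]) simp
  then have "bounded (f ` cball x r)" by (rule compact_imp_bounded)
  then obtain B where B: "\<And>y. y \<in> cball x r \<Longrightarrow> norm (f y) \<le> B"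
    unfolding bounded_iff by blast
  show ?thesis
    unfolding set_integrable_def
  proof (rule integrableI_bounded_set_indicator[OF open_sets[OF open_ball] measurable_continuous[OF assms]])
    show "emeasure M (ball x r) < \<infinity>" unfolding emeasure_ball by simp
    show "AE y in M. y \<in> ball x r \<longrightarrow> norm (f y) \<le> B"
      by (intro AE_I2 impI B) simp
  qed
qed

lemma locally_integrable_continuous:
  fixes f :: "'a \<Rightarrow> 'b::{banach, second_countable_topology}"
  assumes "continuous_on UNIV f"
  shows "locally_integrable M f"
  unfolding locally_integrable_def
proof (intro conjI allI impI)
  show "f \<in> borel_measurable M" by (rule measurable_continuous[OF assms])
  fix K :: "'a set" assume K: "compact K"
  obtain r where r: "K \<subseteq> ball 0 r" using bounded_subset_ballD[OF compact_imp_bounded[OF K], of 0] by blast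
  show "set_integrable M K f"
    by (rule set_integrable_subset[OF set_integrable_ball[OF assms] _ r]) (simp add: sets_M borel_compact K)
qed

lemma set_integral_const_ball:
  "(LINT y:ball x r|M. c) = measure M (ball x r) *\<^sub>R (c::'b::{banach, second_countable_topology})"
  unfolding set_lebesgue_integral_def
proof (rule has_bochner_integral_integral_eq, rule has_bochner_integral_indicator)
  show "emeasure M (ball x r) < \<infinity>" unfolding emeasure_ball by simp
qed simp

lemma set_integral_ball_mono:
  fixes f g :: "'a \<Rightarrow> real"
  assumes "continuous_on UNIV f" "continuous_on UNIV g" "\<And>y. y \<in> ball x r \<Longrightarrow> f y \<le> g y"
  shows "(LINT y:ball x r|M. f y) \<le> (LINT y:ball x r|M. g y)"
  by (rule set_integral_mono[OF set_integrable_ball[OF assms(1)] set_integrable_ball[OF assms(2)] assms(3)])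

lemma set_integral_ball_subset:
  fixes f :: "'a \<Rightarrow> real"
  assumes "continuous_on UNIV f" "\<And>y. 0 \<le> f y" "ball x r \<subseteq> ball y s"
  shows "(LINT y:ball x r|M. f y) \<le> (LINT y:ball y s|M. f y)"
  unfolding set_lebesgue_integral_def
proof (rule integral_mono)
  show "indicator (ball x r) z *\<^sub>R f z \<le> indicator (ball y s) z *\<^sub>R f z" for z
    using assms(2,3) by (auto simp: indicator_def)
qed (rule set_integrable_ball[OF assms(1), unfolded set_integrable_def])+

lemma measure_times_average:
  "0 < r \<Longrightarrow> measure M (ball x r) *\<^sub>R average M (ball x r) f = (LINT y:ball x r|M. f y)"
  using measure_ball_pos[of r x] by (simp add: average_def)

lemma average_mono:
  fixes f g :: "'a \<Rightarrow> real"
  assumes "continuous_on UNIV f" "continuous_on UNIV g" "\<And>y. y \<in> ball x r \<Longrightarrow> f y \<le> g y"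
  shows "average M (ball x r) f \<le> average M (ball x r) g"
  unfolding average_def using set_integral_ball_mono[OF assms] by (simp add: divide_right_mono)

lemma average_nonneg: "(\<And>y. 0 \<le> f y) \<Longrightarrow> 0 \<le> average M (ball x r) (f :: 'a \<Rightarrow> real)"
  unfolding average_def set_lebesgue_integral_def by (auto intro!: divide_nonneg_nonneg integral_nonneg)

lemma average_diff_const:
  fixes f :: "'a \<Rightarrow> 'b::{banach, second_countable_topology}"
  assumes "continuous_on UNIV f" "0 < r"
  shows "average M (ball x r) f - c = average M (ball x r) (\<lambda>y. f y - c)"
proof -
  have "(LINT y:ball x r|M. f y - c) = (LINT y:ball x r|M. f y) - (LINT y:ball x r|M. c)"
    by (intro set_integral_diff set_integrable_ball assms continuous_on_const)
  then show ?thesis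
    using measure_ball_pos[OF assms(2), of x]
    unfolding average_def set_integral_const_ball by (simp only: scaleR_diff_right) simp
qed

lemma norm_average_le:
  fixes f :: "'a \<Rightarrow> 'b::{banach, second_countable_topology}"
  assumes "continuous_on UNIV f"
  shows "norm (average M (ball x r) f) \<le> average M (ball x r) (\<lambda>y. norm (f y))"
proof -
  have "norm (LINT y:ball x r|M. f y) \<le> (LINT y:ball x r|M. norm (f y))"
    by (rule set_integral_norm_bound[OF set_integrable_ball[OF assms]])
  then have "(1 / measure M (ball x r)) * norm (LINT y:ball x r|M. f y) \<le>
      (1 / measure M (ball x r)) * (LINT y:ball x r|M. norm (f y))"
    by (rule mult_left_mono) simp
  then show ?thesis by (simp only: average_def norm_scaleR real_scaleR_def) simp
qed

lemma average_const_le: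
  assumes "continuous_on UNIV f" "0 < r" "\<And>y. y \<in> ball x r \<Longrightarrow> f y \<le> (c::real)"
  shows "average M (ball x r) f \<le> c"
proof -
  have "average M (ball x r) f \<le> average M (ball x r) (\<lambda>y. c)"
    using assms by (intro average_mono) auto
  also have "\<dots> = c" using measure_ball_pos[OF assms(2), of x] by (simp add: average_def set_integral_const_ball)
  finally show ?thesis .
qed

lemma average_ball_subset_le:
  fixes f :: "'a \<Rightarrow> real"
  assumes "continuous_on UNIV f" "\<And>y. 0 \<le> f y" "ball x r \<subseteq> ball y s" "0 < r"
    "measure M (ball y s) \<le> T * measure M (ball x r)"
  shows "average M (ball x r) f \<le> T * average M (ball y s) f"
proof -
  let ?a = "measure M (ball x r)" and ?b = "measure M (ball y s)" and ?J = "LINT z:ball y s|M. f z"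
  have a: "0 < ?a" by (rule measure_ball_pos) fact
  then have b: "0 < ?b" using measure_ball_mono[OF assms(3)] by linarith
  have J: "0 \<le> ?J" unfolding set_lebesgue_integral_def using assms(2) by (auto intro!: integral_nonneg)
  have "average M (ball x r) f \<le> ?J / ?a"
    using divide_right_mono[OF set_integral_ball_subset[OF assms(1,2,3)] less_imp_le[OF a]]
    by (simp add: average_def)
  also have "\<dots> = (?b * ?J) / (?a * ?b)" using a b by simp
  also have "\<dots> \<le> (T * ?a * ?J) / (?a * ?b)"
    using mult_right_mono[OF assms(5) J] a b by (intro divide_right_mono) auto
  also have "\<dots> = T * (?J / ?b)" using a by simp
  finally show ?thesis by (simp add: average_def)
qed

text \<open>A substitute for Jensen's inequality: if \<open>t > S\<close>, then \<open>t \<le> t\<^sup>p S\<^sup>1\<^sup>-\<^sup>p\<close>.\<close>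

lemma average_le_of_average_powr:
  fixes u :: "'a \<Rightarrow> real"
  assumes u: "continuous_on UNIV u" "\<And>y. 0 \<le> u y" and p: "1 \<le> p" and S: "0 < S" and r: "0 < r"
    and le: "average M (ball x r) (\<lambda>y. u y powr p) \<le> S powr p"
  shows "average M (ball x r) u \<le> 2 * S"
proof -
  have cp: "continuous_on UNIV (\<lambda>y. u y powr p)"
    using u p by (intro continuous_on_powr') auto
  have pt: "u y - S \<le> S powr (1 - p) * u y powr p" for y
  proof (cases "u y \<le> S")
    case True
    moreover have "0 \<le> S powr (1 - p) * u y powr p" by simp
    ultimately show ?thesis by linarith
  next
    case False
    then have "u y = u y powr (1 - p) * u y powr p" using S by (simp add: powr_add[symmetric])
    also have "\<dots> \<le> S powr (1 - p) * u y powr p"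
      using False S p by (intro mult_right_mono powr_mono2') auto
    finally show ?thesis using S by linarith
  qed
  have "average M (ball x r) u - S = average M (ball x r) (\<lambda>y. u y - S)"
    by (rule average_diff_const[OF u(1) r])
  also have "\<dots> \<le> average M (ball x r) (\<lambda>y. S powr (1 - p) * u y powr p)"
    using pt by (intro average_mono continuous_intros u cp) auto
  also have "\<dots> = S powr (1 - p) * average M (ball x r) (\<lambda>y. u y powr p)"
    by (simp add: average_def)
  also have "\<dots> \<le> S powr (1 - p) * S powr p" using le by (intro mult_left_mono) auto
  also have "\<dots> = S" using S by (simp add: powr_add[symmetric])
  finally show ?thesis by simp
qed

end

section \<open>The exceptional set\<close>

lemma powr_add_le:
  fixes a b p :: real
  assumes "0 \<le> a" "0 \<le> b" "0 \<le> p"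
  shows "(a + b) powr p \<le> 2 powr p * (a powr p + b powr p)"
proof -
  have "(a + b) powr p \<le> (2 * max a b) powr p" using assms by (intro powr_mono2) auto
  also have "\<dots> = 2 powr p * max a b powr p" using assms by (simp add: powr_mult)
  also have "max a b powr p \<le> a powr p + b powr p" by (simp add: max_def)
  finally show ?thesis by (simp add: mult_left_mono)
qed

lemma norm_grad_one_minus_le:
  assumes "h differentiable (at x)"
  shows "norm (grad (\<lambda>x. 1 - h x) x) \<le> norm (grad h x)"
proof -
  have d: "(\<lambda>x. - 1 * h x) differentiable (at x)" using assms by (intro differentiable_mult) auto
  have "grad (\<lambda>x. 1 + - 1 * h x) x = grad (\<lambda>x. 1) x + grad (\<lambda>x. - 1 * h x) x"
    by (rule grad_add[OF _ d]) simp
  then have "norm (grad (\<lambda>x. 1 - h x) x) = norm (grad (\<lambda>x. - 1 * h x) x)" by simp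
  also have "\<dots> \<le> norm (- 1 :: complex) * norm (grad h x) + norm (grad (\<lambda>x. - 1) x) * norm (h x)"
    by (rule norm_grad_mult_le[OF _ assms]) simp
  finally show ?thesis by simp
qed

text \<open>\<open>CP\<close> is strictly positive so that the quantities \<open>CP * r * T\<close>
  below are positive, as the substitute for Jensen's inequality demands; any Poincare constant may
  be enlarged to meet this.\<close>

locale calderon_zygmund = doubling_measure M D for M :: "(real ^ 'n::finite) measure" and D :: real +
  fixes f :: "real ^ 'n \<Rightarrow> complex" and p CP \<alpha> :: real
  assumes p: "1 \<le> p" and CP: "0 < CP" and poincare: "poincare M p p CP" and f: "schwartz f"
    and energy_integrable: "integrable M (\<lambda>x. norm (grad f x) powr p)" and \<alpha>: "0 < \<alpha>"
begin

definition energy :: "real ^ 'n \<Rightarrow> real" where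
  "energy x = norm (grad f x) powr p"

text \<open>Written between measures and without division, so that it is literally the set in
  \<open>weak_type\<close>. In the uncentred form a point outside \<open>U\<close> controls every
  ball that contains it.\<close>

definition U :: "(real ^ 'n) set" where
  "U = {x. \<exists>c r. 0 < r \<and> x \<in> ball c r \<and> ennreal (\<alpha> powr p) * emeasure M (ball c r) <
     emeasure (density M (\<lambda>y. ennreal (energy y))) (ball c r)}"

definition d :: "real ^ 'n \<Rightarrow> real" where
  "d x = infdist x (- U)"

lemma smooth_f: "smooth f"
  using f unfolding schwartz_def by blast

lemma continuous_f: "continuous_on S f"
  by (rule smooth_continuous[OF smooth_f])

lemma continuous_powr: "continuous_on S u \<Longrightarrow> 1 \<le> q \<Longrightarrow> continuous_on S (\<lambda>x. norm (u x) powr q)"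
  by (rule continuous_on_powr') (auto intro: continuous_on_norm)

lemma continuous_energy: "continuous_on S energy"
  unfolding energy_def[abs_def] by (rule continuous_powr[OF continuous_on_grad[OF smooth_f] p])

lemma energy_nonneg: "0 \<le> energy x"
  by (simp add: energy_def)

lemma emeasure_energy:
  assumes "A \<in> sets M"
  shows "emeasure (density M (\<lambda>y. ennreal (energy y))) A = ennreal (LINT y:A|M. energy y)"
proof -
  have m: "energy \<in> borel_measurable M" by (rule measurable_continuous[OF continuous_energy])
  have "emeasure (density M (\<lambda>y. ennreal (energy y))) A = (\<integral>\<^sup>+y. ennreal (energy y) * indicator A y \<partial>M)"
    using m assms by (intro emeasure_density) auto
  also have "\<dots> = (\<integral>\<^sup>+y. ennreal (indicator A y *\<^sub>R energy y) \<partial>M)"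
    by (intro nn_integral_cong) (simp add: indicator_def)
  also have "\<dots> = ennreal (LINT y|M. indicator A y *\<^sub>R energy y)"
  proof (rule nn_integral_eq_integral)
    show "integrable M (\<lambda>y. indicator A y *\<^sub>R energy y)"
      using integrable_mult_indicator[OF assms energy_integrable] by (simp add: energy_def)
  qed (simp add: energy_nonneg)
  finally show ?thesis by (simp add: set_lebesgue_integral_def)
qed

lemma open_U: "open U"
  unfolding U_def by (rule weak_type(1)) (auto simp: sets_M)

lemma emeasure_U_le: "emeasure M U \<le> ennreal (D ^ 3 * \<alpha> powr (- p) * (LINT x|M. energy x))"
proof -
  have J: "0 \<le> (LINT x|M. energy x)" by (simp add: energy_nonneg)
  have "ennreal (\<alpha> powr p) * emeasure M U \<le> ennreal (D ^ 3) * emeasure (density M (\<lambda>y. ennreal (energy y))) UNIV"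
    unfolding U_def by (rule weak_type(2)) (auto simp: sets_M)
  also have "emeasure (density M (\<lambda>y. ennreal (energy y))) UNIV = ennreal (LINT x|M. energy x)"
    using emeasure_energy[of UNIV] by (simp add: set_lebesgue_integral_def)
  finally have "ennreal (\<alpha> powr (- p)) * (ennreal (\<alpha> powr p) * emeasure M U) \<le>
      ennreal (\<alpha> powr (- p)) * (ennreal (D ^ 3) * ennreal (LINT x|M. energy x))"
    by (rule mult_left_mono) simp
  moreover have "ennreal (\<alpha> powr (- p)) * (ennreal (\<alpha> powr p) * emeasure M U) = emeasure M U"
  proof -
    have "ennreal (\<alpha> powr (- p)) * ennreal (\<alpha> powr p) = 1"
      using \<alpha> by (simp add: ennreal_mult[symmetric] powr_add[symmetric])
    then show ?thesis by (simp add: mult.assoc[symmetric])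
  qed
  ultimately show ?thesis
    using J D_ge_1 by (simp add: ennreal_mult[symmetric] mult_ac)
qed

lemma emeasure_U_finite: "emeasure M U < \<infinity>"
  by (rule le_less_trans[OF emeasure_U_le]) simp

lemma U_ne: "U \<noteq> UNIV"
  using emeasure_U_finite emeasure_UNIV by auto

lemma d_pos: "x \<in> U \<Longrightarrow> 0 < d x"
  unfolding d_def using open_U U_ne by (intro infdist_pos_not_in_closed) auto

lemma d_zero: "x \<notin> U \<Longrightarrow> d x = 0"
  unfolding d_def by simp

lemma d_le: "d x \<le> d y + dist x y"
  unfolding d_def by (rule infdist_triangle)

lemma d_le_dist: "y \<notin> U \<Longrightarrow> d x \<le> dist x y"
  unfolding d_def by (rule infdist_le) simp

lemma set_integral_energy_le:
  assumes "x \<notin> U" "x \<in> ball c r"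
  shows "(LINT y:ball c r|M. energy y) \<le> \<alpha> powr p * measure M (ball c r)"
proof -
  have "0 < r" using assms(2) by (metis ball_eq_empty empty_iff not_less)
  then have "\<not> ennreal (\<alpha> powr p) * emeasure M (ball c r) < emeasure (density M (\<lambda>y. ennreal (energy y))) (ball c r)"
    using assms unfolding U_def by blast
  then have "ennreal (LINT y:ball c r|M. energy y) \<le> ennreal (\<alpha> powr p * measure M (ball c r))"
    unfolding not_less emeasure_energy[OF open_sets[OF open_ball]] emeasure_ball
    by (simp add: ennreal_mult)
  then show ?thesis by (rule ennreal_le_iff[THEN iffD1, rotated]) simp
qed

text \<open>Continuity of the gradient replaces Lebesgue differentiation and gives the bound at
  every such point: were the norm above \<alpha> at x, it would exceed some \<beta> > \<alpha> on a
  ball around x, and that ball would put x into \<open>U\<close>.\<close>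

lemma norm_grad_f_le: "x \<notin> U \<Longrightarrow> norm (grad f x) \<le> \<alpha>"
proof (rule ccontr)
  assume x: "x \<notin> U" and "\<not> norm (grad f x) \<le> \<alpha>"
  define \<beta> where "\<beta> = (\<alpha> + norm (grad f x)) / 2"
  have \<beta>: "\<alpha> < \<beta>" "\<beta> < norm (grad f x)" using \<open>\<not> norm (grad f x) \<le> \<alpha>\<close> by (auto simp: \<beta>_def)
  have "open {y. \<beta> < norm (grad f y)}"
    by (rule open_Collect_less[OF continuous_on_const continuous_on_norm[OF continuous_on_grad[OF smooth_f]]])
  then obtain r where r: "0 < r" "ball x r \<subseteq> {y. \<beta> < norm (grad f y)}"
    using \<beta>(2) unfolding open_contains_ball by blast
  have "\<beta> powr p * measure M (ball x r) = (LINT y:ball x r|M. \<beta> powr p)"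
    by (simp add: set_integral_const_ball)
  also have "\<dots> \<le> (LINT y:ball x r|M. energy y)"
  proof (rule set_integral_ball_mono[OF continuous_on_const continuous_energy])
    fix y assume "y \<in> ball x r"
    then have "\<beta> \<le> norm (grad f y)" using r(2) by auto
    then show "\<beta> powr p \<le> energy y" unfolding energy_def using \<alpha> \<beta> p by (intro powr_mono2) auto
  qed
  also have "\<dots> \<le> \<alpha> powr p * measure M (ball x r)"
    using x r(1) by (intro set_integral_energy_le[of x]) auto
  also have "\<dots> < \<beta> powr p * measure M (ball x r)"
    using \<alpha> \<beta> p by (intro mult_strict_right_mono powr_less_mono2 measure_ball_pos r) auto
  finally show False by simp
qed

text \<open>Twice the distance is enough for the ball to contain a nearest point of the complement,
  and that point certifies the bound.\<close>

lemma average_energy_le: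
  assumes "z \<in> U"
  shows "average M (ball z (2 * d z)) energy \<le> \<alpha> powr p"
proof -
  have "closed (- U)" "- U \<noteq> {}" using open_U U_ne by auto
  then obtain y where y: "y \<in> - U" "d z = dist z y"
    unfolding d_def by (rule infdist_attains_inf)
  have "0 < d z" using d_pos assms by blast
  have "(LINT y:ball z (2 * d z)|M. energy y) \<le> \<alpha> powr p * measure M (ball z (2 * d z))"
    using y \<open>0 < d z\<close> by (intro set_integral_energy_le[of y]) auto
  then show ?thesis
    using measure_ball_pos[of "2 * d z" z] \<open>0 < d z\<close> by (simp add: average_def divide_le_eq)
qed

section \<open>Oscillation of f on balls of controlled energy\<close>

lemma locally_lipschitz_f: "locally_lipschitz f"
proof -
  obtain A where A: "0 \<le> A" "\<And>x. norm (grad f x) \<le> A" using schwartz_grad_bounded[OF f] by blast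
  have "A-lipschitz_on S f" for S
    by (rule lipschitz_onI) (use A grad_bound_lipschitz[OF convex_UNIV smooth_differentiable[OF smooth_f] A(2)] in \<open>auto simp: dist_norm\<close>)
  then show ?thesis unfolding locally_lipschitz_def using zero_less_one by blast
qed

text \<open>The exponent q is left free because the lemma serves twice: with q = p for the gradient
  estimates, and with general q for the size of the bad functions.\<close>

lemma poincare_ball:
  assumes q: "poincare M p q C" "0 \<le> C" and r: "0 < r" and T: "0 \<le> T" "average M (ball x r) energy \<le> T powr p"
  shows "average M (ball x r) (\<lambda>y. norm (f y - average M (ball x r) f) powr q) powr (1 / q) \<le> C * r * T"
proof -
  have "average M (ball x r) (\<lambda>y. norm (f y - average M (ball x r) f) powr q) powr (1 / q)
      \<le> C * r * average M (ball x r) energy powr (1 / p)"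
    using q(1) r locally_lipschitz_f unfolding poincare_def energy_def[abs_def] by blast
  also have "\<dots> \<le> C * r * (T powr p) powr (1 / p)"
    using p q r T by (intro mult_left_mono powr_mono2 average_nonneg energy_nonneg) auto
  also have "(T powr p) powr (1 / p) = T" using p T by (simp add: powr_powr)
  finally show ?thesis .
qed

lemma average_oscillation_powr_le:
  assumes r: "0 < r" and T: "0 \<le> T" "average M (ball x r) energy \<le> T powr p"
  shows "average M (ball x r) (\<lambda>y. norm (f y - average M (ball x r) f) powr p) \<le> (CP * r * T) powr p"
proof -
  let ?V = "average M (ball x r) (\<lambda>y. norm (f y - average M (ball x r) f) powr p)"
  have V: "0 \<le> ?V" by (rule average_nonneg) simp
  have "?V powr (1 / p) \<le> CP * r * T"
    by (rule poincare_ball[OF poincare less_imp_le[OF CP] r T])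
  then have "(?V powr (1 / p)) powr p \<le> (CP * r * T) powr p" using p by (intro powr_mono2) auto
  then show ?thesis using p V by (simp add: powr_powr)
qed

lemma average_oscillation_le:
  assumes r: "0 < r" and T: "0 < T" "average M (ball x r) energy \<le> T powr p"
  shows "average M (ball x r) (\<lambda>y. norm (f y - average M (ball x r) f)) \<le> 2 * (CP * r * T)"
proof (rule average_le_of_average_powr[OF _ _ p _ r])
  show "continuous_on UNIV (\<lambda>y. norm (f y - average M (ball x r) f))"
    by (intro continuous_on_norm continuous_on_diff continuous_f continuous_on_const)
  show "0 < CP * r * T" using CP r T by simp
  show "average M (ball x r) (\<lambda>y. norm (f y - average M (ball x r) f) powr p) \<le> (CP * r * T) powr p"
    by (rule average_oscillation_powr_le[OF r less_imp_le[OF T(1)] T(2)])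
qed simp

end

section \<open>The decomposition\<close>

text \<open>The centres are indexed by natural numbers because the partition of unity needs an order
  in which each bump has only finitely many predecessors.\<close>

locale calderon_zygmund_covering = calderon_zygmund M D f p CP \<alpha>
  for M :: "(real ^ 'n::finite) measure" and D f p CP \<alpha> +
  fixes I :: "nat set" and c :: "nat \<Rightarrow> real ^ 'n" and K :: real
  assumes c_in_U: "i \<in> I \<Longrightarrow> c i \<in> U"
    and disjoint: "i \<in> I \<Longrightarrow> j \<in> I \<Longrightarrow> i \<noteq> j \<Longrightarrow> ball (c i) (d (c i) / 20) \<inter> ball (c j) (d (c j) / 20) = {}"
    and cover: "z \<in> U \<Longrightarrow> \<exists>i\<in>I. dist z (c i) \<le> 3/20 * d (c i)"
    and K: "0 \<le> K" "0 < \<rho> \<Longrightarrow> norm (grad (bump a \<rho> :: real ^ 'n \<Rightarrow> complex) x) \<le> K / \<rho>"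
begin

text \<open>The bumps vanish beyond 9/40 of \<open>d (c i)\<close>; 1/4 is slightly larger, so that
  the closed supports fit into the open balls.\<close>

definition r :: "nat \<Rightarrow> real" where
  "r i = d (c i) / 4"

text \<open>The threshold exceeds 1/4 by enough to include every index whose partition function is
  active anywhere in \<open>ball z (d z / 20)\<close>.\<close>

definition near :: "real ^ 'n \<Rightarrow> nat set" where
  "near z = {i \<in> I. dist z (c i) < d (c i) / 3}"

definition \<phi> :: "nat \<Rightarrow> real ^ 'n \<Rightarrow> complex" where
  "\<phi> i = bump (c i) (3/20 * d (c i))"

text \<open>This partition of unity on \<open>U\<close> telescopes: its partial sums are \<open>1 - (\<Prod>j<n. 1 - \<phi> j)\<close>.\<close>

definition \<psi> :: "nat \<Rightarrow> real ^ 'n \<Rightarrow> complex" where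
  "\<psi> i x = \<phi> i x * (\<Prod>j\<in>{j\<in>I. j < i}. 1 - \<phi> j x)"

definition m :: "nat \<Rightarrow> complex" where
  "m i = average M (ball (c i) (r i)) f"

definition b :: "nat \<Rightarrow> real ^ 'n \<Rightarrow> complex" where
  "b i x = (f x - m i) * \<psi> i x"

definition g :: "real ^ 'n \<Rightarrow> complex" where
  "g x = (if x \<in> U then f x - (\<Sum>i\<in>near x. b i x) else f x)"

section \<open>Geometry of the Whitney balls\<close>

lemma d_c_pos: "i \<in> I \<Longrightarrow> 0 < d (c i)"
  using d_pos c_in_U by blast

lemma r_pos: "i \<in> I \<Longrightarrow> 0 < r i"
  using d_c_pos by (simp add: r_def)

lemma near_subset: "near z \<subseteq> I"
  by (auto simp: near_def)

lemma near_d: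
  assumes "i \<in> near z"
  shows "i \<in> I" "dist z (c i) < d (c i) / 3" "d (c i) \<le> 3/2 * d z" "d z \<le> 4/3 * d (c i)" "0 < d z"
proof -
  show 1: "i \<in> I" "dist z (c i) < d (c i) / 3" using assms by (auto simp: near_def)
  have "d (c i) \<le> d z + dist z (c i)" "d z \<le> d (c i) + dist z (c i)"
    using d_le[of "c i" z] d_le[of z "c i"] by (simp_all add: dist_commute)
  then show "d (c i) \<le> 3/2 * d z" "d z \<le> 4/3 * d (c i)" "0 < d z"
    using 1 d_c_pos[OF 1(1)] by linarith+
qed

lemma inj_c: "inj_on c I"
proof (rule inj_onI, rule ccontr)
  fix i j assume "i \<in> I" "j \<in> I" "c i = c j" "i \<noteq> j"
  then have "ball (c i) (d (c i) / 20) = {}" using disjoint[of i j] by simp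
  then show False using d_c_pos[OF \<open>i \<in> I\<close>] by (simp add: not_less)
qed

lemma near_finite: "z \<in> U \<Longrightarrow> finite (near z)"
  and card_near: "z \<in> U \<Longrightarrow> real (card (near z)) \<le> D ^ 6"
proof -
  assume z: "z \<in> U"
  have im: "c ` near z = {x \<in> c ` I. dist z x < infdist x (- U) / 3}"
    by (auto simp: near_def d_def)
  have sub: "c ` I \<subseteq> U" using c_in_U by blast
  have dis: "ball x (infdist x (- U) / 20) \<inter> ball y (infdist y (- U) / 20) = {}"
    if "x \<in> c ` I" "y \<in> c ` I" "x \<noteq> y" for x y
    using that disjoint unfolding d_def by blast
  note ov = whitney_overlap[OF open_U U_ne sub dis z]
  have inj: "inj_on c (near z)" using inj_c near_subset inj_on_subset by blast
  show "finite (near z)" using ov(1) unfolding im[symmetric] by (rule finite_imageD[OF _ inj])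
  show "real (card (near z)) \<le> D ^ 6"
    using ov(2) unfolding im[symmetric] card_image[OF inj] .
qed

section \<open>The partition of unity\<close>

lemma smooth_\<phi>: "smooth (\<phi> i)"
  unfolding \<phi>_def by (rule smooth_bump)

lemma differentiable_\<phi>: "\<phi> i differentiable (at x)"
  by (rule smooth_differentiable[OF smooth_\<phi>])

lemma norm_\<phi>: "norm (\<phi> i x) \<le> 1" "norm (1 - \<phi> i x) \<le> 1"
  unfolding \<phi>_def by (rule norm_bump)+

lemma \<phi>_eq_0: "i \<in> I \<Longrightarrow> 9/40 * d (c i) \<le> dist x (c i) \<Longrightarrow> \<phi> i x = 0"
  unfolding \<phi>_def using d_c_pos by (intro bump_eq_0) auto

lemma grad_\<phi>_eq_0:
  assumes "i \<in> I" "i \<notin> near x"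
  shows "grad (\<phi> i) x = 0"
proof -
  have "grad (\<phi> i) x = grad (\<lambda>x. 0) x"
  proof (rule grad_cong_open(1))
    show "open {y. 9/40 * d (c i) < dist y (c i)}"
      by (intro open_Collect_less continuous_on_const continuous_on_dist continuous_on_id)
    show "x \<in> {y. 9/40 * d (c i) < dist y (c i)}"
      using assms d_c_pos[OF assms(1)] by (simp add: near_def)
    show "\<phi> i y = 0" if "y \<in> {y. 9/40 * d (c i) < dist y (c i)}" for y
      using that by (intro \<phi>_eq_0 assms) simp
  qed
  then show ?thesis by simp
qed

lemma norm_grad_\<phi>:
  assumes "i \<in> near x"
  shows "norm (grad (\<phi> i) x) \<le> 9 * K / d x"
proof -
  note n = near_d[OF assms]
  have "norm (grad (\<phi> i) x) \<le> K / (3/20 * d (c i))"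
    unfolding \<phi>_def using d_c_pos[OF n(1)] by (intro K) simp
  \<comment> \<open>As \<open>d x\<close> is at most 4/3 of \<open>d (c i)\<close>, its ninth is at
    most 4/27 < 3/20 of it.\<close>
  also have "\<dots> \<le> K / (1/9 * d x)"
    using n K d_c_pos[OF n(1)] by (intro divide_left_mono) auto
  finally show ?thesis by (simp add: mult.commute)
qed

lemma smooth_one_minus_\<phi>: "smooth (\<lambda>x. 1 - \<phi> i x)"
  by (rule smooth_diff[OF smooth_const smooth_\<phi>])

lemma smooth_\<psi>: "smooth (\<psi> i)"
proof -
  have "smooth (\<lambda>x. \<phi> i x * (\<Prod>j\<in>{j\<in>I. j < i}. 1 - \<phi> j x))"
    by (rule smooth_mult[OF smooth_\<phi> smooth_prod[OF smooth_one_minus_\<phi>]])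
  then show ?thesis by (simp add: \<psi>_def[abs_def])
qed

lemma norm_prod_le: "norm (\<Prod>j\<in>S. 1 - \<phi> j x) \<le> 1"
  unfolding prod_norm[symmetric] using norm_\<phi> by (intro prod_le_1) auto

lemma norm_\<psi>: "norm (\<psi> i x) \<le> 1"
proof -
  have "norm (\<psi> i x) \<le> 1 * 1"
    unfolding \<psi>_def norm_mult by (intro mult_mono norm_\<phi> norm_prod_le) auto
  then show ?thesis by simp
qed

lemma \<psi>_ne_0: "i \<in> I \<Longrightarrow> \<psi> i x \<noteq> 0 \<Longrightarrow> dist x (c i) < 9/40 * d (c i)"
  using \<phi>_eq_0[of i x] unfolding \<psi>_def by fastforce

text \<open>The number of factors in \<open>\<psi> i\<close> grows with i, but a factor has a
  nonzero gradient at x only if its index is in \<open>near x\<close>. At most \<open>D ^ 6\<close>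
  terms survive, so the bound does not depend on the enumeration.\<close>

lemma norm_grad_\<psi>:
  assumes x: "x \<in> U" and i: "i \<in> I"
  shows "norm (grad (\<psi> i) x) \<le> D ^ 6 * (9 * K / d x)"
proof -
  let ?S = "{j\<in>I. j < i}" and ?T = "{j\<in>I. j \<le> i}"
  have fin: "finite ?S" "finite ?T" by auto
  have T: "?T = insert i ?S" using i by auto
  have e: "\<psi> i = (\<lambda>x. \<phi> i x * (\<Prod>j\<in>?S. 1 - \<phi> j x))" by (rule ext) (rule \<psi>_def)
  have dm: "(\<lambda>x. 1 - \<phi> j x) differentiable (at x)" for j
    by (rule smooth_differentiable[OF smooth_one_minus_\<phi>])
  have "norm (grad (\<psi> i) x) \<le> norm (\<phi> i x) * norm (grad (\<lambda>x. \<Prod>j\<in>?S. 1 - \<phi> j x) x)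
      + norm (grad (\<phi> i) x) * norm (\<Prod>j\<in>?S. 1 - \<phi> j x)"
    unfolding e by (rule norm_grad_mult_le[OF differentiable_\<phi> differentiable_prod_fun[OF dm]])
  also have "\<dots> \<le> 1 * norm (grad (\<lambda>x. \<Prod>j\<in>?S. 1 - \<phi> j x) x) + norm (grad (\<phi> i) x) * 1"
    by (intro add_mono mult_right_mono mult_left_mono norm_\<phi> norm_prod_le) auto
  also have "norm (grad (\<lambda>x. \<Prod>j\<in>?S. 1 - \<phi> j x) x) \<le> (\<Sum>j\<in>?S. norm (grad (\<lambda>x. 1 - \<phi> j x) x))"
    by (rule norm_grad_prod_le[OF fin(1) dm norm_\<phi>(2)])
  also have "\<dots> \<le> (\<Sum>j\<in>?S. norm (grad (\<phi> j) x))"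
    by (intro sum_mono norm_grad_one_minus_le differentiable_\<phi>)
  finally have "norm (grad (\<psi> i) x) \<le> (\<Sum>j\<in>?T. norm (grad (\<phi> j) x))"
    unfolding T using fin by simp
  also have "\<dots> = (\<Sum>j\<in>?T \<inter> near x. norm (grad (\<phi> j) x))"
    using fin grad_\<phi>_eq_0 by (intro sum.mono_neutral_right) auto
  also have "\<dots> \<le> (\<Sum>j\<in>?T \<inter> near x. 9 * K / d x)"
    by (intro sum_mono norm_grad_\<phi>) simp
  also have "\<dots> = real (card (?T \<inter> near x)) * (9 * K / d x)" by simp
  also have "\<dots> \<le> D ^ 6 * (9 * K / d x)"
  proof (rule mult_right_mono)
    have "card (?T \<inter> near x) \<le> card (near x)" by (rule card_mono[OF near_finite[OF x]]) simp
    then show "real (card (?T \<inter> near x)) \<le> D ^ 6" using card_near[OF x] by linarith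
    show "0 \<le> 9 * K / d x" using K d_pos[OF x] by simp
  qed
  finally show ?thesis .
qed

lemma sum_\<psi>_initial: "(\<Sum>i\<in>{i\<in>I. i < n}. \<psi> i x) = 1 - (\<Prod>i\<in>{i\<in>I. i < n}. 1 - \<phi> i x)"
proof (induction n)
  case (Suc n)
  show ?case
  proof (cases "n \<in> I")
    case True
    then have "{i\<in>I. i < Suc n} = insert n {i\<in>I. i < n}" by auto
    then show ?thesis using Suc by (simp add: \<psi>_def algebra_simps)
  next
    case False
    then have "{i\<in>I. i < Suc n} = {i\<in>I. i < n}" by (auto simp: less_Suc_eq)
    then show ?thesis using Suc by simp
  qed
qed simp

text \<open>Some bump \<open>\<phi> k\<close> equals 1 at x, so every later \<open>\<psi> i\<close>
  vanishes there and the telescoped product is zero after finitely many steps. The index set is left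
  free because one set is later used for all points of a small ball.\<close>

lemma sum_\<psi>:
  assumes x: "x \<in> U" and S: "finite S" "S \<subseteq> I" "\<And>i. i \<in> I \<Longrightarrow> \<psi> i x \<noteq> 0 \<Longrightarrow> i \<in> S"
  shows "(\<Sum>i\<in>S. \<psi> i x) = 1"
proof -
  obtain k where k: "k \<in> I" "dist x (c k) \<le> 3/20 * d (c k)" using cover[OF x] by blast
  then have \<phi>k: "\<phi> k x = 1" unfolding \<phi>_def using d_c_pos by (intro bump_eq_1) auto
  let ?T = "{i\<in>I. i < Suc k}"
  have T: "i \<in> ?T" if "i \<in> I" "\<psi> i x \<noteq> 0" for i
  proof (rule ccontr)
    assume "i \<notin> ?T"
    then have "k \<in> {j\<in>I. j < i}" using that k by auto
    moreover have "finite {j\<in>I. j < i}" by simp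
    ultimately have "(\<Prod>j\<in>{j\<in>I. j < i}. 1 - \<phi> j x) = 0" using \<phi>k by (auto intro!: prod_zero)
    then show False using that by (simp add: \<psi>_def)
  qed
  have "(\<Sum>i\<in>S. \<psi> i x) = (\<Sum>i\<in>S \<union> ?T. \<psi> i x)"
    using S by (intro sum.mono_neutral_left) auto
  also have "\<dots> = (\<Sum>i\<in>?T. \<psi> i x)"
    using S T by (intro sum.mono_neutral_right) auto
  also have "\<dots> = 1 - (\<Prod>i\<in>?T. 1 - \<phi> i x)" by (rule sum_\<psi>_initial)
  also have "(\<Prod>i\<in>?T. 1 - \<phi> i x) = 0" using \<phi>k k by (intro prod_zero) auto
  finally show ?thesis by simp
qed

section \<open>The bad functions\<close>

lemma smooth_b: "smooth (b i)"
proof -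
  have "smooth (\<lambda>x. (f x - m i) * \<psi> i x)"
    by (rule smooth_mult[OF smooth_diff[OF smooth_f smooth_const] smooth_\<psi>])
  then show ?thesis by (simp add: b_def[abs_def])
qed

lemma ball_subset_U: assumes "i \<in> I" shows "ball (c i) (r i) \<subseteq> U"
proof
  fix x assume "x \<in> ball (c i) (r i)"
  then show "x \<in> U" using d_le_dist[of x "c i"] d_c_pos[OF assms] by (force simp: r_def)
qed

lemma ball_near: "i \<in> I \<Longrightarrow> x \<in> ball (c i) (r i) \<Longrightarrow> i \<in> near x"
  using d_c_pos[of i] by (simp add: near_def r_def dist_commute)

lemma \<psi>_ne_0_ball: "i \<in> I \<Longrightarrow> \<psi> i x \<noteq> 0 \<Longrightarrow> x \<in> ball (c i) (r i)"
  using \<psi>_ne_0[of i x] d_c_pos[of i] by (simp add: r_def dist_commute)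

lemma supp_b: assumes "i \<in> I" shows "supp (b i) \<subseteq> ball (c i) (r i)"
proof -
  have "{x. b i x \<noteq> 0} \<subseteq> cball (c i) (9/40 * d (c i))"
    using \<psi>_ne_0[OF assms] by (force simp: b_def dist_commute)
  then have "supp (b i) \<subseteq> cball (c i) (9/40 * d (c i))"
    unfolding supp_def by (rule closure_minimal) simp
  then show ?thesis using d_c_pos[OF assms] by (force simp: r_def)
qed

text \<open>One finite index set serves a whole neighbourhood of z, so that sums can be
  differentiated term by term. The triangle inequalities give dist z (c i) < 11/38 * d (c i), and
  11/38 < 1/3.\<close>

lemma \<psi>_near:
  assumes "z \<in> U" "y \<in> ball z (d z / 20)" "i \<in> I" "\<psi> i y \<noteq> 0"
  shows "i \<in> near z"
proof -
  have "dist y (c i) < 9/40 * d (c i)" by (rule \<psi>_ne_0[OF assms(3,4)])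
  moreover have "dist z y < d z / 20" using assms(2) by simp
  moreover have "dist z (c i) \<le> dist z y + dist y (c i)" by (rule dist_triangle)
  moreover have "d z \<le> d (c i) + dist z (c i)" by (rule d_le)
  moreover have "0 < d (c i)" by (rule d_c_pos[OF assms(3)])
  ultimately have "dist z (c i) < d (c i) / 3" by linarith
  then show ?thesis using assms(3) by (simp add: near_def)
qed

text \<open>Enlarging the ball eightfold reaches the radius 2 * d (c i), at which the average is
  controlled. The factor \<open>D ^ 3\<close> is moved inside the power, which only increases the
  bound as p \<ge> 1, to match the form \<open>T powr p\<close> of the oscillation
  estimates.\<close>

lemma average_energy_ball:
  assumes "i \<in> I"
  shows "average M (ball (c i) (r i)) energy \<le> (D ^ 3 * \<alpha>) powr p"
proof -
  have D: "1 \<le> D ^ 3" using D_ge_1 by simp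
  have "average M (ball (c i) (r i)) energy \<le> D ^ 3 * average M (ball (c i) (2 * d (c i))) energy"
  proof (rule average_ball_subset_le[OF continuous_energy energy_nonneg _ r_pos[OF assms]])
    show "ball (c i) (r i) \<subseteq> ball (c i) (2 * d (c i))"
      using d_c_pos[OF assms] by (intro subset_ball) (simp add: r_def)
    show "measure M (ball (c i) (2 * d (c i))) \<le> D ^ 3 * measure M (ball (c i) (r i))"
      using r_pos[OF assms] by (intro measure_ball_compare) (auto simp: r_def)
  qed
  also have "\<dots> \<le> D ^ 3 * \<alpha> powr p"
    using D_ge_1 average_energy_le[OF c_in_U[OF assms]] by (intro mult_left_mono) auto
  also have "\<dots> \<le> (D ^ 3) powr p * \<alpha> powr p"
  proof (rule mult_right_mono)
    have "(D ^ 3) powr 1 \<le> (D ^ 3) powr p" using D p by (intro powr_mono) auto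
    then show "D ^ 3 \<le> (D ^ 3) powr p" using D_ge_1 by simp
  qed simp
  also have "\<dots> = (D ^ 3 * \<alpha>) powr p" using \<alpha> D_ge_1 by (simp add: powr_mult)
  finally show ?thesis .
qed

lemma D3_times_\<alpha>_pos: "0 < D ^ 3 * \<alpha>"
  using D_ge_1 \<alpha> by simp

lemma norm_grad_b:
  assumes i: "i \<in> I" and x: "x \<in> ball (c i) (r i)"
  shows "norm (grad (b i) x) \<le> (3 * D ^ 6 * K / r i) * norm (f x - m i) + norm (grad f x)"
proof -
  have xU: "x \<in> U" using ball_subset_U[OF i] x by blast
  have "d (c i) \<le> d x + dist (c i) x" by (rule d_le)
  \<comment> \<open>Since d (c i) = 4 * r i, points of the ball keep distance 3 * r i from the
    complement; this turns 9 K / d x into 3 K / r i.\<close>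
  then have dx: "3 * r i \<le> d x" using x by (simp add: r_def)
  have e: "b i = (\<lambda>x. (f x - m i) * \<psi> i x)" by (rule ext) (rule b_def)
  have df: "(\<lambda>x. f x - m i) differentiable (at x)"
    by (rule smooth_differentiable[OF smooth_diff[OF smooth_f smooth_const]])
  have "grad (\<lambda>x. f x + (- m i)) x = grad f x + grad (\<lambda>x. - m i) x"
    by (rule grad_add[OF smooth_differentiable[OF smooth_f]]) simp
  then have gf: "grad (\<lambda>x. f x - m i) x = grad f x" by simp
  have "norm (grad (b i) x) \<le> norm (f x - m i) * norm (grad (\<psi> i) x) + norm (grad f x) * norm (\<psi> i x)"
    using norm_grad_mult_le[OF df smooth_differentiable[OF smooth_\<psi>]] unfolding e gf .
  also have "\<dots> \<le> norm (f x - m i) * (D ^ 6 * (9 * K / d x)) + norm (grad f x) * 1"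
    by (intro add_mono mult_left_mono norm_grad_\<psi>[OF xU i] norm_\<psi>) auto
  finally have 1: "norm (grad (b i) x) \<le> norm (f x - m i) * (D ^ 6 * (9 * K / d x)) + norm (grad f x)"
    by simp
  have "D ^ 6 * (9 * K / d x) \<le> D ^ 6 * (9 * K / (3 * r i))"
  proof (intro mult_left_mono divide_left_mono dx)
    show "0 < d x * (3 * r i)" using r_pos[OF i] dx by (intro mult_pos_pos) auto
  qed (use K D_ge_1 in auto)
  also have "D ^ 6 * (9 * K / (3 * r i)) = 3 * D ^ 6 * K / r i" by simp
  finally have "norm (f x - m i) * (D ^ 6 * (9 * K / d x)) \<le> norm (f x - m i) * (3 * D ^ 6 * K / r i)"
    by (rule mult_left_mono) simp
  then show ?thesis using 1 by (simp only: mult.commute[of "norm (f x - m i)"])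
qed

text \<open>The gradient of \<open>\<psi> i\<close> costs 1 / r i, and the Poincare inequality on
  the same ball gives back r i, so the constant is free of scale. The other Leibniz term is
  controlled by the average energy.\<close>

lemma set_integral_grad_b:
  assumes i: "i \<in> I"
  shows "(LINT x:ball (c i) (r i)|M. norm (grad (b i) x) powr p)
    \<le> 2 powr p * ((3 * D ^ 6 * K * CP) powr p + 1) * (D ^ 3) powr p * \<alpha> powr p * measure M (ball (c i) (r i))"
proof -
  let ?B = "ball (c i) (r i)" and ?q = "3 * D ^ 6 * K / r i" and ?T = "D ^ 3 * \<alpha>"
  have r: "0 < r i" by (rule r_pos[OF i])
  have q: "0 \<le> ?q" using K D_ge_1 r by simp
  let ?v = "\<lambda>x. norm (f x - m i) powr p"
  have cv: "continuous_on UNIV ?v"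
    by (rule continuous_powr[OF continuous_on_diff[OF continuous_f continuous_on_const] p])
  have "average M ?B (\<lambda>x. norm (grad (b i) x) powr p)
      \<le> average M ?B (\<lambda>x. 2 powr p * ?q powr p * ?v x + 2 powr p * energy x)"
  proof (rule average_mono)
    show "continuous_on UNIV (\<lambda>x. norm (grad (b i) x) powr p)"
      by (rule continuous_powr[OF continuous_on_grad[OF smooth_b] p])
    show "continuous_on UNIV (\<lambda>x. 2 powr p * ?q powr p * ?v x + 2 powr p * energy x)"
      by (intro continuous_on_add continuous_on_mult continuous_on_const cv continuous_energy)
    fix x assume "x \<in> ?B"
    from norm_grad_b[OF i this]
    have "norm (grad (b i) x) powr p \<le> (?q * norm (f x - m i) + norm (grad f x)) powr p"
      using p by (intro powr_mono2) auto
    also have "\<dots> \<le> 2 powr p * ((?q * norm (f x - m i)) powr p + norm (grad f x) powr p)"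
      using p q by (intro powr_add_le mult_nonneg_nonneg) auto
    also have "\<dots> = 2 powr p * ?q powr p * ?v x + 2 powr p * energy x"
      using q by (simp only: powr_mult energy_def distrib_left mult.assoc)
    finally show "norm (grad (b i) x) powr p \<le> 2 powr p * ?q powr p * ?v x + 2 powr p * energy x" .
  qed
  also have "\<dots> = 2 powr p * ?q powr p * average M ?B ?v + 2 powr p * average M ?B energy"
  proof -
    have "(LINT x:?B|M. 2 powr p * ?q powr p * ?v x + 2 powr p * energy x) =
        (LINT x:?B|M. 2 powr p * ?q powr p * ?v x) + (LINT x:?B|M. 2 powr p * energy x)"
      by (intro set_integral_add set_integrable_ball continuous_on_mult continuous_on_const cv continuous_energy)
    then show ?thesis by (simp add: average_def add_divide_distrib)
  qed
  also have "\<dots> \<le> 2 powr p * ?q powr p * (CP * r i * ?T) powr p + 2 powr p * ?T powr p"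
  proof (intro add_mono mult_left_mono average_energy_ball[OF i])
    show "average M ?B ?v \<le> (CP * r i * ?T) powr p"
      using average_oscillation_powr_le[OF r less_imp_le[OF D3_times_\<alpha>_pos] average_energy_ball[OF i]] unfolding m_def .
  qed auto
  also have "\<dots> = 2 powr p * ((?q * (CP * r i)) powr p + 1) * ?T powr p"
    using q CP r D3_times_\<alpha>_pos by (simp only: powr_mult) (simp add: algebra_simps)
  also have "?q * (CP * r i) = 3 * D ^ 6 * K * CP" using r by simp
  also have "?T powr p = (D ^ 3) powr p * \<alpha> powr p"
    by (rule powr_mult)
  finally have "measure M ?B * average M ?B (\<lambda>x. norm (grad (b i) x) powr p) \<le>
     measure M ?B * (2 powr p * ((3 * D ^ 6 * K * CP) powr p + 1) * ((D ^ 3) powr p * \<alpha> powr p))"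
    by (rule mult_left_mono) simp
  then show ?thesis
    using measure_times_average[OF r, of "c i" "\<lambda>x. norm (grad (b i) x) powr p"] by (simp add: mult_ac)
qed

lemma average_b_powr_le:
  assumes i: "i \<in> I" and q: "p \<le> q" "poincare M p q C"
  shows "average M (ball (c i) (r i)) (\<lambda>x. norm (b i x) powr q) powr (1 / q) \<le> \<bar>C\<bar> * D ^ 3 * \<alpha> * r i"
proof -
  have q1: "1 \<le> q" using p q by simp
  \<comment> \<open>Formally a Poincare constant is any real number; its absolute value is one as
    well.\<close>
  have C: "poincare M p q \<bar>C\<bar>"
    using q(2) unfolding poincare_def
    by (meson abs_ge_self less_imp_le mult_right_mono order_trans powr_ge_zero)
  have "average M (ball (c i) (r i)) (\<lambda>x. norm (b i x) powr q) \<le>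
      average M (ball (c i) (r i)) (\<lambda>x. norm (f x - m i) powr q)"
  proof (rule average_mono)
    show "continuous_on UNIV (\<lambda>x. norm (b i x) powr q)"
      by (rule continuous_powr[OF smooth_continuous[OF smooth_b] q1])
    show "continuous_on UNIV (\<lambda>x. norm (f x - m i) powr q)"
      by (rule continuous_powr[OF continuous_on_diff[OF continuous_f continuous_on_const] q1])
    fix x
    have "norm (b i x) \<le> norm (f x - m i)"
      unfolding b_def norm_mult using norm_\<psi>[of i x] by (simp add: mult_left_le)
    then show "norm (b i x) powr q \<le> norm (f x - m i) powr q" using q1 by (intro powr_mono2) auto
  qed
  then have "average M (ball (c i) (r i)) (\<lambda>x. norm (b i x) powr q) powr (1 / q) \<le>
      average M (ball (c i) (r i)) (\<lambda>x. norm (f x - m i) powr q) powr (1 / q)"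
    using q1 by (intro powr_mono2 average_nonneg) auto
  also have "\<dots> \<le> \<bar>C\<bar> * r i * (D ^ 3 * \<alpha>)"
    unfolding m_def
    by (rule poincare_ball[OF C abs_ge_zero r_pos[OF i] less_imp_le[OF D3_times_\<alpha>_pos] average_energy_ball[OF i]])
  finally show ?thesis by (simp add: mult_ac)
qed

lemma b_eq_0: "i \<in> I \<Longrightarrow> i \<notin> near x \<Longrightarrow> b i x = 0"
  using \<psi>_ne_0_ball ball_near by (fastforce simp: b_def)

lemma b_eq_0_outside: "i \<in> I \<Longrightarrow> x \<notin> U \<Longrightarrow> b i x = 0"
  using \<psi>_ne_0_ball ball_subset_U by (fastforce simp: b_def)

section \<open>The good function\<close>

lemma has_sum_b: "((\<lambda>i. b i x) has_sum (f x - g x)) I"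
proof (cases "x \<in> U")
  case True
  show ?thesis
    by (rule has_sum_finite_neutralI[OF near_finite[OF True] near_subset])
      (use b_eq_0 True in \<open>auto simp: g_def\<close>)
next
  case False
  show ?thesis
    by (rule has_sum_finite_neutralI[of "{}"]) (use b_eq_0_outside False in \<open>auto simp: g_def\<close>)
qed

text \<open>As the partition functions sum to 1 near z, \<open>f\<close> cancels and only the
  averages \<open>m i\<close> remain. For the same reason a constant \<open>m0\<close> can be split
  off at will; its choice will make the coefficients small.\<close>

lemma g_eq:
  assumes z: "z \<in> U" and y: "y \<in> ball z (d z / 20)"
  shows "g y = m0 + (\<Sum>i\<in>near z. (m i - m0) * \<psi> i y)"
proof -
  have yU: "y \<in> U"
    using d_le_dist[of y z] y d_pos[OF z] by force
  have s: "(\<Sum>i\<in>near z. \<psi> i y) = 1"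
    by (rule sum_\<psi>[OF yU near_finite[OF z] near_subset \<psi>_near[OF z y]])
  have "(\<Sum>i\<in>near y. b i y) = (\<Sum>i\<in>near y \<union> near z. b i y)"
    using near_finite[OF z] near_finite[OF yU] near_subset b_eq_0 by (intro sum.mono_neutral_left) auto
  also have "\<dots> = (\<Sum>i\<in>near z. b i y)"
  proof (rule sum.mono_neutral_right)
    show "finite (near y \<union> near z)" using near_finite[OF z] near_finite[OF yU] by simp
    show "\<forall>i\<in>near y \<union> near z - near z. b i y = 0"
      using \<psi>_near[OF z y] near_subset unfolding b_def by fastforce
  qed simp
  also have "\<dots> = f y * (\<Sum>i\<in>near z. \<psi> i y) - (\<Sum>i\<in>near z. m i * \<psi> i y)"
    by (simp add: b_def left_diff_distrib sum_subtractf sum_distrib_left)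
  finally have "g y = (\<Sum>i\<in>near z. m i * \<psi> i y)" using yU s by (simp add: g_def)
  also have "\<dots> = m0 * (\<Sum>i\<in>near z. \<psi> i y) + (\<Sum>i\<in>near z. (m i - m0) * \<psi> i y)"
    by (simp add: left_diff_distrib sum_subtractf sum_distrib_left)
  finally show ?thesis using s by simp
qed

text \<open>The oscillation over the large ball bounds that over the small one at the cost of
  \<open>D ^ 4\<close>, since 1/3 + 8/3 \<le> 16/4 in units of d (c i). On the large ball the energy
  bound has the constant \<alpha> itself, as this ball meets the complement of
  \<open>U\<close>.\<close>

lemma norm_m_diff:
  assumes z: "z \<in> U" and i: "i \<in> near z"
  shows "norm (m i - average M (ball z (2 * d z)) f) \<le> 4 * D ^ 4 * CP * d z * \<alpha>"
proof -
  note n = near_d[OF i]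
  let ?m = "average M (ball z (2 * d z)) f"
  have c: "continuous_on UNIV (\<lambda>y. f y - ?m)" by (rule continuous_on_diff[OF continuous_f continuous_on_const])
  have dz: "0 < 2 * d z" using n by simp
  have "norm (m i - ?m) = norm (average M (ball (c i) (r i)) (\<lambda>y. f y - ?m))"
    unfolding m_def by (simp only: average_diff_const[OF continuous_f r_pos[OF n(1)]])
  also have "\<dots> \<le> average M (ball (c i) (r i)) (\<lambda>y. norm (f y - ?m))" by (rule norm_average_le[OF c])
  also have "\<dots> \<le> D ^ 4 * average M (ball z (2 * d z)) (\<lambda>y. norm (f y - ?m))"
  proof (rule average_ball_subset_le[OF continuous_on_norm[OF c] norm_ge_zero _ r_pos[OF n(1)]])
    show "ball (c i) (r i) \<subseteq> ball z (2 * d z)"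
    proof
      fix y assume "y \<in> ball (c i) (r i)"
      then have "dist (c i) y < d (c i) / 4" by (simp add: r_def)
      moreover have "dist z y \<le> dist z (c i) + dist (c i) y" by (rule dist_triangle)
      ultimately have "dist z y < 2 * d z" using n by linarith
      then show "y \<in> ball z (2 * d z)" by simp
    qed
    show "measure M (ball z (2 * d z)) \<le> D ^ 4 * measure M (ball (c i) (r i))"
      using n r_pos[OF n(1)] by (intro measure_ball_compare) (auto simp: r_def)
  qed
  also have "\<dots> \<le> D ^ 4 * (2 * (CP * (2 * d z) * \<alpha>))"
    using D_ge_1 by (intro mult_left_mono average_oscillation_le[OF dz \<alpha> average_energy_le[OF z]]) auto
  finally show ?thesis by (simp add: mult_ac)
qed

text \<open>The factor d z in the differences of averages cancels 1 / d z from the partition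
  functions. The constant 36 is 4 * 9, and the exponent 16 = 6 + 4 + 6 collects overlap, averages
  and partition functions.\<close>

lemma g_differentiable:
  assumes z: "z \<in> U"
  shows "g differentiable (at z)" "norm (grad g z) \<le> 36 * K * CP * D ^ 16 * \<alpha>"
proof -
  define m0 where "m0 = average M (ball z (2 * d z)) f"
  let ?h = "\<lambda>y. m0 + (\<Sum>i\<in>near z. (m i - m0) * \<psi> i y)"
  have op: "open (ball z (d z / 20))" "z \<in> ball z (d z / 20)" using d_pos[OF z] by auto
  have dc: "(\<lambda>y. (m i - m0) * \<psi> i y) differentiable (at z)" for i
    by (rule smooth_differentiable[OF smooth_mult[OF smooth_const smooth_\<psi>]])
  have ds: "(\<lambda>y. \<Sum>i\<in>near z. (m i - m0) * \<psi> i y) differentiable (at z)"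
    by (rule differentiable_sum_fun[OF dc])
  have h: "?h differentiable (at z)" by (rule differentiable_add[OF differentiable_const ds])
  have gc: "grad g z = grad ?h z" "g differentiable (at z) \<longleftrightarrow> ?h differentiable (at z)"
    by (rule grad_cong_open[OF op], rule g_eq[OF z], assumption)+
  show "g differentiable (at z)" using gc(2) h by simp
  have "grad g z = grad (\<lambda>y. m0) z + grad (\<lambda>y. \<Sum>i\<in>near z. (m i - m0) * \<psi> i y) z"
    unfolding gc(1) by (rule grad_add[OF differentiable_const ds])
  also have "\<dots> = (\<Sum>i\<in>near z. grad (\<lambda>y. (m i - m0) * \<psi> i y) z)"
    by (simp add: grad_sum[OF dc])
  finally have "norm (grad g z) \<le> (\<Sum>i\<in>near z. norm (grad (\<lambda>y. (m i - m0) * \<psi> i y) z))"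
    by (simp only: norm_sum)
  also have "\<dots> \<le> (\<Sum>i\<in>near z. (4 * D ^ 4 * CP * d z * \<alpha>) * (D ^ 6 * (9 * K / d z)))"
  proof (rule sum_mono)
    fix i assume i: "i \<in> near z"
    have "norm (grad (\<lambda>y. (m i - m0) * \<psi> i y) z) \<le>
        norm (m i - m0) * norm (grad (\<psi> i) z) + norm (grad (\<lambda>y. m i - m0) z) * norm (\<psi> i z)"
      by (rule norm_grad_mult_le[OF differentiable_const smooth_differentiable[OF smooth_\<psi>]])
    also have "\<dots> = norm (m i - m0) * norm (grad (\<psi> i) z)" by simp
    also have "\<dots> \<le> (4 * D ^ 4 * CP * d z * \<alpha>) * (D ^ 6 * (9 * K / d z))"
    proof (rule mult_mono)
      show "norm (m i - m0) \<le> 4 * D ^ 4 * CP * d z * \<alpha>" unfolding m0_def by (rule norm_m_diff[OF z i])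
      show "norm (grad (\<psi> i) z) \<le> D ^ 6 * (9 * K / d z)" by (rule norm_grad_\<psi>[OF z near_d(1)[OF i]])
      show "0 \<le> 4 * D ^ 4 * CP * d z * \<alpha>" using D_ge_1 CP d_pos[OF z] \<alpha> by simp
    qed simp
    finally show "norm (grad (\<lambda>y. (m i - m0) * \<psi> i y) z) \<le> (4 * D ^ 4 * CP * d z * \<alpha>) * (D ^ 6 * (9 * K / d z))" .
  qed
  also have "\<dots> = real (card (near z)) * ((4 * D ^ 4 * CP * d z * \<alpha>) * (D ^ 6 * (9 * K / d z)))" by simp
  also have "\<dots> \<le> D ^ 6 * ((4 * D ^ 4 * CP * d z * \<alpha>) * (D ^ 6 * (9 * K / d z)))"
    using D_ge_1 CP d_pos[OF z] \<alpha> K by (intro mult_right_mono card_near[OF z]) simp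
  also have "\<dots> = 36 * K * CP * (D ^ 6 * D ^ 4 * D ^ 6) * \<alpha>" using d_pos[OF z] by simp
  also have "D ^ 6 * D ^ 4 * D ^ 6 = D ^ 16" by (simp add: power_add[symmetric])
  finally show "norm (grad g z) \<le> 36 * K * CP * D ^ 16 * \<alpha>" .
qed

text \<open>On a ball of the covering f varies by at most \<open>A\<close> times the diameter, which
  is comparable to d y, and at most \<open>D ^ 6\<close> bad functions are active at y. As
  \<open>A\<close> depends on f, the bound is used only for qualitative conclusions.\<close>

lemma norm_g_minus_f:
  assumes A: "0 \<le> A" "\<And>x. norm (grad f x) \<le> A"
  shows "norm (g y - f y) \<le> D ^ 6 * A * d y"
proof (cases "y \<in> U")
  case False
  then show ?thesis by (simp add: g_def d_zero)
next
  case y: True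
  have lip: "norm (f u - f v) \<le> A * norm (u - v)" for u v
    by (rule grad_bound_lipschitz[OF convex_UNIV smooth_differentiable[OF smooth_f] A(2)]) auto
  have "norm (g y - f y) = norm (\<Sum>i\<in>near y. b i y)" using y by (simp add: g_def)
  also have "\<dots> \<le> (\<Sum>i\<in>near y. norm (b i y))" by (rule norm_sum)
  also have "\<dots> \<le> (\<Sum>i\<in>near y. A * d y)"
  proof (rule sum_mono)
    fix i assume i: "i \<in> near y"
    note n = near_d[OF i]
    show "norm (b i y) \<le> A * d y"
    proof (cases "\<psi> i y = 0")
      case True
      then show ?thesis using A n by (simp add: b_def)
    next
      case False
      then have yB: "dist (c i) y < r i" using \<psi>_ne_0_ball[OF n(1)] by simp
      have cf: "continuous_on UNIV (\<lambda>x. f x - f y)"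
        by (rule continuous_on_diff[OF continuous_f continuous_on_const])
      have "norm (m i - f y) = norm (average M (ball (c i) (r i)) (\<lambda>x. f x - f y))"
        unfolding m_def by (simp only: average_diff_const[OF continuous_f r_pos[OF n(1)]])
      also have "\<dots> \<le> average M (ball (c i) (r i)) (\<lambda>x. norm (f x - f y))" by (rule norm_average_le[OF cf])
      also have "\<dots> \<le> A * (2 * r i)"
      proof (rule average_const_le[OF continuous_on_norm[OF cf] r_pos[OF n(1)]])
        fix x assume "x \<in> ball (c i) (r i)"
        then have "dist x y \<le> 2 * r i" using yB dist_triangle[of x y "c i"] by (simp add: dist_commute)
        then have "A * norm (x - y) \<le> A * (2 * r i)" using A by (intro mult_left_mono) (auto simp: dist_norm)
        then show "norm (f x - f y) \<le> A * (2 * r i)" using lip[of x y] by linarith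
      qed
      also have "\<dots> \<le> A * d y" using n A d_pos[OF y] by (intro mult_left_mono) (auto simp: r_def)
      finally have "norm (f y - m i) \<le> A * d y" by (simp add: norm_minus_commute)
      moreover have "norm (b i y) \<le> norm (f y - m i)"
        unfolding b_def norm_mult using norm_\<psi>[of i y] by (simp add: mult_left_le)
      ultimately show ?thesis by linarith
    qed
  qed
  also have "\<dots> = real (card (near y)) * (A * d y)" by simp
  also have "\<dots> \<le> D ^ 6 * (A * d y)"
    using A d_pos[OF y] by (intro mult_right_mono card_near[OF y]) simp
  finally show ?thesis by (simp add: mult_ac)
qed

text \<open>A segment inside \<open>U\<close> is handled by the gradient bound there. Any other
  segment contains a point outside \<open>U\<close>, where g agrees with f, and is split at that
  point; the lengths add up.\<close>

lemma g_lipschitz: "\<exists>L. L-lipschitz_on UNIV g"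
proof -
  obtain A where A: "0 \<le> A" "\<And>x. norm (grad f x) \<le> A" using schwartz_grad_bounded[OF f] by blast
  define L1 where "L1 = A + D ^ 6 * A"
  define L2 where "L2 = 36 * K * CP * D ^ 16 * \<alpha>"
  have L: "0 \<le> L1" "0 \<le> L2" using A K CP D_ge_1 \<alpha> by (auto simp: L1_def L2_def)
  have 1: "norm (g x - g y) \<le> L1 * norm (x - y)" if x: "x \<notin> U" for x y
  proof -
    have "norm (g x - g y) = norm ((f x - f y) + (f y - g y))" using x by (simp add: g_def)
    also have "\<dots> \<le> norm (f x - f y) + norm (f y - g y)" by (rule norm_triangle_ineq)
    also have "norm (f x - f y) \<le> A * norm (x - y)"
      by (rule grad_bound_lipschitz[OF convex_UNIV smooth_differentiable[OF smooth_f] A(2)]) auto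
    also have "norm (f y - g y) \<le> D ^ 6 * A * d y"
      using norm_g_minus_f[OF A] by (simp add: norm_minus_commute)
    also have "\<dots> \<le> D ^ 6 * A * norm (x - y)"
      using d_le_dist[OF x, of y] A D_ge_1 by (intro mult_left_mono) (auto simp: dist_norm norm_minus_commute)
    finally show ?thesis by (simp add: L1_def distrib_right)
  qed
  have 2: "norm (g x - g y) \<le> (L1 + L2) * norm (x - y)" for x y
  proof (cases "closed_segment x y \<subseteq> U")
    case True
    have "norm (g x - g y) \<le> L2 * norm (x - y)"
      unfolding L2_def
      by (rule grad_bound_lipschitz[OF convex_closed_segment[of x y]]) (use True g_differentiable in auto)
    then show ?thesis using mult_nonneg_nonneg[OF L(1) norm_ge_zero[of "x - y"]] by (simp add: distrib_right)
  next
    case False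
    then obtain u where u: "u \<in> closed_segment x y" "u \<notin> U" by blast
    have "norm (g x - g y) \<le> norm (g x - g u) + norm (g u - g y)"
      using norm_triangle_ineq[of "g x - g u" "g u - g y"] by simp
    also have "norm (g x - g u) \<le> L1 * norm (x - u)"
      using 1[OF u(2), of x] by (simp add: norm_minus_commute)
    also have "norm (g u - g y) \<le> L1 * norm (u - y)" by (rule 1[OF u(2)])
    also have "L1 * norm (x - u) + L1 * norm (u - y) = L1 * norm (x - y)"
      using u(1) unfolding between_mem_segment[symmetric] between
      by (simp add: dist_norm distrib_left)
    finally show ?thesis using mult_nonneg_nonneg[OF L(2) norm_ge_zero[of "x - y"]] by (simp add: distrib_right)
  qed
  have "(L1 + L2)-lipschitz_on UNIV g"
    by (rule lipschitz_onI) (use 2 L in \<open>auto simp: dist_norm\<close>)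
  then show ?thesis by blast
qed

lemma g_differentiable_outside:
  assumes x: "x \<notin> U"
    and small: "\<And>\<epsilon>. 0 < \<epsilon> \<Longrightarrow> \<exists>\<delta>>0. \<forall>y. dist y x < \<delta> \<longrightarrow> d y \<le> \<epsilon> * dist y x"
  shows "g differentiable (at x)" "norm (grad g x) \<le> \<alpha>"
proof -
  obtain A where A: "0 \<le> A" "\<And>x. norm (grad f x) \<le> A" using schwartz_grad_bounded[OF f] by blast
  have L: "0 \<le> D ^ 6 * A" using A D_ge_1 by simp
  define e where "e y = g y - f y" for y
  have "(e has_derivative (\<lambda>v. 0)) (at x)"
    unfolding has_derivative_at_alt
  proof (intro conjI allI impI)
    fix \<epsilon> :: real assume \<epsilon>: "0 < \<epsilon>"
    \<comment> \<open>Adding 1 keeps the denominator positive when \<open>A\<close> is 0.\<close>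
    define \<eta> where "\<eta> = \<epsilon> / (D ^ 6 * A + 1)"
    have \<eta>: "0 < \<eta>" using \<epsilon> L by (simp add: \<eta>_def)
    obtain \<delta> where \<delta>: "0 < \<delta>" "\<And>y. dist y x < \<delta> \<Longrightarrow> d y \<le> \<eta> * dist y x" using small[OF \<eta>] by blast
    have "norm (e y - e x - 0) \<le> \<epsilon> * norm (y - x)" if "norm (y - x) < \<delta>" for y
    proof -
      have "norm (e y - e x - 0) \<le> D ^ 6 * A * d y"
        using norm_g_minus_f[OF A] x by (simp add: e_def g_def)
      also have "\<dots> \<le> D ^ 6 * A * (\<eta> * norm (y - x))"
        using \<delta>(2)[of y] that by (intro mult_left_mono L) (simp add: dist_norm)
      also have "\<dots> \<le> (D ^ 6 * A + 1) * (\<eta> * norm (y - x))"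
        using \<eta> by (intro mult_right_mono) auto
      also have "\<dots> = \<epsilon> * norm (y - x)" using L by (simp add: \<eta>_def)
      finally show ?thesis .
    qed
    then show "\<exists>\<delta>>0. \<forall>y. norm (y - x) < \<delta> \<longrightarrow> norm (e y - e x - 0) \<le> \<epsilon> * norm (y - x)" using \<delta>(1) by blast
  qed simp
  then have e: "e differentiable (at x)" "grad e x = 0"
    using has_derivative_zero_grad unfolding differentiable_def by blast+
  have g: "g = (\<lambda>y. f y + e y)" by (simp add: e_def)
  have df: "f differentiable (at x)" by (rule smooth_differentiable[OF smooth_f])
  show "g differentiable (at x)" unfolding g by (rule differentiable_add[OF df e(1)])
  have "grad g x = grad f x" unfolding g by (simp add: grad_add[OF df e(1)] e(2))
  then show "norm (grad g x) \<le> \<alpha>" using norm_grad_f_le[OF x] by simp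
qed

lemma AE_g:
  "AE x in M. g differentiable (at x) \<and> norm (grad g x) \<le> (36 * K * CP * D ^ 16 + 1) * \<alpha>"
  using AE_infdist_small[OF open_U emeasure_U_finite]
proof eventually_elim
  case (elim x)
  have C: "0 \<le> 36 * K * CP * D ^ 16 * \<alpha>" using K CP D_ge_1 \<alpha> by simp
  show ?case
  proof (cases "x \<in> U")
    case True
    then show ?thesis using g_differentiable[OF True] \<alpha> by (simp add: distrib_right)
  next
    case False
    have "\<exists>\<delta>>0. \<forall>y. dist y x < \<delta> \<longrightarrow> d y \<le> \<epsilon> * dist y x" if "0 < \<epsilon>" for \<epsilon>
      using elim False that unfolding d_def by blast
    note 1 = g_differentiable_outside[OF False this]
    have "norm (grad g x) \<le> 36 * K * CP * D ^ 16 * \<alpha> + \<alpha>" using 1(2) C by linarith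
    then show ?thesis using 1(1) by (simp add: distrib_right)
  qed
qed

text \<open>Shrinking each ball to the disjoint one of radius d (c i) / 20 divides the radius by 5
  and costs \<open>D ^ 3\<close>. The shrunken balls lie in \<open>U\<close>, whose mass is bounded
  by the weak type estimate with another \<open>D ^ 3\<close>.\<close>

lemma infsum_emeasure_balls:
  "(\<Sum>\<^sub>\<infinity>i\<in>I. emeasure M (ball (c i) (r i))) \<le> ennreal (D ^ 6 * \<alpha> powr (- p) * (LINT x|M. energy x))"
proof (rule infsum_le_finite_sums)
  fix S assume S: "finite S" "S \<subseteq> I"
  have J: "0 \<le> (LINT x|M. energy x)" by (simp add: energy_nonneg)
  have "(\<Sum>i\<in>S. emeasure M (ball (c i) (r i))) \<le> (\<Sum>i\<in>S. ennreal (D ^ 3) * emeasure M (ball (c i) (d (c i) / 20)))"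
  proof (rule sum_mono)
    fix i assume "i \<in> S"
    then have "0 < d (c i)" using S d_c_pos by blast
    then have "measure M (ball (c i) (r i)) \<le> D ^ 3 * measure M (ball (c i) (d (c i) / 20))"
      by (intro measure_ball_compare) (auto simp: r_def)
    then show "emeasure M (ball (c i) (r i)) \<le> ennreal (D ^ 3) * emeasure M (ball (c i) (d (c i) / 20))"
      unfolding emeasure_ball using D_ge_1 by (simp add: ennreal_mult[symmetric] ennreal_leI)
  qed
  also have "\<dots> = ennreal (D ^ 3) * (\<Sum>i\<in>S. emeasure M (ball (c i) (d (c i) / 20)))"
    by (simp add: sum_distrib_left)
  also have "(\<Sum>i\<in>S. emeasure M (ball (c i) (d (c i) / 20))) = emeasure M (\<Union>i\<in>S. ball (c i) (d (c i) / 20))"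
  proof (rule sum_emeasure[OF _ _ S(1)])
    show "disjoint_family_on (\<lambda>i. ball (c i) (d (c i) / 20)) S"
      unfolding disjoint_family_on_def using S(2) disjoint by blast
  qed auto
  also have "\<dots> \<le> emeasure M U"
  proof (rule emeasure_mono)
    show "(\<Union>i\<in>S. ball (c i) (d (c i) / 20)) \<subseteq> U"
    proof
      fix x assume "x \<in> (\<Union>i\<in>S. ball (c i) (d (c i) / 20))"
      then obtain i where "i \<in> S" "x \<in> ball (c i) (d (c i) / 20)" by blast
      moreover from this have "x \<in> ball (c i) (r i)"
        using S(2) d_c_pos[of i] by (auto simp: r_def)
      ultimately show "x \<in> U" using ball_subset_U[of i] S(2) by blast
    qed
  qed (simp add: open_U)
  also have "\<dots> \<le> ennreal (D ^ 3 * \<alpha> powr (- p) * (LINT x|M. energy x))" by (rule emeasure_U_le)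
  finally have "(\<Sum>i\<in>S. emeasure M (ball (c i) (r i))) \<le>
      ennreal (D ^ 3) * ennreal (D ^ 3 * \<alpha> powr (- p) * (LINT x|M. energy x))"
    by (simp add: mult_left_mono)
  also have "\<dots> = ennreal (D ^ 3 * (D ^ 3 * \<alpha> powr (- p) * (LINT x|M. energy x)))"
    using D_ge_1 J by (intro ennreal_mult[symmetric]) auto
  also have "D ^ 3 * (D ^ 3 * \<alpha> powr (- p) * (LINT x|M. energy x)) = D ^ 6 * \<alpha> powr (- p) * (LINT x|M. energy x)"
    by (simp add: power_add[symmetric] mult.assoc[symmetric])
  finally show "(\<Sum>i\<in>S. emeasure M (ball (c i) (r i))) \<le> ennreal (D ^ 6 * \<alpha> powr (- p) * (LINT x|M. energy x))" .
qed (simp add: nonneg_summable_on_complete)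

lemma infsum_indicator_balls:
  "(\<Sum>\<^sub>\<infinity>i\<in>I. indicator (ball (c i) (r i)) x :: ennreal) \<le> of_nat (nat \<lceil>D ^ 6\<rceil>)"
proof (rule infsum_le_finite_sums)
  fix S assume S: "finite S" "S \<subseteq> I"
  let ?T = "{i\<in>S. x \<in> ball (c i) (r i)}"
  have "(\<Sum>i\<in>S. indicator (ball (c i) (r i)) x :: ennreal) = (\<Sum>i\<in>?T. 1)"
    using S(1) by (intro sum.mono_neutral_cong_right) (auto simp: indicator_def)
  also have "\<dots> = of_nat (card ?T)" by simp
  also have "card ?T \<le> nat \<lceil>D ^ 6\<rceil>"
  proof (cases "x \<in> U")
    case True
    have "?T \<subseteq> near x" using S(2) ball_near by blast
    then have "card ?T \<le> card (near x)" by (rule card_mono[OF near_finite[OF True]])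
    then have "real (card ?T) \<le> D ^ 6" using card_near[OF True] by linarith
    then show ?thesis by linarith
  next
    case False
    then have "?T = {}" using S(2) ball_subset_U by blast
    then show ?thesis by (simp only: card.empty)
  qed
  finally show "(\<Sum>i\<in>S. indicator (ball (c i) (r i)) x :: ennreal) \<le> of_nat (nat \<lceil>D ^ 6\<rceil>)" by simp
qed (simp add: nonneg_summable_on_complete)

end

text \<open>The order of the quantifiers expresses what the constants depend on: \<open>N\<close> is
  fixed before the Poincare constant, \<open>C\<close> after it but before the weight, and
  \<open>K\<close>, a function of q, after the weight but before f and \<alpha>.\<close>

theorem proposition9p1:
  fixes p C0 :: real
  assumes "1 \<le> p"
  shows "\<exists>N::nat. \<forall>CP::real. \<exists>C::real. \<forall>w :: real ^ 'n::finite \<Rightarrow> real.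
    locally_integrable lborel w \<and> (AE x in lborel. 0 < w x) \<and>
    doubling (weighted w) C0 \<and> poincare (weighted w) p p CP \<longrightarrow>
    (\<exists>K :: real \<Rightarrow> real. \<forall>f \<alpha>.
      schwartz f \<and> integrable (weighted w) (\<lambda>x. norm (grad f x) powr p) \<and> 0 < \<alpha> \<longrightarrow>
      (\<exists>(I :: nat set) (c :: nat \<Rightarrow> real ^ 'n) (r :: nat \<Rightarrow> real)
         (b :: nat \<Rightarrow> real ^ 'n \<Rightarrow> complex) (g :: real ^ 'n \<Rightarrow> complex).
        (\<forall>i\<in>I. 0 < r i \<and> smooth (b i)) \<and>
        locally_integrable (weighted w) g \<and>
        (\<forall>x. ((\<lambda>i. b i x) has_sum (f x - g x)) I) \<and>
        gradient_bounded (weighted w) g (C * \<alpha>) \<and>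
        (\<forall>i\<in>I. supp (b i) \<subseteq> ball (c i) (r i) \<and>
          (LINT x:ball (c i) (r i)|weighted w. norm (grad (b i) x) powr p)
            \<le> C * \<alpha> powr p * measure (weighted w) (ball (c i) (r i))) \<and>
        (\<Sum>\<^sub>\<infinity>i\<in>I. emeasure (weighted w) (ball (c i) (r i)))
          \<le> ennreal (C * \<alpha> powr (- p) * (LINT x|weighted w. norm (grad f x) powr p)) \<and>
        (\<forall>x. (\<Sum>\<^sub>\<infinity>i\<in>I. indicator (ball (c i) (r i)) x :: ennreal) \<le> of_nat N) \<and>
        (\<forall>q. p \<le> q \<and> (\<exists>CQ. poincare (weighted w) p q CQ) \<longrightarrow>
          (\<forall>i\<in>I. (average (weighted w) (ball (c i) (r i)) (\<lambda>x. norm (b i x) powr q)) powr (1 / q)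
             \<le> K q * \<alpha> * r i))))"
    (is "\<exists>N. \<forall>CP. \<exists>C. \<forall>w. ?hyp w CP \<longrightarrow> (\<exists>K. \<forall>f \<alpha>. ?dat w f \<alpha> \<longrightarrow> ?concl N C w K f \<alpha>)")
proof -
  let ?N = "nat \<lceil>C0 ^ 6\<rceil>"
  obtain \<kappa> where \<kappa>: "0 \<le> \<kappa>"
    "\<And>c \<rho> x. 0 < \<rho> \<Longrightarrow> norm (grad (bump c \<rho> :: real ^ 'n \<Rightarrow> complex) x) \<le> \<kappa> / \<rho>"
    using grad_bump_bound by blast
  show ?thesis
  proof (rule exI[of _ ?N], rule allI)
    fix CP0 :: real
    \<comment> \<open>Enlarged so as to be positive, whatever the sign of the given
      constant.\<close>
    define CP where "CP = \<bar>CP0\<bar> + 1"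
    define C1 where "C1 = 36 * \<kappa> * CP * C0 ^ 16 + 1"
    define C2 where "C2 = 2 powr p * ((3 * C0 ^ 6 * \<kappa> * CP) powr p + 1) * (C0 ^ 3) powr p"
    \<comment> \<open>\<open>C\<close> is fixed before a weight is given, so the sign of
      \<open>C0\<close> is not known yet; the absolute values make \<open>C\<close> dominate all
      three constants regardless.\<close>
    define C where "C = \<bar>C1\<bar> + \<bar>C2\<bar> + \<bar>C0 ^ 6\<bar>"
    have C: "C1 \<le> C" "C2 \<le> C" "C0 ^ 6 \<le> C"
      using abs_ge_self[of C1] abs_ge_self[of C2] abs_ge_self[of "C0 ^ 6"] abs_ge_zero[of C1]
        abs_ge_zero[of C2] abs_ge_zero[of "C0 ^ 6"] unfolding C_def by linarith+
    show "\<exists>C. \<forall>w. ?hyp w CP0 \<longrightarrow> (\<exists>K. \<forall>f \<alpha>. ?dat w f \<alpha> \<longrightarrow> ?concl ?N C w K f \<alpha>)"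
    proof (rule exI[of _ C], rule allI, rule impI)
      fix w :: "real ^ 'n \<Rightarrow> real"
      assume w: "?hyp w CP0"
      then have wm: "w \<in> borel_measurable lborel" "AE x in lborel. 0 < w x"
        by (auto simp: locally_integrable_def)
      have dm: "doubling_measure (weighted w) C0"
        using doubling_measure_weighted[OF wm] w by blast
      have poin: "poincare (weighted w) p p CP"
        unfolding poincare_def
      proof (intro allI impI)
        fix f :: "real ^ 'n \<Rightarrow> complex" and x :: "real ^ 'n" and r :: real
        assume r: "0 < r" "locally_lipschitz f"
        let ?R = "average (weighted w) (ball x r) (\<lambda>y. norm (grad f y) powr p) powr (1 / p)"
        have "average (weighted w) (ball x r) (\<lambda>y. norm (f y - average (weighted w) (ball x r) f) powr p) powr (1 / p)
            \<le> CP0 * r * ?R"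
          using w r unfolding poincare_def by blast
        also have "\<dots> \<le> CP * r * ?R"
          using r by (intro mult_right_mono) (auto simp: CP_def)
        finally show "average (weighted w) (ball x r) (\<lambda>y. norm (f y - average (weighted w) (ball x r) f) powr p) powr (1 / p)
            \<le> CP * r * ?R" .
      qed
      \<comment> \<open>One Poincare constant is chosen for each q, before f and \<alpha> are given;
        this makes the last estimate uniform in f, \<alpha> and i.\<close>
      define Kq where "Kq q = \<bar>SOME CQ. poincare (weighted w) p q CQ\<bar> * C0 ^ 3" for q
      show "\<exists>K. \<forall>f \<alpha>. ?dat w f \<alpha> \<longrightarrow> ?concl ?N C w K f \<alpha>"
      proof (rule exI[of _ Kq], rule allI, rule allI, rule impI)
        fix f :: "real ^ 'n \<Rightarrow> complex" and \<alpha> :: real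
        assume f: "?dat w f \<alpha>"
        interpret cz: calderon_zygmund "weighted w" C0 f p CP \<alpha>
          using dm poin f assms
          by (intro calderon_zygmund.intro calderon_zygmund_axioms.intro) (auto simp: CP_def)
        obtain A where A: "countable A" "A \<subseteq> cz.U"
          "\<And>x y. x \<in> A \<Longrightarrow> y \<in> A \<Longrightarrow> x \<noteq> y \<Longrightarrow> ball x (cz.d x / 20) \<inter> ball y (cz.d y / 20) = {}"
          "\<And>z. z \<in> cz.U \<Longrightarrow> \<exists>x\<in>A. dist z x \<le> 3/20 * cz.d x"
          using whitney_covering[OF cz.open_U cz.U_ne, folded cz.d_def] by blast
        \<comment> \<open>The set of centres may be finite or empty, so it is enumerated by a subset
          of the natural numbers and not by a sequence.\<close>
        define I where "I = to_nat_on A ` A"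
        define c where "c = from_nat_into A"
        have c: "c (to_nat_on A a) = a" if "a \<in> A" for a
          unfolding c_def using A(1) that by simp
        interpret cz: calderon_zygmund_covering "weighted w" C0 f p CP \<alpha> I c \<kappa>
        proof
          show "c i \<in> cz.U" if "i \<in> I" for i
            using that A(2) c by (auto simp: I_def)
          show "ball (c i) (cz.d (c i) / 20) \<inter> ball (c j) (cz.d (c j) / 20) = {}"
            if "i \<in> I" "j \<in> I" "i \<noteq> j" for i j
          proof -
            obtain a a' where "a \<in> A" "i = to_nat_on A a" "a' \<in> A" "j = to_nat_on A a'"
              using \<open>i \<in> I\<close> \<open>j \<in> I\<close> unfolding I_def by blast
            then show ?thesis using A(3)[of a a'] c \<open>i \<noteq> j\<close> by metis
          qed
          show "\<exists>i\<in>I. dist z (c i) \<le> 3/20 * cz.d (c i)" if "z \<in> cz.U" for z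
          proof -
            obtain x where "x \<in> A" "dist z x \<le> 3/20 * cz.d x" using A(4) \<open>z \<in> cz.U\<close> by blast
            then show ?thesis using c by (intro bexI[of _ "to_nat_on A x"]) (auto simp: I_def)
          qed
        qed (use \<kappa> in auto)
        have J: "0 \<le> (LINT x|weighted w. norm (grad f x) powr p)" by simp
        have \<alpha>: "0 < \<alpha>" using f by blast
        obtain L where L: "L-lipschitz_on UNIV cz.g" using cz.g_lipschitz by blast
        have "\<forall>i\<in>I. 0 < cz.r i \<and> smooth (cz.b i)"
          using cz.r_pos cz.smooth_b by blast
        moreover have "locally_integrable (weighted w) cz.g"
          by (rule cz.locally_integrable_continuous[OF lipschitz_on_continuous_on[OF L]])
        moreover have "\<forall>x. ((\<lambda>i. cz.b i x) has_sum (f x - cz.g x)) I"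
          using cz.has_sum_b by blast
        moreover have "gradient_bounded (weighted w) cz.g (C * \<alpha>)"
        proof (rule gradient_bounded_weighted[OF wm L])
          have "C1 * \<alpha> \<le> C * \<alpha>" using C(1) \<alpha> by (intro mult_right_mono) auto
          then have "cz.g differentiable (at x) \<and> norm (grad cz.g x) \<le> C * \<alpha>"
            if "cz.g differentiable (at x) \<and> norm (grad cz.g x) \<le> C1 * \<alpha>" for x
            using that by linarith
          with cz.AE_g[folded C1_def]
          show "AE x in weighted w. cz.g differentiable (at x) \<and> norm (grad cz.g x) \<le> C * \<alpha>"
            by (rule eventually_mono)
        qed
        moreover have "\<forall>i\<in>I. supp (cz.b i) \<subseteq> ball (c i) (cz.r i) \<and>
          (LINT x:ball (c i) (cz.r i)|weighted w. norm (grad (cz.b i) x) powr p)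
            \<le> C * \<alpha> powr p * measure (weighted w) (ball (c i) (cz.r i))"
        proof (rule ballI, rule conjI)
          fix i assume i: "i \<in> I"
          show "supp (cz.b i) \<subseteq> ball (c i) (cz.r i)" by (rule cz.supp_b[OF i])
          have "(LINT x:ball (c i) (cz.r i)|weighted w. norm (grad (cz.b i) x) powr p)
              \<le> C2 * \<alpha> powr p * measure (weighted w) (ball (c i) (cz.r i))"
            unfolding C2_def by (rule cz.set_integral_grad_b[OF i])
          also have "\<dots> \<le> C * \<alpha> powr p * measure (weighted w) (ball (c i) (cz.r i))"
            using C(2) by (intro mult_right_mono) auto
          finally show "(LINT x:ball (c i) (cz.r i)|weighted w. norm (grad (cz.b i) x) powr p)
              \<le> C * \<alpha> powr p * measure (weighted w) (ball (c i) (cz.r i))" .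
        qed
        moreover have "(\<Sum>\<^sub>\<infinity>i\<in>I. emeasure (weighted w) (ball (c i) (cz.r i)))
          \<le> ennreal (C * \<alpha> powr (- p) * (LINT x|weighted w. norm (grad f x) powr p))"
        proof (rule order_trans[OF cz.infsum_emeasure_balls], unfold cz.energy_def, rule ennreal_leI)
          show "C0 ^ 6 * \<alpha> powr (- p) * (LINT x|weighted w. norm (grad f x) powr p)
              \<le> C * \<alpha> powr (- p) * (LINT x|weighted w. norm (grad f x) powr p)"
            using C(3) J by (intro mult_right_mono) auto
        qed
        moreover have "\<forall>x. (\<Sum>\<^sub>\<infinity>i\<in>I. indicator (ball (c i) (cz.r i)) x :: ennreal) \<le> of_nat ?N"
          by (intro allI cz.infsum_indicator_balls)
        moreover have "\<forall>q. p \<le> q \<and> (\<exists>CQ. poincare (weighted w) p q CQ) \<longrightarrow>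
          (\<forall>i\<in>I. (average (weighted w) (ball (c i) (cz.r i)) (\<lambda>x. norm (cz.b i x) powr q)) powr (1 / q)
             \<le> Kq q * \<alpha> * cz.r i)"
        proof (intro allI impI ballI, elim conjE)
          fix q i assume q: "p \<le> q" "\<exists>CQ. poincare (weighted w) p q CQ" and i: "i \<in> I"
          show "(average (weighted w) (ball (c i) (cz.r i)) (\<lambda>x. norm (cz.b i x) powr q)) powr (1 / q)
             \<le> Kq q * \<alpha> * cz.r i"
            unfolding Kq_def by (rule cz.average_b_powr_le[OF i q(1) someI_ex[OF q(2)]])
        qed
        ultimately show "?concl ?N C w Kq f \<alpha>"
          by (intro exI[of _ I] exI[of _ c] exI[of _ cz.r] exI[of _ cz.b] exI[of _ cz.g] conjI)
      qed
    qed
  qed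
qed

end
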